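(* Let $W$ be a finite real reflection group and let $m$ be a positive integer. Then $m$ is an elliptic number for $W$ if and only if for every maximal parabolic subgroup $W'$ of $W$ one has $a_W(m)>a_{W'}(m)$.
   Context: $W$ is a finite real reflection group with (complexified) reflection representation $\mathfrak h$ of dimension $r$ (with no nonzero $W$-fixed vectors). A parabolic subgroup is the stabilizer in $W$ of a point of $\mathfrak h$, itself a finite reflection group; a maximal parabolic subgroup is a maximal element among proper parabolic subgroups. An elliptic element of $W$ is an element not contained in any proper parabolic subgroup, equivalently an element whose fixed space in $\mathfrak h$ is $\{0\}$. A vector of $\mathfrak h$ is regular if it is not fixed by any reflection of $W$. A positive integer $m$ is a regular number for $W$ if there is an element $g\in W$ that has a regular eigenvector with eigenvalue a primitive $m$-th root of $1$. If in addition this element $g$ can be chosen to be elliptic, $m$ is called an elliptic number for $W$. $d_1(W),\dots,d_r(W)$ are the degrees of $W$ (degrees of homogeneous generators of $\mathbb C[\mathfrak h]^W$), and $a_W(m)=\#\{1\le i\le r\mid m\text{ divides } d_i(W)\}$; $a_{W'}(m)$ is defined in the same way for the reflection group $W'$ acting on its own reflection representation $\mathfrak h/\mathfrak h^{W'}$.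
   Formalization: The case m = 1 is excluded, because there the claim fails for every W of positive rank: 1 is never elliptic, yet a_W(1) > a_{W'}(1) for every maximal parabolic subgroup W'; the degenerate rank 0 case is also left out. *)

theory Defs
  imports "HOL-Analysis.Analysis" "HOL-Algebra.Generated_Groups"
begin

text \<open>
  A real reflection group of rank \<open>r = CARD('n)\<close> is a set \<open>W\<close> of real \<open>r \<times> r\<close> matrices.  The
  complexified reflection representation is \<open>complex ^ 'n\<close>, on which a real matrix acts through its
  entries.  The rank is positive because index types are nonempty.
\<close>

definition act :: "real ^ 'n ^ 'n \<Rightarrow> complex ^ 'n \<Rightarrow> complex ^ 'n" where
  "act g v = map_matrix complex_of_real g *v v"

definition GL :: "(real ^ 'n ^ 'n) monoid" where
  "GL = \<lparr>carrier = {g. invertible g}, mult = (**), one = mat 1\<rparr>"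

definition reflection :: "real ^ 'n ^ 'n \<Rightarrow> bool" where
  "reflection s \<longleftrightarrow> s ** s = mat 1 \<and> dim {x. s *v x = x} + 1 = CARD('n)"

definition fixed_space :: "(real ^ 'n ^ 'n) set \<Rightarrow> (complex ^ 'n) set" where
  "fixed_space G = {v. \<forall>g\<in>G. act g v = v}"

text \<open>
  No inner product is fixed: a finite linear group preserves one, so this agrees with the
  definition by orthogonal reflections.
\<close>

definition real_reflection_group :: "(real ^ 'n ^ 'n) set \<Rightarrow> bool" where
  "real_reflection_group W \<longleftrightarrow>
     finite W \<and> generate GL {s \<in> W. reflection s} = W \<and> fixed_space W = {0}"

definition parabolic :: "(real ^ 'n ^ 'n) set \<Rightarrow> (real ^ 'n ^ 'n) set \<Rightarrow> bool" where
  "parabolic W P \<longleftrightarrow> (\<exists>v. P = {g \<in> W. act g v = v})"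

definition proper_parabolic :: "(real ^ 'n ^ 'n) set \<Rightarrow> (real ^ 'n ^ 'n) set \<Rightarrow> bool" where
  "proper_parabolic W P \<longleftrightarrow> parabolic W P \<and> P \<noteq> W"

definition maximal_parabolic :: "(real ^ 'n ^ 'n) set \<Rightarrow> (real ^ 'n ^ 'n) set \<Rightarrow> bool" where
  "maximal_parabolic W P \<longleftrightarrow>
     proper_parabolic W P \<and> (\<forall>Q. proper_parabolic W Q \<and> P \<subseteq> Q \<longrightarrow> Q = P)"

definition elliptic_element :: "(real ^ 'n ^ 'n) set \<Rightarrow> real ^ 'n ^ 'n \<Rightarrow> bool" where
  "elliptic_element W g \<longleftrightarrow> g \<in> W \<and> (\<forall>P. proper_parabolic W P \<longrightarrow> g \<notin> P)"

definition regular_vector :: "(real ^ 'n ^ 'n) set \<Rightarrow> complex ^ 'n \<Rightarrow> bool" where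
  "regular_vector W v \<longleftrightarrow> (\<forall>s\<in>W. reflection s \<longrightarrow> act s v \<noteq> v)"

definition primitive_root_of_unity :: "nat \<Rightarrow> complex \<Rightarrow> bool" where
  "primitive_root_of_unity m z \<longleftrightarrow> z ^ m = 1 \<and> (\<forall>k. 0 < k \<and> k < m \<longrightarrow> z ^ k \<noteq> 1)"

definition has_regular_eigenvector ::
    "(real ^ 'n ^ 'n) set \<Rightarrow> nat \<Rightarrow> real ^ 'n ^ 'n \<Rightarrow> bool" where
  "has_regular_eigenvector W m g \<longleftrightarrow>
     (\<exists>v z. v \<noteq> 0 \<and> regular_vector W v \<and> primitive_root_of_unity m z \<and> act g v = z *s v)"

definition regular_number :: "(real ^ 'n ^ 'n) set \<Rightarrow> nat \<Rightarrow> bool" where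
  "regular_number W m \<longleftrightarrow> 0 < m \<and> (\<exists>g\<in>W. has_regular_eigenvector W m g)"

text \<open>
  The number 1 is never elliptic: an element fixing a nonzero vector lies in the stabilizer of that
  vector, which is a proper parabolic subgroup because only 0 is fixed by the whole group.
\<close>

definition elliptic_number :: "(real ^ 'n ^ 'n) set \<Rightarrow> nat \<Rightarrow> bool" where
  "elliptic_number W m \<longleftrightarrow>
     regular_number W m \<and> (\<exists>g\<in>W. has_regular_eigenvector W m g \<and> elliptic_element W g)"

text \<open>
  Polynomials over the infinite field \<^typ>\<open>complex\<close> are identified with polynomial functions, and
  \<open>generated_algebra S\<close> is the unital algebra of functions generated by \<open>S\<close>.
\<close>

inductive_set generated_algebra :: "('a \<Rightarrow> complex) set \<Rightarrow> ('a \<Rightarrow> complex) set"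
  for S :: "('a \<Rightarrow> complex) set" where
  generator: "f \<in> S \<Longrightarrow> f \<in> generated_algebra S"
| const: "(\<lambda>_. c) \<in> generated_algebra S"
| add: "f \<in> generated_algebra S \<Longrightarrow> g \<in> generated_algebra S
          \<Longrightarrow> (\<lambda>x. f x + g x) \<in> generated_algebra S"
| mult: "f \<in> generated_algebra S \<Longrightarrow> g \<in> generated_algebra S
          \<Longrightarrow> (\<lambda>x. f x * g x) \<in> generated_algebra S"

definition polynomial_functions :: "(complex ^ 'n \<Rightarrow> complex) set" where
  "polynomial_functions = generated_algebra (range (\<lambda>i x. x $ i))"

definition polynomials_in :: "nat \<Rightarrow> ((nat \<Rightarrow> complex) \<Rightarrow> complex) set" where
  "polynomials_in k = generated_algebra ((\<lambda>i y. y i) ` {..<k})"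

definition homogeneous :: "nat \<Rightarrow> (complex ^ 'n \<Rightarrow> complex) \<Rightarrow> bool" where
  "homogeneous d f \<longleftrightarrow> (\<forall>c x. f (c *s x) = c ^ d * f x)"

definition algebraically_independent :: "(complex ^ 'n \<Rightarrow> complex) list \<Rightarrow> bool" where
  "algebraically_independent fs \<longleftrightarrow>
     (\<forall>p \<in> polynomials_in (length fs). (\<forall>x. p (\<lambda>i. (fs ! i) x) = 0) \<longrightarrow> p = (\<lambda>_. 0))"

text \<open>
  The reflection representation of \<open>G\<close> is the quotient of \<open>complex ^ 'n\<close> by \<open>fixed_space G\<close>.
  Polynomial functions on this quotient are represented by their pullbacks to \<open>complex ^ 'n\<close>, that
  is, by the polynomial functions that are invariant under translation by \<open>fixed_space G\<close>.
\<close>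

definition reflection_rank :: "(real ^ 'n ^ 'n) set \<Rightarrow> nat" where
  "reflection_rank G = CARD('n) - vec.dim (fixed_space G)"

definition invariant_ring :: "(real ^ 'n ^ 'n) set \<Rightarrow> (complex ^ 'n \<Rightarrow> complex) set" where
  "invariant_ring G = {f \<in> polynomial_functions.
     (\<forall>v\<in>fixed_space G. \<forall>x. f (x + v) = f x) \<and> (\<forall>g\<in>G. \<forall>x. f (act g x) = f x)}"

definition basic_invariants ::
    "(real ^ 'n ^ 'n) set \<Rightarrow> (complex ^ 'n \<Rightarrow> complex) list \<Rightarrow> nat list \<Rightarrow> bool" where
  "basic_invariants G fs ds \<longleftrightarrow>
     length fs = reflection_rank G \<and> list_all2 homogeneous ds fs \<and>
     algebraically_independent fs \<and> generated_algebra (set fs) = invariant_ring G"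

text \<open>
  By the theorem of Chevalley basic invariants of a finite reflection group exist, and their
  degrees are unique up to order.
\<close>

definition degrees :: "(real ^ 'n ^ 'n) set \<Rightarrow> nat list" where
  "degrees G = (SOME ds. \<exists>fs. basic_invariants G fs ds)"

definition num_degrees_divisible :: "(real ^ 'n ^ 'n) set \<Rightarrow> nat \<Rightarrow> nat" where
  "num_degrees_divisible G m = card {i. i < length (degrees G) \<and> m dvd degrees G ! i}"

end

theory Submission
  imports Defs "HOL-Computational_Algebra.Fundamental_Theorem_Algebra"
begin

text \<open>
  Let \<open>z\<close> be a primitive \<open>m\<close>-th root of unity with \<open>z \<noteq> 1\<close>, and write \<open>V(g, z)\<close> for the eigenspace of
  \<open>g\<close>.  The theorem follows from Springer's results on a finite reflection group \<open>G\<close>: the largest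
  dimension of the spaces \<open>V(g, z)\<close> is the number of degrees of \<open>G\<close> that \<open>m\<close> divides
  (\<open>dim_eigenspace_le_degrees\<close>, \<open>ex_eigenspace_ge_degrees\<close>), and if \<open>V(g, z)\<close> has this dimension, then the
  group moves every eigenvector for \<open>z\<close> into it (\<open>eigenvector_conjugate_into\<close>).  These are applied to
  \<open>W\<close> and to its maximal parabolic subgroups, whose degree counts are therefore at most that of \<open>W\<close>.

  Let \<open>g\<close> be elliptic with a regular eigenvector \<open>v\<close> for \<open>z\<close>.  If some maximal parabolic subgroup \<open>P\<close> had
  the degree count of \<open>W\<close>, then some \<open>h\<close> in \<open>P\<close> would have an eigenspace of the largest dimension for
  \<open>W\<close>, and \<open>v\<close> could be moved into it.  A conjugate of \<open>h\<close> then agrees with \<open>g\<close> on \<open>v\<close>, hence equals \<open>g\<close>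
  because the stabilizer of a regular vector is trivial, and \<open>g\<close> lies in a proper parabolic subgroup.

  Conversely, let the degree counts of all maximal parabolic subgroups be smaller, and let \<open>E = V(g, z)\<close>
  have the largest dimension for \<open>W\<close>.  An element that acts by \<open>z\<close> on \<open>E\<close> is then in no proper parabolic
  subgroup.  If \<open>E\<close> contained no regular vector, its pointwise stabilizer would contain a reflection.
  The element \<open>g\<close> permutes the chambers of that stabilizer, and can be multiplied by an element of it so
  that the product preserves a chamber; the product fixes a nonzero real vector of this chamber
  (\<open>ex_fixing_element\<close>) and still acts by \<open>z\<close> on \<open>E\<close>, a contradiction.

  Springer's results come from the map whose components are basic invariants.  An eigenvector for \<open>z\<close>
  is a common zero of the invariants whose degree \<open>m\<close> does not divide; conversely, for a common zero
  \<open>x\<close>, all invariants agree at \<open>x\<close> and \<open>z x\<close>, so these two vectors are in one orbit.  Dimensions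
  are compared by topological means.  The quotient map is locally injective on a subspace near generic
  points, so invariance of domain bounds the dimension of an eigenspace and produces interior points of
  its image (\<open>dim_le_coordinates\<close>, \<open>coordinate_map_open_image\<close>).  It is surjective
  (\<open>quotient_map_surjective\<close>), and finitely many smooth images of small subspaces cannot cover a larger one
  (\<open>not_covered_by_small_images\<close>).

  Basic invariants exist by Chevalley's theorem (\<open>ex_basic_invariants\<close>), which rests on divided
  differences by the linear forms of the reflections (\<open>homogeneous_syzygy\<close>).  It is applicable to
  parabolic subgroups because these are generated by reflections, by Steinberg's theorem
  (\<open>stabilizer_reflection_group\<close>); this is deduced from simple roots and the free action on chambers.
\<close>


section \<open>Algebras of functions\<close>

lemma generated_algebra_sum:
  assumes "\<And>i. i \<in> I \<Longrightarrow> f i \<in> generated_algebra S"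
  shows "(\<lambda>x. \<Sum>i\<in>I. f i x) \<in> generated_algebra S"
  using assms
  by (induction I rule: infinite_finite_induct)
    (auto intro: generated_algebra.const generated_algebra.add)

lemma generated_algebra_cmult:
  assumes "f \<in> generated_algebra S"
  shows "(\<lambda>x. c * f x) \<in> generated_algebra S"
  using generated_algebra.mult[OF generated_algebra.const assms] .

lemma generated_algebra_diff:
  assumes "f \<in> generated_algebra S" "g \<in> generated_algebra S"
  shows "(\<lambda>x. f x - g x) \<in> generated_algebra S"
  using generated_algebra.add[OF assms(1) generated_algebra_cmult[OF assms(2), of "-1"]] by simp

lemma generated_algebra_compose:
  assumes "p \<in> generated_algebra S" "\<And>f. f \<in> S \<Longrightarrow> (\<lambda>x. f (\<phi> x)) \<in> generated_algebra T"
  shows "(\<lambda>x. p (\<phi> x)) \<in> generated_algebra T"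
  using assms(1)
  by induction (auto intro: assms(2) generated_algebra.intros)

lemma generated_algebra_poly_along_curve:
  assumes "p \<in> generated_algebra S" "\<And>f. f \<in> S \<Longrightarrow> \<exists>q. \<forall>t. f (\<gamma> t) = poly q t"
  shows "\<exists>q. \<forall>t. p (\<gamma> t) = poly q t"
  using assms(1)
proof induction
  case (const c)
  show ?case by (rule exI[of _ "[:c:]"]) simp
next
  case (add f g)
  then obtain q r where "\<forall>t. f (\<gamma> t) = poly q t" "\<forall>t. g (\<gamma> t) = poly r t" by blast
  then show ?case by (intro exI[of _ "q + r"]) simp
next
  case (mult f g)
  then obtain q r where "\<forall>t. f (\<gamma> t) = poly q t" "\<forall>t. g (\<gamma> t) = poly r t" by blast
  then show ?case by (intro exI[of _ "q * r"]) simp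
qed (rule assms(2))

text \<open>
  The partial derivatives \<open>D i\<close> are built along the derivation of \<open>p\<close> from the generators by the
  sum and product rules.  The generators may be dependent, so the \<open>D i\<close> are not unique; the chain rule
  is their defining property.
\<close>

lemma generated_algebra_chain_rule:
  assumes "finite I" "p \<in> generated_algebra (\<xi> ` I)"
  obtains D where "\<And>i. i \<in> I \<Longrightarrow> D i \<in> generated_algebra (\<xi> ` I)"
    "\<And>\<gamma> u t. (\<And>i. i \<in> I \<Longrightarrow> ((\<lambda>t. \<xi> i (\<gamma> t)) has_field_derivative u i) (at t)) \<Longrightarrow>
       ((\<lambda>t. p (\<gamma> t)) has_field_derivative (\<Sum>i\<in>I. D i (\<gamma> t) * u i)) (at t)"
proof -
  have "\<exists>D. (\<forall>i\<in>I. D i \<in> generated_algebra (\<xi> ` I)) \<and>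
    (\<forall>\<gamma> u t. (\<forall>i\<in>I. ((\<lambda>t. \<xi> i (\<gamma> t)) has_field_derivative u i) (at t)) \<longrightarrow>
       ((\<lambda>t. p (\<gamma> t)) has_field_derivative (\<Sum>i\<in>I. D i (\<gamma> t) * u i)) (at t))"
    using assms(2)
  proof induction
    case (generator f)
    then obtain j where j: "j \<in> I" "f = \<xi> j" by blast
    have "(\<Sum>i\<in>I. (if i = j then 1 else 0) * u i) = u j" for u :: "_ \<Rightarrow> complex"
      using j(1) assms(1) by (simp add: if_distrib[of "\<lambda>x. x * _"] cong: if_cong)
    then show ?case
      using j by (intro exI[of _ "\<lambda>i _. if i = j then 1 else 0"])
        (auto intro: generated_algebra.const)
  next
    case (const c)
    show ?case
      by (rule exI[of _ "\<lambda>i _. 0"]) (auto intro: generated_algebra.const)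
  next
    case (add f g)
    then obtain D E where D: "\<forall>i\<in>I. D i \<in> generated_algebra (\<xi> ` I)"
      "\<And>\<gamma> u t. (\<forall>i\<in>I. ((\<lambda>t. \<xi> i (\<gamma> t)) has_field_derivative u i) (at t)) \<Longrightarrow>
       ((\<lambda>t. f (\<gamma> t)) has_field_derivative (\<Sum>i\<in>I. D i (\<gamma> t) * u i)) (at t)"
      and E: "\<forall>i\<in>I. E i \<in> generated_algebra (\<xi> ` I)"
      "\<And>\<gamma> u t. (\<forall>i\<in>I. ((\<lambda>t. \<xi> i (\<gamma> t)) has_field_derivative u i) (at t)) \<Longrightarrow>
       ((\<lambda>t. g (\<gamma> t)) has_field_derivative (\<Sum>i\<in>I. E i (\<gamma> t) * u i)) (at t)"
      by blast
    have "((\<lambda>t. f (\<gamma> t) + g (\<gamma> t)) has_field_derivative (\<Sum>i\<in>I. (D i (\<gamma> t) + E i (\<gamma> t)) * u i)) (at t)"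
      if "\<forall>i\<in>I. ((\<lambda>t. \<xi> i (\<gamma> t)) has_field_derivative u i) (at t)" for \<gamma> u t
      using DERIV_add[OF D(2)[OF that] E(2)[OF that]]
      by (simp add: sum.distrib distrib_right)
    then show ?case
      using D(1) E(1)
      by (intro exI[of _ "\<lambda>i x. D i x + E i x"]) (auto intro: generated_algebra.add)
  next
    case (mult f g)
    then obtain D E where D: "\<forall>i\<in>I. D i \<in> generated_algebra (\<xi> ` I)"
      "\<And>\<gamma> u t. (\<forall>i\<in>I. ((\<lambda>t. \<xi> i (\<gamma> t)) has_field_derivative u i) (at t)) \<Longrightarrow>
       ((\<lambda>t. f (\<gamma> t)) has_field_derivative (\<Sum>i\<in>I. D i (\<gamma> t) * u i)) (at t)"
      and E: "\<forall>i\<in>I. E i \<in> generated_algebra (\<xi> ` I)"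
      "\<And>\<gamma> u t. (\<forall>i\<in>I. ((\<lambda>t. \<xi> i (\<gamma> t)) has_field_derivative u i) (at t)) \<Longrightarrow>
       ((\<lambda>t. g (\<gamma> t)) has_field_derivative (\<Sum>i\<in>I. E i (\<gamma> t) * u i)) (at t)"
      by blast
    have "((\<lambda>t. f (\<gamma> t) * g (\<gamma> t)) has_field_derivative
        (\<Sum>i\<in>I. (D i (\<gamma> t) * g (\<gamma> t) + f (\<gamma> t) * E i (\<gamma> t)) * u i)) (at t)"
      if "\<forall>i\<in>I. ((\<lambda>t. \<xi> i (\<gamma> t)) has_field_derivative u i) (at t)" for \<gamma> u t
      using DERIV_mult[OF D(2)[OF that] E(2)[OF that]]
      by (simp add: sum.distrib distrib_left sum_distrib_left mult_ac add_ac)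
    then show ?case
      using D(1) E(1) mult.hyps
      by (intro exI[of _ "\<lambda>i x. D i x * g x + f x * E i x"])
        (auto intro!: generated_algebra.add generated_algebra.mult)
  qed
  then show thesis using that by blast
qed

lemma poly_eqI_all:
  fixes p q :: "complex poly"
  assumes "\<And>t. poly p t = poly q t"
  shows "p = q"
  using assms poly_eq_poly_eq_iff by blast

section \<open>Gradings\<close>

text \<open>
  A grading of an algebra of functions is given by a scaling \<open>\<sigma>\<close> of the underlying space: the part
  of degree \<open>d\<close> of \<open>p\<close> at \<open>x\<close> is the coefficient of \<open>t ^ d\<close> in \<open>p (\<sigma> t x)\<close>.  It depends on
  nothing but these values, so it commutes with every map that commutes with the scalings.
\<close>

definition graded_part :: "(complex \<Rightarrow> 'a \<Rightarrow> 'a) \<Rightarrow> nat \<Rightarrow> ('a \<Rightarrow> complex) \<Rightarrow> 'a \<Rightarrow> complex" where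
  "graded_part \<sigma> d p x = coeff (SOME q. \<forall>t. p (\<sigma> t x) = poly q t) d"

definition weighted_homogeneous :: "(complex \<Rightarrow> 'a \<Rightarrow> 'a) \<Rightarrow> nat \<Rightarrow> ('a \<Rightarrow> complex) \<Rightarrow> bool" where
  "weighted_homogeneous \<sigma> d p \<longleftrightarrow> (\<forall>c x. p (\<sigma> c x) = c ^ d * p x)"

lemma graded_part_eq:
  assumes "\<And>t. p (\<sigma> t x) = poly q t"
  shows "graded_part \<sigma> d p x = coeff q d"
proof -
  have "(SOME q. \<forall>t. p (\<sigma> t x) = poly q t) = q"
    by (rule some_equality) (use assms in \<open>auto intro!: poly_eqI_all\<close>)
  then show ?thesis by (simp add: graded_part_def)
qed

text \<open>
  Two instances occur: vectors with the usual scaling, and tuples in which each variable is scaled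
  by a power that is the degree of the invariant to be substituted for it.
\<close>

locale graded_algebra =
  fixes \<sigma> :: "complex \<Rightarrow> 'a \<Rightarrow> 'a" and S :: "('a \<Rightarrow> complex) set"
  assumes scale_one: "\<sigma> 1 x = x"
    and scale_scale: "\<sigma> s (\<sigma> t x) = \<sigma> (s * t) x"
    and generator_homogeneous: "f \<in> S \<Longrightarrow> \<exists>e. weighted_homogeneous \<sigma> e f"
begin

lemma ex_poly:
  assumes "p \<in> generated_algebra S"
  shows "\<exists>q. \<forall>t. p (\<sigma> t x) = poly q t"
proof (rule generated_algebra_poly_along_curve[OF assms])
  fix f assume "f \<in> S"
  then obtain e where "weighted_homogeneous \<sigma> e f" using generator_homogeneous by blast
  then have "\<forall>t. f (\<sigma> t x) = poly (monom (f x) e) t"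
    by (simp add: weighted_homogeneous_def poly_monom mult.commute)
  then show "\<exists>q. \<forall>t. f (\<sigma> t x) = poly q t" by blast
qed

lemma obtain_poly:
  assumes "p \<in> generated_algebra S"
  obtains q where "\<And>t. p (\<sigma> t x) = poly q t" "\<And>d. graded_part \<sigma> d p x = coeff q d"
  using ex_poly[OF assms, of x] graded_part_eq by metis

lemma graded_part_add:
  assumes "p \<in> generated_algebra S" "q \<in> generated_algebra S"
  shows "graded_part \<sigma> d (\<lambda>x. p x + q x) x = graded_part \<sigma> d p x + graded_part \<sigma> d q x"
proof -
  obtain a where a: "\<And>t. p (\<sigma> t x) = poly a t" "\<And>d. graded_part \<sigma> d p x = coeff a d"
    using obtain_poly[OF assms(1)] by blast
  obtain b where b: "\<And>t. q (\<sigma> t x) = poly b t" "\<And>d. graded_part \<sigma> d q x = coeff b d"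
    using obtain_poly[OF assms(2)] by blast
  have "graded_part \<sigma> d (\<lambda>x. p x + q x) x = coeff (a + b) d"
    by (rule graded_part_eq) (simp add: a b)
  then show ?thesis by (simp add: a b)
qed

lemma graded_part_mult:
  assumes "p \<in> generated_algebra S" "q \<in> generated_algebra S"
  shows "graded_part \<sigma> d (\<lambda>x. p x * q x) x = (\<Sum>i\<le>d. graded_part \<sigma> i p x * graded_part \<sigma> (d - i) q x)"
proof -
  obtain a where a: "\<And>t. p (\<sigma> t x) = poly a t" "\<And>d. graded_part \<sigma> d p x = coeff a d"
    using obtain_poly[OF assms(1)] by blast
  obtain b where b: "\<And>t. q (\<sigma> t x) = poly b t" "\<And>d. graded_part \<sigma> d q x = coeff b d"
    using obtain_poly[OF assms(2)] by blast
  have "graded_part \<sigma> d (\<lambda>x. p x * q x) x = coeff (a * b) d"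
    by (rule graded_part_eq) (simp add: a b)
  then show ?thesis by (simp add: a b coeff_mult)
qed

lemma graded_part_const: "graded_part \<sigma> d (\<lambda>_. c) x = (if d = 0 then c else 0)"
proof -
  have "graded_part \<sigma> d (\<lambda>_. c) x = coeff [:c:] d"
    by (rule graded_part_eq) simp
  then show ?thesis by (auto simp: coeff_pCons split: nat.splits)
qed

lemma graded_part_homogeneous:
  assumes "weighted_homogeneous \<sigma> e p"
  shows "graded_part \<sigma> d p x = (if d = e then p x else 0)"
proof -
  have "graded_part \<sigma> d p x = coeff (monom (p x) e) d"
    by (rule graded_part_eq) (use assms in \<open>simp add: weighted_homogeneous_def poly_monom\<close>)
  then show ?thesis by auto
qed

lemma graded_part_mult_homogeneous:
  assumes "p \<in> generated_algebra S" "q \<in> generated_algebra S" "weighted_homogeneous \<sigma> e q"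
  shows "graded_part \<sigma> d (\<lambda>x. p x * q x) x = (if e \<le> d then graded_part \<sigma> (d - e) p x * q x else 0)"
proof -
  obtain a where a: "\<And>t. p (\<sigma> t x) = poly a t" "\<And>d. graded_part \<sigma> d p x = coeff a d"
    using obtain_poly[OF assms(1)] by blast
  have "graded_part \<sigma> d (\<lambda>x. p x * q x) x = coeff (monom (q x) e * a) d"
    by (rule graded_part_eq)
      (use assms(3) in \<open>simp add: a weighted_homogeneous_def poly_monom mult_ac\<close>)
  then show ?thesis by (auto simp: a coeff_monom_mult)
qed

lemma graded_part_sum:
  assumes "\<And>i. i \<in> I \<Longrightarrow> p i \<in> generated_algebra S"
  shows "graded_part \<sigma> d (\<lambda>x. \<Sum>i\<in>I. p i x) x = (\<Sum>i\<in>I. graded_part \<sigma> d (p i) x)"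
  using assms
proof (induction I rule: infinite_finite_induct)
  case (insert i I)
  then show ?case by (simp add: graded_part_add generated_algebra_sum)
qed (simp_all add: graded_part_const)

lemma graded_part_in:
  assumes "p \<in> generated_algebra S"
  shows "graded_part \<sigma> d p \<in> generated_algebra S"
  using assms
proof (induction arbitrary: d)
  case (generator f)
  then obtain e where "weighted_homogeneous \<sigma> e f" using generator_homogeneous by blast
  then have "graded_part \<sigma> d f = (if d = e then f else (\<lambda>_. 0))"
    using graded_part_homogeneous by auto
  then show ?case using generator by (simp add: generated_algebra.intros)
next
  case (const c)
  have "graded_part \<sigma> d (\<lambda>_. c) = (\<lambda>_. if d = 0 then c else 0)"
    using graded_part_const by auto
  then show ?case by (simp add: generated_algebra.const)
next
  case (add f g)
  have "graded_part \<sigma> d (\<lambda>x. f x + g x) = (\<lambda>x. graded_part \<sigma> d f x + graded_part \<sigma> d g x)"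
    using graded_part_add[OF add.hyps] by auto
  then show ?case using add.IH by (simp add: generated_algebra.add)
next
  case (mult f g)
  have "graded_part \<sigma> d (\<lambda>x. f x * g x)
    = (\<lambda>x. \<Sum>i\<le>d. graded_part \<sigma> i f x * graded_part \<sigma> (d - i) g x)"
    using graded_part_mult[OF mult.hyps] by auto
  then show ?case using mult.IH by (simp add: generated_algebra.mult generated_algebra_sum)
qed

lemma weighted_homogeneous_graded_part:
  assumes "p \<in> generated_algebra S"
  shows "weighted_homogeneous \<sigma> d (graded_part \<sigma> d p)"
  unfolding weighted_homogeneous_def
proof (intro allI)
  fix c x
  obtain a where a: "\<And>t. p (\<sigma> t x) = poly a t" "\<And>d. graded_part \<sigma> d p x = coeff a d"
    using obtain_poly[OF assms] by blast
  have "graded_part \<sigma> d p (\<sigma> c x) = coeff (pcompose a [:0, c:]) d"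
    by (rule graded_part_eq) (simp add: scale_scale a poly_pcompose mult.commute)
  then show "graded_part \<sigma> d p (\<sigma> c x) = c ^ d * graded_part \<sigma> d p x"
    by (simp add: coeff_pcompose_linear a)
qed

lemma sum_graded_parts:
  assumes "p \<in> generated_algebra S"
  obtains N where "\<And>x. p x = (\<Sum>d\<le>N. graded_part \<sigma> d p x)"
proof -
  have "\<exists>N. \<forall>x. \<forall>d>N. graded_part \<sigma> d p x = 0"
    using assms
  proof induction
    case (generator f)
    then obtain e where "weighted_homogeneous \<sigma> e f" using generator_homogeneous by blast
    then show ?case using graded_part_homogeneous by auto
  next
    case (const c)
    show ?case by (auto simp: graded_part_const)
  next
    case (add f g)
    then obtain M N where "\<forall>x. \<forall>d>M. graded_part \<sigma> d f x = 0" "\<forall>x. \<forall>d>N. graded_part \<sigma> d g x = 0"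
      by blast
    then show ?case
      by (intro exI[of _ "max M N"]) (simp add: graded_part_add[OF add.hyps])
  next
    case (mult f g)
    then obtain M N where MN: "\<forall>x. \<forall>d>M. graded_part \<sigma> d f x = 0" "\<forall>x. \<forall>d>N. graded_part \<sigma> d g x = 0"
      by blast
    have "graded_part \<sigma> i f x * graded_part \<sigma> (d - i) g x = 0" if "d > M + N" for d i x
      using MN that by (cases "i > M") auto
    then show ?case
      by (intro exI[of _ "M + N"]) (auto simp: graded_part_mult[OF mult.hyps] intro!: sum.neutral)
  qed
  then obtain N where N: "\<And>x d. d > N \<Longrightarrow> graded_part \<sigma> d p x = 0" by blast
  have "p x = (\<Sum>d\<le>N. graded_part \<sigma> d p x)" for x
  proof -
    obtain a where a: "\<And>t. p (\<sigma> t x) = poly a t" "\<And>d. graded_part \<sigma> d p x = coeff a d"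
      using obtain_poly[OF assms] by blast
    have "degree a \<le> N"
      by (rule degree_le) (use N a(2) in metis)
    then have "a = (\<Sum>d\<le>N. monom (coeff a d) d)"
      by (rule poly_as_sum_of_monoms'[symmetric])
    then have "poly a 1 = poly (\<Sum>d\<le>N. monom (coeff a d) d) 1" by simp
    then have "poly a 1 = (\<Sum>d\<le>N. coeff a d)"
      by (simp add: poly_sum poly_monom)
    then show ?thesis using a(1)[of 1] a(2) by (simp add: scale_one)
  qed
  then show thesis using that by blast
qed

text \<open>
  The assumption on curves says that the generators \<open>\<xi> i\<close> can be varied independently, which determines
  the partial derivatives.  Applying a scaling to a curve along which only \<open>\<xi> i\<close> varies, and comparing
  the two resulting derivatives of \<open>p\<close>, shows that the \<open>i\<close>-th of them is homogeneous.
\<close>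

lemma homogeneous_partial_derivatives:
  assumes "finite I" "S = \<xi> ` I" "\<And>i. i \<in> I \<Longrightarrow> weighted_homogeneous \<sigma> (v i) (\<xi> i)"
    and curve: "\<And>x i. i \<in> I \<Longrightarrow> \<exists>\<gamma>. \<gamma> 0 = x \<and>
      (\<forall>j\<in>I. ((\<lambda>t. \<xi> j (\<gamma> t)) has_field_derivative (if j = i then 1 else 0)) (at 0))"
    and "p \<in> generated_algebra S" "weighted_homogeneous \<sigma> n p"
  obtains D where "\<And>i. i \<in> I \<Longrightarrow> D i \<in> generated_algebra S"
    "\<And>i. i \<in> I \<Longrightarrow> v i \<le> n \<Longrightarrow> weighted_homogeneous \<sigma> (n - v i) (D i)"
    "\<And>i. i \<in> I \<Longrightarrow> \<not> v i \<le> n \<Longrightarrow> D i = (\<lambda>_. 0)"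
    "\<And>\<gamma> u t. (\<And>i. i \<in> I \<Longrightarrow> ((\<lambda>t. \<xi> i (\<gamma> t)) has_field_derivative u i) (at t)) \<Longrightarrow>
       ((\<lambda>t. p (\<gamma> t)) has_field_derivative (\<Sum>i\<in>I. D i (\<gamma> t) * u i)) (at t)"
proof -
  obtain D where D: "\<And>i. i \<in> I \<Longrightarrow> D i \<in> generated_algebra S"
    "\<And>\<gamma> u t. (\<And>i. i \<in> I \<Longrightarrow> ((\<lambda>t. \<xi> i (\<gamma> t)) has_field_derivative u i) (at t)) \<Longrightarrow>
       ((\<lambda>t. p (\<gamma> t)) has_field_derivative (\<Sum>i\<in>I. D i (\<gamma> t) * u i)) (at t)"
    by (rule generated_algebra_chain_rule[OF assms(1) assms(5)[unfolded assms(2)],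
          folded assms(2)]) blast
  have scaling: "c ^ v i * D i (\<sigma> c x) = c ^ n * D i x" if i: "i \<in> I" for i c x
  proof -
    obtain \<gamma> where \<gamma>: "\<gamma> 0 = x"
      "\<And>j. j \<in> I \<Longrightarrow> ((\<lambda>t. \<xi> j (\<gamma> t)) has_field_derivative (if j = i then 1 else 0)) (at 0)"
      using curve[OF i] by blast
    have "((\<lambda>t. \<xi> j (\<sigma> c (\<gamma> t))) has_field_derivative c ^ v j * (if j = i then 1 else 0)) (at 0)"
      if "j \<in> I" for j
      using DERIV_cmult[OF \<gamma>(2)[OF that], of "c ^ v j"] assms(3)[OF that]
      by (simp add: weighted_homogeneous_def)
    from D(2)[OF this] \<gamma>(1) i assms(1)
    have "((\<lambda>t. p (\<sigma> c (\<gamma> t))) has_field_derivative D i (\<sigma> c x) * c ^ v i) (at 0)"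
      by (simp add: if_distrib[of "\<lambda>x. _ * x"] cong: if_cong)
    moreover have "((\<lambda>t. c ^ n * p (\<gamma> t)) has_field_derivative c ^ n * D i x) (at 0)"
      using DERIV_cmult[OF D(2)[OF \<gamma>(2)], of "c ^ n"] \<gamma>(1) i assms(1)
      by (simp add: if_distrib[of "\<lambda>x. _ * x"] cong: if_cong)
    ultimately show ?thesis
      using DERIV_unique[of "\<lambda>t. c ^ n * p (\<gamma> t)"] assms(6)
      by (simp add: weighted_homogeneous_def mult.commute)
  qed
  have main: "D i x = (if v i \<le> n then graded_part \<sigma> (n - v i) (D i) x else 0)" if i: "i \<in> I" for i x
  proof -
    obtain a where a: "\<And>t. D i (\<sigma> t x) = poly a t" "\<And>d. graded_part \<sigma> d (D i) x = coeff a d"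
      using obtain_poly[OF D(1)[OF i]] by blast
    have "monom 1 (v i) * a = monom (D i x) n"
      by (rule poly_eqI_all) (use scaling[OF i] in \<open>simp add: poly_monom a[symmetric] mult.commute\<close>)
    then have "coeff (monom 1 (v i) * a) n = D i x" by simp
    then show ?thesis by (simp add: coeff_monom_mult a split: if_splits)
  qed
  show thesis
  proof (rule that)
    fix i assume "i \<in> I" "v i \<le> n"
    then have "D i = graded_part \<sigma> (n - v i) (D i)" using main by auto
    then show "weighted_homogeneous \<sigma> (n - v i) (D i)"
      using weighted_homogeneous_graded_part D(1) \<open>i \<in> I\<close> by metis
  qed (use main D in auto)
qed

end

section \<open>Polynomial functions on complex vectors\<close>

abbreviation vec_scale :: "complex \<Rightarrow> complex ^ 'n \<Rightarrow> complex ^ 'n" where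
  "vec_scale \<equiv> (\<lambda>c x. c *s x)"

lemma homogeneous_iff_weighted: "homogeneous d p \<longleftrightarrow> weighted_homogeneous vec_scale d p"
  by (simp add: homogeneous_def weighted_homogeneous_def)

interpretation vec_grading: graded_algebra vec_scale "range (\<lambda>i (x :: complex ^ 'n). x $ i)"
  by standard (auto simp: weighted_homogeneous_def intro!: exI[of _ 1])

lemmas polynomial_intros =
  generated_algebra.const[of _ "range (\<lambda>i x. x $ i)", folded polynomial_functions_def]
  generated_algebra.add[of _ "range (\<lambda>i x. x $ i)", folded polynomial_functions_def]
  generated_algebra.mult[of _ "range (\<lambda>i x. x $ i)", folded polynomial_functions_def]
  generated_algebra_diff[of _ "range (\<lambda>i x. x $ i)", folded polynomial_functions_def]
  generated_algebra_sum[of _ _ "range (\<lambda>i x. x $ i)", folded polynomial_functions_def]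
  generated_algebra_cmult[of _ "range (\<lambda>i x. x $ i)", folded polynomial_functions_def]

lemma polynomial_coordinate: "(\<lambda>x. x $ i) \<in> polynomial_functions"
  by (auto simp: polynomial_functions_def intro: generated_algebra.generator)

lemma polynomial_compose:
  assumes "p \<in> polynomial_functions" "\<And>i. (\<lambda>x. \<phi> x $ i) \<in> polynomial_functions"
  shows "(\<lambda>x. p (\<phi> x)) \<in> polynomial_functions"
  using assms generated_algebra_compose[of p _ \<phi>]
  unfolding polynomial_functions_def by blast

lemma polynomial_along_line:
  fixes p :: "complex ^ 'n \<Rightarrow> complex"
  assumes "p \<in> polynomial_functions"
  obtains q where "\<And>t. p (x + t *s v) = poly q t"
proof -
  have "\<exists>q. \<forall>t. p (x + t *s v) = poly q t"
  proof (rule generated_algebra_poly_along_curve[OF assms[unfolded polynomial_functions_def]])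
    fix f :: "complex ^ 'n \<Rightarrow> complex" assume "f \<in> range (\<lambda>i x. x $ i)"
    then obtain i where "f = (\<lambda>x. x $ i)" by blast
    then have "\<forall>t. f (x + t *s v) = poly [:x $ i, v $ i:] t" by (simp add: mult.commute)
    then show "\<exists>q. \<forall>t. f (x + t *s v) = poly q t" by blast
  qed
  then show thesis using that by blast
qed

text \<open>On the line through \<open>y\<close> and \<open>x\<close> both functions are univariate polynomials.\<close>

lemma polynomial_mult_eq_0:
  fixes p q :: "complex ^ 'n \<Rightarrow> complex"
  assumes "p \<in> polynomial_functions" "q \<in> polynomial_functions"
    and "\<And>x. p x * q x = 0" "p y \<noteq> 0"
  shows "q x = 0"
proof -
  obtain P where P: "\<And>t. p (y + t *s (x - y)) = poly P t" using polynomial_along_line[OF assms(1)] by blast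
  obtain Q where Q: "\<And>t. q (y + t *s (x - y)) = poly Q t" using polynomial_along_line[OF assms(2)] by blast
  have "P * Q = 0"
    by (rule poly_eqI_all) (simp add: P[symmetric] Q[symmetric] assms(3))
  moreover have "P \<noteq> 0" using P[of 0] assms(4) by auto
  ultimately show ?thesis using Q[of 1] by simp
qed

lemma polynomial_partial_derivatives:
  fixes p :: "complex ^ 'n \<Rightarrow> complex"
  assumes "p \<in> polynomial_functions" "homogeneous n p" "0 < n"
  obtains D where "\<And>i. D i \<in> polynomial_functions" "\<And>i. homogeneous (n - 1) (D i)"
    "\<And>x i. ((\<lambda>t. p (x + t *s axis i 1)) has_field_derivative D i x) (at 0)"
    "\<And>x. (\<Sum>i\<in>UNIV. D i x * x $ i) = of_nat n * p x"
proof -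
  have curve: "\<exists>\<gamma>. \<gamma> 0 = x \<and> (\<forall>j\<in>UNIV. ((\<lambda>t. \<gamma> t $ j) has_field_derivative (if j = i then 1 else 0)) (at 0))"
    for x :: "complex ^ 'n" and i
    by (rule exI[of _ "\<lambda>t. x + t *s axis i 1"])
      (auto simp: axis_def intro!: derivative_eq_intros)
  obtain D where D: "\<And>i. D i \<in> polynomial_functions" "\<And>i. homogeneous (n - 1) (D i)"
    "\<And>\<gamma> u t. (\<And>i. ((\<lambda>t. \<gamma> t $ i) has_field_derivative u i) (at t)) \<Longrightarrow>
       ((\<lambda>t. p (\<gamma> t)) has_field_derivative (\<Sum>i\<in>UNIV. D i (\<gamma> t) * u i)) (at t)"
    by (rule vec_grading.homogeneous_partial_derivatives[of UNIV "\<lambda>i x. x $ i" "\<lambda>_. 1" p n])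
      (use curve assms in \<open>auto simp: homogeneous_iff_weighted polynomial_functions_def
        weighted_homogeneous_def\<close>)
  show thesis
  proof (rule that[OF D(1,2)])
    fix x :: "complex ^ 'n" and i
    have "((\<lambda>t. (x + t *s axis i 1) $ j) has_field_derivative (if j = i then 1 else 0)) (at 0)" for j
      by (auto simp: axis_def intro!: derivative_eq_intros)
    from D(3)[OF this] show "((\<lambda>t. p (x + t *s axis i 1)) has_field_derivative D i x) (at 0)"
      by (simp add: if_distrib[of "\<lambda>x. _ * x"] cong: if_cong)
  next
    fix x :: "complex ^ 'n"
    have "((\<lambda>t. (t *s x) $ j) has_field_derivative x $ j) (at 1)" for j
      by (auto intro!: derivative_eq_intros)
    from D(3)[OF this] have "((\<lambda>t. p (t *s x)) has_field_derivative (\<Sum>i\<in>UNIV. D i x * x $ i)) (at 1)"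
      by simp
    moreover have "((\<lambda>t. t ^ n * p x) has_field_derivative of_nat n * p x) (at 1)"
      by (auto intro!: derivative_eq_intros)
    ultimately show "(\<Sum>i\<in>UNIV. D i x * x $ i) = of_nat n * p x"
      using assms(2) DERIV_unique[of "\<lambda>t. t ^ n * p x"] by (simp add: homogeneous_def)
  qed
qed

lemma homogeneous_prod_power:
  assumes "\<And>i. i \<in> I \<Longrightarrow> homogeneous 1 (f i)"
  shows "homogeneous (\<Sum>i\<in>I. a i) (\<lambda>x. \<Prod>i\<in>I. f i x ^ a i)"
  using assms
  by (auto simp: homogeneous_def power_mult_distrib prod.distrib power_sum)

lemma homogeneous_at_0: "homogeneous d p \<Longrightarrow> 0 < d \<Longrightarrow> p 0 = 0"
  unfolding homogeneous_def by (metis mult_zero_left vector_smult_lzero zero_power)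

section \<open>Ideals of functions\<close>

definition function_ring :: "('a \<Rightarrow> complex) set \<Rightarrow> bool" where
  "function_ring A \<longleftrightarrow> (\<forall>c. (\<lambda>_. c) \<in> A) \<and> (\<forall>f\<in>A. \<forall>g\<in>A. (\<lambda>x. f x + g x) \<in> A) \<and>
     (\<forall>f\<in>A. \<forall>g\<in>A. (\<lambda>x. f x * g x) \<in> A)"

lemma function_ring_const: "function_ring A \<Longrightarrow> (\<lambda>_. c) \<in> A"
  by (simp add: function_ring_def)

lemma function_ring_add: "function_ring A \<Longrightarrow> f \<in> A \<Longrightarrow> g \<in> A \<Longrightarrow> (\<lambda>x. f x + g x) \<in> A"
  by (simp add: function_ring_def)

lemma function_ring_mult: "function_ring A \<Longrightarrow> f \<in> A \<Longrightarrow> g \<in> A \<Longrightarrow> (\<lambda>x. f x * g x) \<in> A"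
  by (simp add: function_ring_def)

lemma function_ring_cmult: "function_ring A \<Longrightarrow> f \<in> A \<Longrightarrow> (\<lambda>x. c * f x) \<in> A"
  by (intro function_ring_mult function_ring_const)

lemma function_ring_diff: "function_ring A \<Longrightarrow> f \<in> A \<Longrightarrow> g \<in> A \<Longrightarrow> (\<lambda>x. f x - g x) \<in> A"
  using function_ring_add[of A f "\<lambda>x. - 1 * g x"] function_ring_cmult[of A g "- 1"] by simp

lemma function_ring_sum:
  "function_ring A \<Longrightarrow> (\<And>i. i \<in> I \<Longrightarrow> f i \<in> A) \<Longrightarrow> (\<lambda>x. \<Sum>i\<in>I. f i x) \<in> A"
  by (induction I rule: infinite_finite_induct) (auto intro: function_ring_const function_ring_add)

lemma function_ring_prod:
  "function_ring A \<Longrightarrow> (\<And>i. i \<in> I \<Longrightarrow> f i \<in> A) \<Longrightarrow> (\<lambda>x. \<Prod>i\<in>I. f i x) \<in> A"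
  by (induction I rule: infinite_finite_induct) (auto intro: function_ring_const function_ring_mult)

text \<open>
  The coefficients range over \<open>A\<close>, which is either the ring of all functions under consideration or
  the ring of invariants.
\<close>

definition ideal_span ::
    "('a \<Rightarrow> complex) set \<Rightarrow> 'i set \<Rightarrow> ('i \<Rightarrow> 'a \<Rightarrow> complex) \<Rightarrow> ('a \<Rightarrow> complex) set" where
  "ideal_span A I f = {p. \<exists>c. (\<forall>i\<in>I. c i \<in> A) \<and> (\<forall>x. p x = (\<Sum>i\<in>I. c i x * f i x))}"

lemma ideal_spanI:
  assumes "\<And>i. i \<in> I \<Longrightarrow> c i \<in> A" "\<And>x. p x = (\<Sum>i\<in>I. c i x * f i x)"
  shows "p \<in> ideal_span A I f"
  using assms by (auto simp: ideal_span_def)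

lemma ideal_spanE:
  assumes "p \<in> ideal_span A I f"
  obtains c where "\<And>i. i \<in> I \<Longrightarrow> c i \<in> A" "\<And>x. p x = (\<Sum>i\<in>I. c i x * f i x)"
  using assms by (auto simp: ideal_span_def)

lemma ideal_span_add:
  assumes "function_ring A" "p \<in> ideal_span A I f" "q \<in> ideal_span A I f"
  shows "(\<lambda>x. p x + q x) \<in> ideal_span A I f"
proof -
  obtain c where c: "\<And>i. i \<in> I \<Longrightarrow> c i \<in> A" "\<And>x. p x = (\<Sum>i\<in>I. c i x * f i x)"
    using ideal_spanE[OF assms(2)] by blast
  obtain d where d: "\<And>i. i \<in> I \<Longrightarrow> d i \<in> A" "\<And>x. q x = (\<Sum>i\<in>I. d i x * f i x)"
    using ideal_spanE[OF assms(3)] by blast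
  show ?thesis
    by (rule ideal_spanI[of _ "\<lambda>i x. c i x + d i x"])
      (use assms(1) c d in \<open>auto simp: function_ring_def distrib_right sum.distrib\<close>)
qed

lemma ideal_span_mult:
  assumes "function_ring A" "a \<in> A" "p \<in> ideal_span A I f"
  shows "(\<lambda>x. a x * p x) \<in> ideal_span A I f"
proof -
  obtain c where c: "\<And>i. i \<in> I \<Longrightarrow> c i \<in> A" "\<And>x. p x = (\<Sum>i\<in>I. c i x * f i x)"
    using ideal_spanE[OF assms(3)] by blast
  show ?thesis
    by (rule ideal_spanI[of _ "\<lambda>i x. a x * c i x"])
      (use assms(1,2) c in \<open>auto simp: function_ring_def sum_distrib_left mult.assoc\<close>)
qed

lemma ideal_span_cmult:
  assumes "function_ring A" "p \<in> ideal_span A I f"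
  shows "(\<lambda>x. c * p x) \<in> ideal_span A I f"
  using ideal_span_mult[OF assms(1) _ assms(2), of "\<lambda>_. c"] assms(1)
  by (simp add: function_ring_def)

lemma ideal_span_zero:
  assumes "function_ring A"
  shows "(\<lambda>_. 0) \<in> ideal_span A I f"
  by (rule ideal_spanI[of _ "\<lambda>_ _. 0"]) (use assms in \<open>auto simp: function_ring_def\<close>)

lemma ideal_span_sum:
  assumes "function_ring A" "\<And>j. j \<in> J \<Longrightarrow> p j \<in> ideal_span A I f"
  shows "(\<lambda>x. \<Sum>j\<in>J. p j x) \<in> ideal_span A I f"
  using assms(2)
  by (induction J rule: infinite_finite_induct)
    (auto intro: ideal_span_zero ideal_span_add assms(1))

lemma ideal_span_base:
  assumes "function_ring A" "finite I" "i \<in> I"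
  shows "f i \<in> ideal_span A I f"
proof (rule ideal_spanI[of _ "\<lambda>j _. if j = i then 1 else 0"])
  show "f i x = (\<Sum>j\<in>I. (if j = i then 1 else 0) * f j x)" for x
    using assms(2,3) by (simp add: if_distrib[of "\<lambda>x. x * _"] cong: if_cong)
qed (use assms(1) in \<open>auto simp: function_ring_def\<close>)

lemma ideal_span_trans:
  assumes "function_ring A" "p \<in> ideal_span A I f" "\<And>i. i \<in> I \<Longrightarrow> f i \<in> ideal_span A J g"
  shows "p \<in> ideal_span A J g"
proof -
  obtain c where c: "\<And>i. i \<in> I \<Longrightarrow> c i \<in> A" "\<And>x. p x = (\<Sum>i\<in>I. c i x * f i x)"
    using ideal_spanE[OF assms(2)] by blast
  have "(\<lambda>x. \<Sum>i\<in>I. c i x * f i x) \<in> ideal_span A J g"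
    by (intro ideal_span_sum ideal_span_mult assms(1,3) c(1))
  moreover have "p = (\<lambda>x. \<Sum>i\<in>I. c i x * f i x)" using c(2) by auto
  ultimately show ?thesis by simp
qed

lemma ideal_span_mono:
  assumes "A \<subseteq> A'"
  shows "ideal_span A I f \<subseteq> ideal_span A' I f"
  using assms unfolding ideal_span_def by blast

section \<open>Finite groups of real matrices\<close>

lemma act_nth: "act g x $ i = (\<Sum>j\<in>UNIV. complex_of_real (g $ i $ j) * x $ j)"
  by (simp add: act_def matrix_vector_mult_def map_matrix_def)

lemma act_add: "act g (x + y) = act g x + act g y"
  by (simp add: act_def matrix_vector_right_distrib)

lemma act_scale: "act g (c *s x) = c *s act g x"
  by (simp add: vec_eq_iff act_nth sum_distrib_left mult_ac)

lemma act_zero: "act g 0 = 0"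
  by (simp add: vec_eq_iff act_nth)

lemma act_diff: "act g (x - y) = act g x - act g y"
  by (simp add: vec_eq_iff act_nth algebra_simps sum_subtractf)

lemma act_sum: "act g (\<Sum>i\<in>I. f i) = (\<Sum>i\<in>I. act g (f i))"
  by (induction I rule: infinite_finite_induct) (simp_all add: act_zero act_add)

lemma act_mult: "act (g ** h) x = act g (act h x)"
  unfolding vec_eq_iff act_nth
  by (auto simp: matrix_matrix_mult_def sum_distrib_left sum_distrib_right mult.assoc
      intro: sum.swap)

lemma act_one: "act (mat 1) x = x"
  by (simp add: vec_eq_iff act_nth mat_def if_distrib[of "\<lambda>x. x * _"] if_distrib[of complex_of_real]
      cong: if_cong)

lemma polynomial_act_coordinate: "(\<lambda>x. act g x $ i) \<in> polynomial_functions"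
  unfolding act_nth by (intro polynomial_intros polynomial_coordinate)

locale matrix_group =
  fixes G :: "(real ^ 'n ^ 'n) set"
  assumes finite_group: "finite G" and one_in: "mat 1 \<in> G"
    and mult_in: "g \<in> G \<Longrightarrow> h \<in> G \<Longrightarrow> g ** h \<in> G"
    and inverse_in: "g \<in> G \<Longrightarrow> \<exists>h\<in>G. h ** g = mat 1 \<and> g ** h = mat 1"
begin

lemma card_pos: "card G > 0"
  using finite_group one_in card_gt_0_iff by blast

lemma bij_mult_right:
  assumes "g \<in> G" shows "bij_betw (\<lambda>h. h ** g) G G"
proof -
  obtain k where k: "k \<in> G" "k ** g = mat 1" "g ** k = mat 1" using inverse_in[OF assms] by blast
  show ?thesis
    by (rule bij_betw_byWitness[of _ "\<lambda>h. h ** k"])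
      (use k assms mult_in in \<open>auto simp: matrix_mul_assoc[symmetric]\<close>)
qed

lemma bij_mult_left:
  assumes "g \<in> G" shows "bij_betw (\<lambda>h. g ** h) G G"
proof -
  obtain k where k: "k \<in> G" "k ** g = mat 1" "g ** k = mat 1" using inverse_in[OF assms] by blast
  show ?thesis
    by (rule bij_betw_byWitness[of _ "\<lambda>h. k ** h"])
      (use k assms mult_in in \<open>auto simp: matrix_mul_assoc\<close>)
qed

definition average :: "complex ^ 'n \<Rightarrow> complex ^ 'n" where
  "average x = inverse (of_nat (card G)) *s (\<Sum>g\<in>G. act g x)"

text \<open>
  The projection along the fixed space onto its invariant complement; functions on the reflection
  representation are the functions on the whole space that factor through it.
\<close>

definition proj :: "complex ^ 'n \<Rightarrow> complex ^ 'n" where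
  "proj x = x - average x"

lemma act_average: "g \<in> G \<Longrightarrow> act g (average x) = average x"
  using sum.reindex_bij_betw[OF bij_mult_left, of g "\<lambda>g. act g x"]
  by (simp add: average_def act_scale act_sum act_mult)

lemma average_act: "g \<in> G \<Longrightarrow> average (act g x) = average x"
  using sum.reindex_bij_betw[OF bij_mult_right, of g "\<lambda>g. act g x"]
  by (simp add: average_def act_mult)

lemma average_add: "average (x + y) = average x + average y"
  by (simp add: average_def act_add sum.distrib vector_add_ldistrib)

lemma average_scale: "average (c *s x) = c *s average x"
  by (simp add: vec_eq_iff average_def act_scale sum_distrib_left mult_ac)

lemma average_fixed: "x \<in> fixed_space G \<Longrightarrow> average x = x"
  using card_pos by (simp add: average_def fixed_space_def vec_eq_iff)

lemma average_in_fixed: "average x \<in> fixed_space G"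
  by (simp add: fixed_space_def act_average)

lemma proj_add: "proj (x + y) = proj x + proj y"
  by (simp add: proj_def average_add)

lemma proj_scale: "proj (c *s x) = c *s proj x"
  by (simp add: proj_def average_scale vec.scale_right_diff_distrib)

lemma proj_fixed: "x \<in> fixed_space G \<Longrightarrow> proj x = 0"
  by (simp add: proj_def average_fixed)

lemma proj_proj: "proj (proj x) = proj x"
proof -
  have "proj x = proj (proj x + average x)" by (simp add: proj_def)
  also have "\<dots> = proj (proj x)" using proj_fixed[OF average_in_fixed] by (simp add: proj_add)
  finally show ?thesis ..
qed

lemma proj_act: "g \<in> G \<Longrightarrow> proj (act g x) = act g (proj x)"
  by (simp add: proj_def average_act act_diff act_average)

lemma polynomial_proj_coordinate: "(\<lambda>x. proj x $ i) \<in> polynomial_functions"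
  unfolding proj_def average_def vector_minus_component vector_smult_component sum_component
  by (intro polynomial_intros polynomial_coordinate polynomial_act_coordinate)

definition reduced :: "(complex ^ 'n \<Rightarrow> complex) set" where
  "reduced = {p \<in> polynomial_functions. \<forall>x. p (proj x) = p x}"

lemma reduced_polynomial: "p \<in> reduced \<Longrightarrow> p \<in> polynomial_functions"
  by (simp add: reduced_def)

lemma reduced_proj: "p \<in> reduced \<Longrightarrow> p (proj x) = p x"
  by (simp add: reduced_def)

lemma compose_proj_reduced: "p \<in> polynomial_functions \<Longrightarrow> (\<lambda>x. p (proj x)) \<in> reduced"
  using polynomial_compose[OF _ polynomial_proj_coordinate] by (simp add: reduced_def proj_proj)

lemma compose_act_reduced: "p \<in> reduced \<Longrightarrow> g \<in> G \<Longrightarrow> (\<lambda>x. p (act g x)) \<in> reduced"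
  using polynomial_compose[of p "act g"] polynomial_act_coordinate[of g]
  by (simp add: reduced_def proj_act[symmetric])

lemma function_ring_reduced: "function_ring reduced"
  by (auto simp: function_ring_def reduced_def polynomial_intros(1-3))

lemma invariant_ring_iff:
  "p \<in> invariant_ring G \<longleftrightarrow> p \<in> reduced \<and> (\<forall>g\<in>G. \<forall>x. p (act g x) = p x)"
proof -
  have "(\<forall>v\<in>fixed_space G. \<forall>x. p (x + v) = p x) \<longleftrightarrow> (\<forall>x. p (proj x) = p x)"
  proof safe
    fix x assume "\<forall>v\<in>fixed_space G. \<forall>x. p (x + v) = p x"
    then have "p (proj x + average x) = p (proj x)" using average_in_fixed by blast
    then show "p (proj x) = p x" by (simp add: proj_def)
  next
    fix v x assume *: "\<forall>x. p (proj x) = p x" and v: "v \<in> fixed_space G"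
    have "p (x + v) = p (proj (x + v))" using * by simp
    also have "\<dots> = p x" using * v by (simp add: proj_add proj_fixed)
    finally show "p (x + v) = p x" .
  qed
  then show ?thesis unfolding invariant_ring_def reduced_def by blast
qed

lemma invariant_reduced: "p \<in> invariant_ring G \<Longrightarrow> p \<in> reduced"
  by (simp add: invariant_ring_iff)

lemma function_ring_invariant: "function_ring (invariant_ring G)"
  using function_ring_reduced by (auto simp: function_ring_def invariant_ring_iff)

lemma graded_part_reduced:
  assumes "p \<in> reduced" shows "graded_part vec_scale d p \<in> reduced"
proof -
  have "p (t *s proj x) = p (t *s x)" for t x
    using reduced_proj[OF assms, of "t *s x"] by (simp add: proj_scale)
  then have "graded_part vec_scale d p (proj x) = graded_part vec_scale d p x" for x
    by (simp add: graded_part_def)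
  then show ?thesis
    using assms vec_grading.graded_part_in[of p d]
    unfolding reduced_def polynomial_functions_def by blast
qed

lemma graded_part_invariant:
  assumes "p \<in> invariant_ring G" shows "graded_part vec_scale d p \<in> invariant_ring G"
proof -
  have "p (t *s act g x) = p (t *s x)" if "g \<in> G" for t x g
    using assms that by (simp add: invariant_ring_iff act_scale[symmetric])
  then show ?thesis
    using assms graded_part_reduced by (simp add: graded_part_def invariant_ring_iff)
qed

definition reynolds :: "(complex ^ 'n \<Rightarrow> complex) \<Rightarrow> complex ^ 'n \<Rightarrow> complex" where
  "reynolds p x = (\<Sum>g\<in>G. p (act g x)) / of_nat (card G)"

lemma reynolds_invariant:
  assumes "p \<in> reduced" shows "reynolds p \<in> invariant_ring G"
proof -
  have "reynolds p (act h x) = reynolds p x" if "h \<in> G" for h x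
    using sum.reindex_bij_betw[OF bij_mult_right[OF that], of "\<lambda>g. p (act g x)"]
    by (simp add: reynolds_def act_mult)
  moreover have "reynolds p \<in> reduced"
  proof -
    have "(\<lambda>x. inverse (of_nat (card G)) * (\<Sum>g\<in>G. p (act g x))) \<in> reduced"
      using compose_act_reduced[OF assms]
      by (intro function_ring_cmult function_ring_sum function_ring_reduced) blast
    then show ?thesis
      by (simp add: reynolds_def[abs_def] divide_inverse mult.commute)
  qed
  ultimately show ?thesis by (simp add: invariant_ring_iff)
qed

lemma reynolds_id: "p \<in> invariant_ring G \<Longrightarrow> reynolds p x = p x"
  using card_pos by (simp add: reynolds_def invariant_ring_iff)

lemma reynolds_mult:
  "f \<in> invariant_ring G \<Longrightarrow> reynolds (\<lambda>x. p x * f x) x = reynolds p x * f x"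
  by (simp add: reynolds_def invariant_ring_iff sum_distrib_right)

lemma reynolds_sum: "reynolds (\<lambda>x. \<Sum>i\<in>I. p i x) x = (\<Sum>i\<in>I. reynolds (p i) x)"
  by (simp add: reynolds_def sum_divide_distrib) (rule sum.swap)

lemma homogeneous_reynolds: "homogeneous d p \<Longrightarrow> homogeneous d (reynolds p)"
  by (simp add: homogeneous_def reynolds_def act_scale sum_distrib_left)

end

section \<open>Divided differences\<close>

lemma group_GL: "group (GL :: (real ^ 'n ^ 'n) monoid)"
proof (rule groupI)
  fix x :: "real ^ 'n ^ 'n" assume "x \<in> carrier GL"
  then obtain y where "x ** y = mat 1" "y ** x = mat 1" by (auto simp: GL_def invertible_def)
  then show "\<exists>y\<in>carrier GL. y \<otimes>\<^bsub>GL\<^esub> x = \<one>\<^bsub>GL\<^esub>"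
    by (intro bexI[of _ y]) (auto simp: GL_def invertible_def)
qed (auto simp: GL_def invertible_mult matrix_mul_assoc invertible_def[of "mat 1"]
    intro: exI[of _ "mat 1"])

lemma reflection_in_GL: "reflection s \<Longrightarrow> s \<in> carrier GL"
  by (auto simp: reflection_def GL_def invertible_def)

lemma inv_reflection: "reflection s \<Longrightarrow> inv\<^bsub>GL\<^esub> s = s"
  using group.inv_equality[OF group_GL, of s s] reflection_in_GL[of s]
  by (simp add: reflection_def GL_def)

text \<open>
  The hyperplane of fixed vectors is the kernel of a linear form, and a vector orthogonal to it
  determines the reflection.
\<close>

lemma reflection_form:
  fixes s :: "real ^ 'n ^ 'n"
  assumes "reflection s"
  obtains a b where "a \<noteq> 0" "b \<noteq> 0" "\<And>x. s *v x = x - (b \<bullet> x) *\<^sub>R a"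
proof -
  let ?H = "{x. s *v x = x}"
  have sub: "subspace ?H"
    by (auto simp: subspace_def matrix_vector_right_distrib matrix_vector_mult_scaleR)
  have "dim ?H = DIM(real ^ 'n) - 1" using assms by (auto simp: reflection_def)
  then obtain b where b: "b \<noteq> 0" "span ?H = {x. b \<bullet> x = 0}"
    using dim_eq_hyperplane[of ?H] by auto
  then have H: "?H = {x. b \<bullet> x = 0}" using span_eq_iff[of ?H] sub by simp
  define a where "a = (1 / (b \<bullet> b)) *\<^sub>R (b - s *v b)"
  have "b \<notin> ?H" using b(1) H by simp
  then have "a \<noteq> 0" using b(1) by (auto simp: a_def)
  moreover have "s *v x = x - (b \<bullet> x) *\<^sub>R a" for x
  proof -
    define c where "c = (b \<bullet> x) / (b \<bullet> b)"
    have "b \<bullet> (x - c *\<^sub>R b) = 0" using b(1) by (simp add: c_def inner_diff_right)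
    then have "s *v (x - c *\<^sub>R b) = x - c *\<^sub>R b" using H by blast
    then have "s *v x = x - c *\<^sub>R (b - s *v b)"
      by (simp add: matrix_vector_mult_diff_distrib matrix_vector_mult_scaleR algebra_simps)
    then show ?thesis by (simp add: a_def c_def)
  qed
  ultimately show thesis using that b(1) by blast
qed

lemma act_reflection_form:
  fixes s :: "real ^ 'n ^ 'n"
  assumes "reflection s"
  obtains a l where "a \<noteq> 0" "l \<in> polynomial_functions" "homogeneous 1 l" "\<exists>y. l y \<noteq> 0"
    "\<And>x y. l (x + y) = l x + l y" "\<And>x. act s x = x - l x *s a"
proof -
  obtain a b :: "real ^ 'n" where ab: "a \<noteq> 0" "b \<noteq> 0" "\<And>x. s *v x = x - (b \<bullet> x) *\<^sub>R a"
    using reflection_form[OF assms] by blast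
  have entry: "s $ i $ j = (if i = j then 1 else 0) - b $ j * a $ i" for i j
  proof -
    have "s $ i $ j = (s *v axis j 1) $ i"
      by (simp add: matrix_vector_mult_basis column_def)
    also have "\<dots> = (if i = j then 1 else 0) - b $ j * a $ i"
      using ab(3)[of "axis j 1"] by (simp add: inner_axis) (simp add: axis_def)
    finally show ?thesis .
  qed
  define l :: "complex ^ 'n \<Rightarrow> complex" where "l x = (\<Sum>j\<in>UNIV. of_real (b $ j) * x $ j)" for x
  define a' :: "complex ^ 'n" where "a' = (\<chi> i. of_real (a $ i))"
  show thesis
  proof (rule that)
    show "a' \<noteq> 0" using ab(1) by (auto simp: a'_def vec_eq_iff)
    show "l \<in> polynomial_functions" unfolding l_def[abs_def]
      by (intro polynomial_intros polynomial_coordinate)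
    show "homogeneous 1 l" by (simp add: homogeneous_def l_def sum_distrib_left mult_ac)
    show "l (x + y) = l x + l y" for x y by (simp add: l_def algebra_simps sum.distrib)
    obtain j where "b $ j \<noteq> 0" using ab(2) by (auto simp: vec_eq_iff)
    moreover have "l (axis j 1) = of_real (b $ j)"
      by (simp add: l_def axis_def if_distrib[of "\<lambda>x. _ * x"] cong: if_cong)
    ultimately show "\<exists>y. l y \<noteq> 0" by (metis of_real_eq_0_iff)
    show "act s x = x - l x *s a'" for x
    proof -
      have "act s x $ i = x $ i - l x * of_real (a $ i)" for i
      proof -
        have "act s x $ i = (\<Sum>j\<in>UNIV. (if i = j then x $ j else 0) - of_real (b $ j) * x $ j * of_real (a $ i))"
          unfolding act_nth entry by (intro sum.cong refl) (simp add: algebra_simps)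
        then show ?thesis by (simp add: sum_subtractf l_def sum_distrib_right)
      qed
      then show ?thesis by (simp add: vec_eq_iff a'_def)
    qed
  qed
qed

text \<open>
  The divided difference is built along the derivation of \<open>p\<close> from the coordinates, by a twisted
  product rule; this replaces a division of polynomials by the linear form.
\<close>

lemma divided_difference:
  fixes p :: "complex ^ 'n \<Rightarrow> complex"
  assumes "p \<in> polynomial_functions" "l \<in> polynomial_functions" "\<And>x. act s x = x - l x *s a"
  shows "\<exists>q\<in>polynomial_functions. \<forall>x. p (act s x) - p x = l x * q x"
  using assms(1) unfolding polynomial_functions_def
proof induction
  case (generator f)
  then obtain i where "f = (\<lambda>x. x $ i)" by blast
  then have "\<forall>x. f (act s x) - f x = l x * (- a $ i)" by (simp add: assms(3))
  then show ?case by (intro bexI[of _ "\<lambda>_. - a $ i"]) (auto intro: generated_algebra.const)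
next
  case (const c)
  show ?case by (intro bexI[of _ "\<lambda>_. 0"]) (auto intro: generated_algebra.const)
next
  case (add f g)
  then obtain q r where "q \<in> generated_algebra (range (\<lambda>i x. x $ i))" "\<forall>x. f (act s x) - f x = l x * q x"
    "r \<in> generated_algebra (range (\<lambda>i x. x $ i))" "\<forall>x. g (act s x) - g x = l x * r x" by blast
  then show ?case
    by (intro bexI[of _ "\<lambda>x. q x + r x"] generated_algebra.add) (auto simp: algebra_simps)
next
  case (mult f g)
  then obtain q r where qr: "q \<in> generated_algebra (range (\<lambda>i x. x $ i))" "\<forall>x. f (act s x) - f x = l x * q x"
    "r \<in> generated_algebra (range (\<lambda>i x. x $ i))" "\<forall>x. g (act s x) - g x = l x * r x" by blast
  have "f (act s x) * g (act s x) - f x * g x = l x * (q x * g (act s x) + f x * r x)" for x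
  proof -
    have "f (act s x) * g (act s x) - f x * g x
      = (f (act s x) - f x) * g (act s x) + f x * (g (act s x) - g x)" by (simp add: algebra_simps)
    then show ?thesis using qr by (simp add: algebra_simps)
  qed
  moreover have "(\<lambda>x. g (act s x)) \<in> generated_algebra (range (\<lambda>i x. x $ i))"
    using mult.hyps(2) polynomial_compose polynomial_act_coordinate
    unfolding polynomial_functions_def by blast
  ultimately show ?case
    by (intro bexI[of _ "\<lambda>x. q x * g (act s x) + f x * r x"])
      (use mult.hyps qr in \<open>auto intro: generated_algebra.intros\<close>)
qed

locale reflection_group =
  fixes G :: "(real ^ 'n ^ 'n) set"
  assumes finite_G: "finite G" and generated: "generate GL {s \<in> G. reflection s} = G"
begin

sublocale matrix_group G
proof
  have H: "{s \<in> G. reflection s} \<subseteq> carrier GL" using reflection_in_GL by blast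
  have sub: "subgroup G GL"
    using group.generate_is_subgroup[OF group_GL H] generated by simp
  show "finite G" by (rule finite_G)
  show "mat 1 \<in> G" using subgroup.one_closed[OF sub] by (simp add: GL_def)
  show "g ** h \<in> G" if "g \<in> G" "h \<in> G" for g h
    using subgroup.m_closed[OF sub that] by (simp add: GL_def)
  show "\<exists>h\<in>G. h ** g = mat 1 \<and> g ** h = mat 1" if "g \<in> G" for g
  proof (intro bexI conjI)
    have "g \<in> carrier GL" using subgroup.mem_carrier[OF sub that] .
    then show "(inv\<^bsub>GL\<^esub> g) ** g = mat 1" "g ** (inv\<^bsub>GL\<^esub> g) = mat 1"
      using group.l_inv[OF group_GL] group.r_inv[OF group_GL] by (auto simp: GL_def)
    show "inv\<^bsub>GL\<^esub> g \<in> G" using subgroup.m_inv_closed[OF sub that] .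
  qed
qed

text \<open>Reflections are their own inverses, so the group is generated by them as a monoid.\<close>

lemma group_induct [consumes 1, case_names one reflection mult]:
  assumes "g \<in> G" "Q (mat 1)" "\<And>s. s \<in> G \<Longrightarrow> reflection s \<Longrightarrow> Q s"
    "\<And>g h. g \<in> G \<Longrightarrow> h \<in> G \<Longrightarrow> Q g \<Longrightarrow> Q h \<Longrightarrow> Q (g ** h)"
  shows "Q g"
proof -
  have "g \<in> generate GL {s \<in> G. reflection s}" using assms(1) generated by simp
  then have "g \<in> G \<and> Q g"
  proof induction
    case one
    then show ?case using assms(2) one_in by (simp add: GL_def)
  next
    case (incl h)
    then show ?case using assms(3) by blast
  next
    case (inv h)
    then have "h \<in> G" "reflection h" by auto
    moreover from this(2) have "inv\<^bsub>GL\<^esub> h = h" by (rule inv_reflection)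
    ultimately show ?case using assms(3) by simp
  next
    case (eng h1 h2)
    then show ?case using assms(4) mult_in by (simp add: GL_def)
  qed
  then show ?thesis ..
qed

lemma reduced_divided_difference:
  assumes "s \<in> G" "reflection s"
  obtains l where "l \<in> reduced" "homogeneous 1 l" "\<exists>y. l y \<noteq> 0"
    "\<And>p. p \<in> reduced \<Longrightarrow> \<exists>q\<in>reduced. \<forall>x. p (act s x) - p x = l x * q x"
    "\<And>p d. p \<in> reduced \<Longrightarrow> homogeneous (Suc d) p \<Longrightarrow>
      \<exists>q\<in>reduced. homogeneous d q \<and> (\<forall>x. p (act s x) - p x = l x * q x)"
proof -
  obtain a l where l: "a \<noteq> 0" "l \<in> polynomial_functions" "homogeneous 1 l" "\<exists>y. l y \<noteq> 0"
    "\<And>x y. l (x + y) = l x + l y" "\<And>x. act s x = x - l x *s a"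
    using act_reflection_form[OF assms(2)] by blast
  have "l v = 0" if "v \<in> fixed_space G" for v
    using that assms(1) l(6)[of v] l(1) by (simp add: fixed_space_def)
  then have "l (proj x) = l x" for x
    using l(5)[of "proj x" "average x"] average_in_fixed[of x] by (simp add: proj_def)
  then have red: "l \<in> reduced" using l(2) by (simp add: reduced_def)
  have dd: "\<exists>q\<in>reduced. \<forall>x. p (act s x) - p x = l x * q x" if p: "p \<in> reduced" for p
  proof -
    obtain q where q: "q \<in> polynomial_functions" "\<And>x. p (act s x) - p x = l x * q x"
      using divided_difference[OF reduced_polynomial[OF p] l(2,6)] by blast
    have "p (act s x) - p x = l x * q (proj x)" for x
      using q(2)[of "proj x"] reduced_proj[OF p] reduced_proj[OF red]
        reduced_proj[OF compose_act_reduced[OF p assms(1)]] by simp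
    then show ?thesis by (intro bexI[OF _ compose_proj_reduced[OF q(1)]]) blast
  qed
  have hom: "\<exists>q\<in>reduced. homogeneous d q \<and> (\<forall>x. p (act s x) - p x = l x * q x)"
    if p: "p \<in> reduced" "homogeneous (Suc d) p" for p d
  proof -
    obtain q where q: "q \<in> reduced" "\<And>x. p (act s x) - p x = l x * q x" using dd[OF p(1)] by blast
    \<comment> \<open>All graded parts of \<open>q\<close> except that of degree \<open>d\<close> can be dropped.\<close>
    have "homogeneous (Suc d) (\<lambda>x. q x * l x)"
      using p(2) q(2) unfolding homogeneous_def
      by (simp add: act_scale mult.commute[of "q _"] q(2)[symmetric] right_diff_distrib)
    then have "q x * l x = graded_part vec_scale (Suc d) (\<lambda>x. q x * l x) x" for x
      using vec_grading.graded_part_homogeneous by (fastforce simp: homogeneous_iff_weighted)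
    also have "graded_part vec_scale (Suc d) (\<lambda>x. q x * l x) x = graded_part vec_scale d q x * l x" for x
      using vec_grading.graded_part_mult_homogeneous[of q l 1 "Suc d" x] l(2,3) reduced_polynomial[OF q(1)]
      by (simp add: polynomial_functions_def homogeneous_iff_weighted)
    finally have "p (act s x) - p x = l x * graded_part vec_scale d q x" for x
      using q(2) by (simp add: mult.commute)
    moreover have "homogeneous d (graded_part vec_scale d q)"
      using vec_grading.weighted_homogeneous_graded_part reduced_polynomial[OF q(1)]
      by (simp add: polynomial_functions_def homogeneous_iff_weighted)
    ultimately show ?thesis using graded_part_reduced[OF q(1)] by blast
  qed
  show thesis using that[OF red l(3,4) dd hom] .
qed

end

section \<open>Syzygies of invariants\<close>

context matrix_group
begin

lemma ideal_span_act:
  assumes "\<And>i. i \<in> I \<Longrightarrow> f i \<in> invariant_ring G" "p \<in> ideal_span reduced I f" "g \<in> G"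
  shows "(\<lambda>x. p (act g x)) \<in> ideal_span reduced I f"
proof -
  obtain c where c: "\<And>i. i \<in> I \<Longrightarrow> c i \<in> reduced" "\<And>x. p x = (\<Sum>i\<in>I. c i x * f i x)"
    using ideal_spanE[OF assms(2)] by blast
  show ?thesis
  proof (rule ideal_spanI[of _ "\<lambda>i x. c i (act g x)"])
    show "p (act g x) = (\<Sum>i\<in>I. c i (act g x) * f i x)" for x
      unfolding c(2) using assms(1,3) by (intro sum.cong) (auto simp: invariant_ring_iff)
  qed (use c compose_act_reduced assms(3) in blast)
qed

end

context reflection_group
begin

text \<open>
  The heart of Chevalley's argument, by induction on the degree of \<open>h i0\<close>.  Divided differences turn
  the relation into one of lower degree, so \<open>h i0\<close> is invariant modulo the ideal that the \<open>f i\<close>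
  generate.  Its average is an invariant of positive degree and lies in that ideal by assumption.
  In degree zero the relation would express \<open>g i0\<close> by the other \<open>g i\<close>.
\<close>

lemma homogeneous_syzygy:
  assumes K: "finite K" "\<And>i. i \<in> K \<Longrightarrow> f i \<in> invariant_ring G"
    and pos: "\<And>p d. p \<in> invariant_ring G \<Longrightarrow> homogeneous d p \<Longrightarrow> 0 < d \<Longrightarrow> p \<in> ideal_span reduced K f"
    and I: "finite I" "i0 \<in> I" "\<And>i. i \<in> I \<Longrightarrow> g i \<in> invariant_ring G"
    and g: "g i0 \<notin> ideal_span (invariant_ring G) (I - {i0}) g"
    and h: "\<And>i. i \<in> I \<Longrightarrow> h i \<in> reduced" "\<And>x. (\<Sum>i\<in>I. h i x * g i x) = 0" "homogeneous d (h i0)"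
  shows "h i0 \<in> ideal_span reduced K f"
  using h
proof (induction d arbitrary: h)
  case 0
  define k where "k = h i0 0"
  have k: "h i0 x = k" for x
    using 0(3) unfolding homogeneous_def k_def by (metis mult_1 power_0 vector_smult_lzero)
  show ?case
  proof (cases "k = 0")
    case True
    then have "h i0 = (\<lambda>_. 0)" using k by auto
    then show ?thesis using ideal_span_zero[OF function_ring_reduced] by simp
  next
    case False
    have "g i0 \<in> ideal_span (invariant_ring G) (I - {i0}) g"
    proof (rule ideal_spanI[of _ "\<lambda>i. reynolds (\<lambda>x. (- 1 / k) * h i x)"])
      show "reynolds (\<lambda>x. (- 1 / k) * h i x) \<in> invariant_ring G" if "i \<in> I - {i0}" for i
        using that 0(1) by (intro reynolds_invariant function_ring_cmult function_ring_reduced) auto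
      fix x
      have "g i0 x = (\<Sum>i\<in>I - {i0}. ((- 1 / k) * h i x) * g i x)" for x
      proof -
        have "k * g i0 x + (\<Sum>i\<in>I - {i0}. h i x * g i x) = 0"
          using 0(2)[of x] I(1,2) k by (simp add: sum.remove)
        then have "g i0 x = (- 1 / k) * (\<Sum>i\<in>I - {i0}. h i x * g i x)"
          using False by (simp add: field_simps eq_neg_iff_add_eq_0)
        then show ?thesis by (simp add: sum_distrib_left mult.assoc)
      qed
      then have "g i0 = (\<lambda>x. \<Sum>i\<in>I - {i0}. ((- 1 / k) * h i x) * g i x)" by auto
      then have "g i0 x = reynolds (\<lambda>x. \<Sum>i\<in>I - {i0}. ((- 1 / k) * h i x) * g i x) x"
        using reynolds_id[OF I(3)[OF I(2)], of x] by simp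
      also have "\<dots> = (\<Sum>i\<in>I - {i0}. reynolds (\<lambda>x. (- 1 / k) * h i x) x * g i x)"
        unfolding reynolds_sum using I(3) by (intro sum.cong refl reynolds_mult) auto
      finally show "g i0 x = (\<Sum>i\<in>I - {i0}. reynolds (\<lambda>x. (- 1 / k) * h i x) x * g i x)" .
    qed
    then show ?thesis using g by blast
  qed
next
  case (Suc d)
  let ?J = "ideal_span reduced K f"
  have step: "(\<lambda>x. h i0 (act s x) - h i0 x) \<in> ?J" if s: "s \<in> G" "reflection s" for s
  proof -
    obtain l where l: "l \<in> reduced" "homogeneous 1 l" "\<exists>y. l y \<noteq> 0"
      "\<And>p. p \<in> reduced \<Longrightarrow> \<exists>q\<in>reduced. \<forall>x. p (act s x) - p x = l x * q x"
      "\<And>p d. p \<in> reduced \<Longrightarrow> homogeneous (Suc d) p \<Longrightarrow>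
        \<exists>q\<in>reduced. homogeneous d q \<and> (\<forall>x. p (act s x) - p x = l x * q x)"
      using reduced_divided_difference[OF s] by blast
    have "\<exists>q. q \<in> reduced \<and> (\<forall>x. h i (act s x) - h i x = l x * q x) \<and> (i = i0 \<longrightarrow> homogeneous d q)"
      if "i \<in> I" for i
      using l(4)[OF Suc.prems(1)[OF that]] l(5)[OF Suc.prems(1)[OF that], of d] Suc.prems(3) by blast
    then obtain q where q: "\<And>i. i \<in> I \<Longrightarrow> q i \<in> reduced"
      "\<And>i x. i \<in> I \<Longrightarrow> h i (act s x) - h i x = l x * q i x" "homogeneous d (q i0)"
      using I(2) by metis
    obtain y where y: "l y \<noteq> 0" using l(3) by blast
    have "(\<lambda>x. \<Sum>i\<in>I. q i x * g i x) \<in> polynomial_functions"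
      using q(1) I(3)
      by (intro reduced_polynomial function_ring_sum function_ring_mult function_ring_reduced)
        (simp_all add: invariant_reduced)
    moreover have "l x * (\<Sum>i\<in>I. q i x * g i x) = 0" for x
    proof -
      have "l x * (\<Sum>i\<in>I. q i x * g i x) = (\<Sum>i\<in>I. (h i (act s x) - h i x) * g i x)"
        using q(2) by (simp add: sum_distrib_left mult.assoc)
      also have "\<dots> = (\<Sum>i\<in>I. h i (act s x) * g i (act s x)) - (\<Sum>i\<in>I. h i x * g i x)"
        using I(3) s(1) by (simp add: sum_subtractf left_diff_distrib invariant_ring_iff)
      finally show ?thesis using Suc.prems(2) by simp
    qed
    ultimately have "(\<Sum>i\<in>I. q i x * g i x) = 0" for x
      using polynomial_mult_eq_0[of l "\<lambda>x. \<Sum>i\<in>I. q i x * g i x" y x] reduced_polynomial[OF l(1)] y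
      by blast
    from Suc.IH[OF q(1) this q(3)] have "q i0 \<in> ?J" .
    from ideal_span_mult[OF function_ring_reduced l(1) this] show ?thesis
      using q(2)[OF I(2)] by simp
  qed
  have all: "(\<lambda>x. h i0 (act g x) - h i0 x) \<in> ?J" if "g \<in> G" for g
    using that
  proof (induction rule: group_induct)
    case one
    show ?case using ideal_span_zero[OF function_ring_reduced] by (simp add: act_one)
  next
    case (reflection s)
    then show ?case by (rule step)
  next
    case (mult a b)
    have "(\<lambda>x. (h i0 (act a (act b x)) - h i0 (act b x)) + (h i0 (act b x) - h i0 x)) \<in> ?J"
      by (intro ideal_span_add function_ring_reduced mult.IH(2))
        (use ideal_span_act[OF K(2) mult.IH(1) mult.hyps(2)] in simp)
    then show ?case by (simp add: act_mult)
  qed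
  have "(\<lambda>x. (- 1 / of_nat (card G)) * (\<Sum>g\<in>G. h i0 (act g x) - h i0 x)) \<in> ?J"
    by (intro ideal_span_cmult ideal_span_sum function_ring_reduced all)
  moreover have "(- 1 / of_nat (card G)) * (\<Sum>g\<in>G. h i0 (act g x) - h i0 x) = h i0 x - reynolds (h i0) x" for x
    using card_pos by (simp add: sum_subtractf reynolds_def field_simps)
  moreover have "reynolds (h i0) \<in> ?J"
    using pos[OF reynolds_invariant homogeneous_reynolds] Suc.prems(1)[OF I(2)] Suc.prems(3) by blast
  ultimately show ?case
    using ideal_span_add[OF function_ring_reduced, of "\<lambda>x. h i0 x - reynolds (h i0) x" K f "reynolds (h i0)"]
    by simp
qed

text \<open>
  Each graded part of \<open>h i0\<close> occurs in a graded part of the whole relation, since the \<open>g i\<close> are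
  homogeneous.
\<close>

lemma syzygy:
  assumes K: "finite K" "\<And>i. i \<in> K \<Longrightarrow> f i \<in> invariant_ring G"
    and pos: "\<And>p d. p \<in> invariant_ring G \<Longrightarrow> homogeneous d p \<Longrightarrow> 0 < d \<Longrightarrow> p \<in> ideal_span reduced K f"
    and I: "finite I" "i0 \<in> I" "\<And>i. i \<in> I \<Longrightarrow> g i \<in> invariant_ring G" "\<And>i. i \<in> I \<Longrightarrow> homogeneous (e i) (g i)"
    and g: "g i0 \<notin> ideal_span (invariant_ring G) (I - {i0}) g"
    and h: "\<And>i. i \<in> I \<Longrightarrow> h i \<in> reduced" "\<And>x. (\<Sum>i\<in>I. h i x * g i x) = 0"
  shows "h i0 \<in> ideal_span reduced K f"
proof -
  have pf: "h i \<in> generated_algebra (range (\<lambda>i x. x $ i))" "g i \<in> generated_algebra (range (\<lambda>i x. x $ i))"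
    if "i \<in> I" for i
    using that h(1) I(3) reduced_polynomial invariant_reduced unfolding polynomial_functions_def by blast+
  have part: "graded_part vec_scale n (h i0) \<in> ideal_span reduced K f" for n
  proof -
    define h' where "h' i = (if e i \<le> n + e i0 then graded_part vec_scale (n + e i0 - e i) (h i) else (\<lambda>_. 0))" for i
    have "h' i0 \<in> ideal_span reduced K f"
    proof (rule homogeneous_syzygy[OF K pos I(1,2,3) g])
      show "h' i \<in> reduced" if "i \<in> I" for i
        using graded_part_reduced[OF h(1)[OF that]] function_ring_reduced
        by (auto simp: h'_def function_ring_def)
      show "homogeneous n (h' i0)"
        using vec_grading.weighted_homogeneous_graded_part[OF pf(1)[OF I(2)]]
        by (simp add: h'_def homogeneous_iff_weighted)
      fix x
      have "0 = graded_part vec_scale (n + e i0) (\<lambda>x. \<Sum>i\<in>I. h i x * g i x) x"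
        using h(2) vec_grading.graded_part_const[of _ 0] by simp
      also have "\<dots> = (\<Sum>i\<in>I. graded_part vec_scale (n + e i0) (\<lambda>x. h i x * g i x) x)"
        using pf by (intro vec_grading.graded_part_sum generated_algebra.mult)
      also have "\<dots> = (\<Sum>i\<in>I. h' i x * g i x)"
        using vec_grading.graded_part_mult_homogeneous[OF pf I(4)[unfolded homogeneous_iff_weighted]]
        by (intro sum.cong) (simp_all add: h'_def)
      finally show "(\<Sum>i\<in>I. h' i x * g i x) = 0" ..
    qed
    then show ?thesis by (simp add: h'_def)
  qed
  obtain N where "\<And>x. h i0 x = (\<Sum>n\<le>N. graded_part vec_scale n (h i0) x)"
    using vec_grading.sum_graded_parts[OF pf(1)[OF I(2)]] by blast
  then have "h i0 = (\<lambda>x. \<Sum>n\<le>N. graded_part vec_scale n (h i0) x)" by auto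
  moreover have "(\<lambda>x. \<Sum>n\<le>N. graded_part vec_scale n (h i0) x) \<in> ideal_span reduced K f"
    by (intro ideal_span_sum function_ring_reduced part)
  ultimately show ?thesis by simp
qed

end

section \<open>Finite generation of the invariants without constant term\<close>

context matrix_group
begin

text \<open>
  As \<open>f x\<close> is a root of this polynomial, which is monic with invariant coefficients, \<open>f\<close> is integral
  over the invariants.
\<close>

definition orbit_poly :: "(complex ^ 'n \<Rightarrow> complex) \<Rightarrow> complex ^ 'n \<Rightarrow> complex poly" where
  "orbit_poly f x = (\<Prod>g\<in>G. [:- f (act g x), 1:])"

lemma coeff_orbit_poly_invariant:
  assumes "f \<in> reduced"
  shows "(\<lambda>x. coeff (orbit_poly f x) i) \<in> invariant_ring G"
proof -
  have "\<forall>i. (\<lambda>x. coeff (\<Prod>g\<in>A. [:- f (act g x), 1:]) i) \<in> reduced" if "A \<subseteq> G" for A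
    using finite_subset[OF that finite_group] that
  proof (induction A rule: finite_induct)
    case empty
    show ?case using function_ring_reduced by (simp add: function_ring_def)
  next
    case (insert g A)
    then have IH: "(\<lambda>x. coeff (\<Prod>g\<in>A. [:- f (act g x), 1:]) i) \<in> reduced" for i by blast
    have g: "(\<lambda>x. - 1 * f (act g x)) \<in> reduced"
      using insert.prems compose_act_reduced[OF assms] by (intro function_ring_cmult function_ring_reduced) auto
    have "(\<lambda>x. (- 1 * f (act g x)) * coeff (\<Prod>g\<in>A. [:- f (act g x), 1:]) i +
        (case i of 0 \<Rightarrow> 0 | Suc k \<Rightarrow> coeff (\<Prod>g\<in>A. [:- f (act g x), 1:]) k)) \<in> reduced" for i
    proof (cases i)
      case 0
      then show ?thesis using function_ring_mult[OF function_ring_reduced g IH] by simp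
    next
      case (Suc k)
      then show ?thesis
        using function_ring_add[OF function_ring_reduced
            function_ring_mult[OF function_ring_reduced g IH] IH] by simp
    qed
    moreover have "coeff (\<Prod>g\<in>insert g A. [:- f (act g x), 1:]) i =
       (- 1 * f (act g x)) * coeff (\<Prod>g\<in>A. [:- f (act g x), 1:]) i +
        (case i of 0 \<Rightarrow> 0 | Suc k \<Rightarrow> coeff (\<Prod>g\<in>A. [:- f (act g x), 1:]) k)" for i x
      using insert.hyps by (simp add: coeff_pCons split: nat.splits)
    ultimately show ?case by simp
  qed
  then have "(\<lambda>x. coeff (orbit_poly f x) i) \<in> reduced" by (simp add: orbit_poly_def)
  moreover have "orbit_poly f (act h x) = orbit_poly f x" if "h \<in> G" for h x
    using prod.reindex_bij_betw[OF bij_mult_right[OF that], of "\<lambda>g. [:- f (act g x), 1:]"]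
    by (simp add: orbit_poly_def act_mult)
  ultimately show ?thesis by (simp add: invariant_ring_iff)
qed

lemma degree_orbit_poly: "degree (orbit_poly f x) = card G"
  unfolding orbit_poly_def by (subst degree_prod_eq_sum_degree) auto

lemma coeff_orbit_poly_card: "coeff (orbit_poly f x) (card G) = 1"
  using lead_coeff_prod[of "\<lambda>g. [:- f (act g x), 1:]" G] degree_orbit_poly[of f x]
  by (simp add: orbit_poly_def)

lemma homogeneous_coeff_orbit_poly:
  assumes "homogeneous 1 f" "i < card G"
  shows "homogeneous (card G - i) (\<lambda>x. coeff (orbit_poly f x) i)"
  unfolding homogeneous_def
proof (intro allI)
  fix c x
  show "coeff (orbit_poly f (c *s x)) i = c ^ (card G - i) * coeff (orbit_poly f x) i"
  proof (cases "c = 0")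
    case True
    have "orbit_poly f 0 = monom 1 (card G)"
      using homogeneous_at_0[OF assms(1)]
      by (simp add: orbit_poly_def act_zero) (simp add: monom_altdef)
    then show ?thesis using True assms(2) by simp
  next
    case False
    have "pcompose (orbit_poly f (c *s x)) [:0, c:] = smult (c ^ card G) (orbit_poly f x)"
    proof (rule poly_eqI_all)
      fix t
      have "poly (pcompose (orbit_poly f (c *s x)) [:0, c:]) t = (\<Prod>g\<in>G. c * (t - f (act g x)))"
        using assms(1) by (simp add: orbit_poly_def poly_pcompose poly_prod act_scale homogeneous_def algebra_simps)
      then show "poly (pcompose (orbit_poly f (c *s x)) [:0, c:]) t = poly (smult (c ^ card G) (orbit_poly f x)) t"
        by (simp add: prod.distrib orbit_poly_def poly_prod)
    qed
    then have "c ^ i * coeff (orbit_poly f (c *s x)) i = c ^ card G * coeff (orbit_poly f x) i"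
      by (metis coeff_pcompose_linear coeff_smult)
    moreover have "c ^ card G = c ^ i * c ^ (card G - i)"
      using assms(2) by (simp flip: power_add)
    ultimately show ?thesis using False by simp
  qed
qed

lemma orbit_poly_root: "poly (orbit_poly f x) (f x) = 0"
proof -
  have "(\<Prod>g\<in>G. f x - f (act g x)) = 0"
    using finite_group one_in by (intro prod_zero) (auto simp: act_one intro!: bexI[of _ "mat 1"])
  then show ?thesis by (simp add: orbit_poly_def poly_prod)
qed

lemma power_card_eq:
  "f x ^ card G = (\<Sum>i<card G. - coeff (orbit_poly f x) i * f x ^ i)"
proof -
  have "0 = (\<Sum>i\<le>card G. coeff (orbit_poly f x) i * f x ^ i)"
    using orbit_poly_root[of f x] by (simp add: poly_altdef degree_orbit_poly)
  also have "\<dots> = (\<Sum>i<card G. coeff (orbit_poly f x) i * f x ^ i) + f x ^ card G"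
    by (simp add: lessThan_Suc_atMost[symmetric] coeff_orbit_poly_card)
  finally show ?thesis by (simp add: sum_negf eq_neg_iff_add_eq_0 add.commute)
qed

definition coordinate :: "'n \<Rightarrow> complex ^ 'n \<Rightarrow> complex" where
  "coordinate j x = proj x $ j"

lemma coordinate_reduced: "coordinate j \<in> reduced"
  using compose_proj_reduced[OF polynomial_coordinate] by (simp add: coordinate_def[abs_def])

lemma homogeneous_coordinate: "homogeneous 1 (coordinate j)"
  by (simp add: homogeneous_def coordinate_def proj_scale)

definition monomial :: "('n \<Rightarrow> nat) \<Rightarrow> complex ^ 'n \<Rightarrow> complex" where
  "monomial a x = (\<Prod>j\<in>UNIV. coordinate j x ^ a j)"

lemma monomial_reduced: "monomial a \<in> reduced"
proof -
  have "(\<lambda>x. coordinate j x ^ k) \<in> reduced" for j k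
    using function_ring_prod[OF function_ring_reduced, of "{..<k}" "\<lambda>_. coordinate j"]
    by (simp add: coordinate_reduced)
  then show ?thesis
    unfolding monomial_def[abs_def] by (intro function_ring_prod function_ring_reduced)
qed

lemma monomial_add: "monomial (\<lambda>j. a j + b j) x = monomial a x * monomial b x"
  by (simp add: monomial_def power_add prod.distrib)

lemma monomial_single: "monomial (\<lambda>j. if j = i then k else 0) x = coordinate i x ^ k"
  by (simp add: monomial_def if_distrib[of "\<lambda>k. _ ^ k"] prod.If_cases)

inductive_set monomial_span :: "(complex ^ 'n \<Rightarrow> complex) set" where
  base: "monomial a \<in> monomial_span"
| add: "f \<in> monomial_span \<Longrightarrow> g \<in> monomial_span \<Longrightarrow> (\<lambda>x. f x + g x) \<in> monomial_span"
| cmult: "f \<in> monomial_span \<Longrightarrow> (\<lambda>x. c * f x) \<in> monomial_span"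

lemma reduced_monomial_span:
  assumes "p \<in> reduced" shows "p \<in> monomial_span"
proof -
  have coord: "(\<lambda>x. coordinate i x * f x) \<in> monomial_span" if "f \<in> monomial_span" for i f
    using that
  proof induction
    case (base a)
    have "(\<lambda>x. coordinate i x * monomial a x) = monomial (\<lambda>j. (if j = i then 1 else 0) + a j)"
      by (simp only: monomial_add monomial_single fun_eq_iff power_one_right) simp
    then show ?case by (simp add: monomial_span.base)
  next
    case (add f g)
    then show ?case using monomial_span.add by (simp add: distrib_left)
  next
    case (cmult f c)
    then show ?case using monomial_span.cmult[of "\<lambda>x. coordinate i x * f x" c]
      by (simp add: mult.left_commute)
  qed
  have "p \<in> generated_algebra (range (\<lambda>i x. x $ i))"
    using reduced_polynomial[OF assms] by (simp add: polynomial_functions_def)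
  then have "\<forall>f\<in>monomial_span. (\<lambda>x. p (proj x) * f x) \<in> monomial_span"
  proof induction
    case (generator f)
    then obtain i where "f = (\<lambda>x. x $ i)" by blast
    then show ?case using coord[of _ i] by (simp add: coordinate_def)
  next
    case (const c)
    then show ?case by (simp add: monomial_span.cmult)
  next
    case (add f g)
    then show ?case by (simp add: monomial_span.add distrib_right)
  next
    case (mult f g)
    show ?case
    proof
      fix h assume "h \<in> monomial_span"
      then have "(\<lambda>x. f (proj x) * (g (proj x) * h x)) \<in> monomial_span"
        using mult.IH(1)[rule_format, OF mult.IH(2)[rule_format]] by blast
      then show "(\<lambda>x. f (proj x) * g (proj x) * h x) \<in> monomial_span" by (simp add: mult.assoc)
    qed
  qed
  then have "(\<lambda>x. p (proj x) * monomial (\<lambda>_. 0) x) \<in> monomial_span"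
    using monomial_span.base by blast
  then show ?thesis using reduced_proj[OF assms] by (simp add: monomial_def)
qed

text \<open>
  Each coordinate is integral over the invariants, of degree the order of the group.  Hence the
  coefficients of these integral equations, together with the averages of the monomials of small
  exponents, generate: a monomial with a large exponent is a combination, with these coefficients,
  of other monomials, and averaging commutes with the multiplication by invariants.
\<close>

lemma positive_invariants_finitely_generated:
  obtains B where "finite B" "\<And>b. b \<in> B \<Longrightarrow> b \<in> invariant_ring G \<and> (\<exists>d>0. homogeneous d b)"
    "\<And>p d. p \<in> invariant_ring G \<Longrightarrow> homogeneous d p \<Longrightarrow> 0 < d \<Longrightarrow> p \<in> ideal_span (invariant_ring G) B (\<lambda>b. b)"
proof -
  let ?N = "card G" and ?R = "invariant_ring G"
  define E where "E = {a :: 'n \<Rightarrow> nat. (\<forall>j. a j < ?N) \<and> a \<noteq> (\<lambda>_. 0)}"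
  define B where "B = (\<lambda>a. reynolds (monomial a)) ` E \<union>
    (\<lambda>(j, i) x. coeff (orbit_poly (coordinate j) x) i) ` (UNIV \<times> {..<?N})"
  let ?J = "ideal_span ?R B (\<lambda>b. b)"
  have "E \<subseteq> Pi\<^sub>E UNIV (\<lambda>_. {..<?N})" by (auto simp: E_def PiE_def extensional_def)
  then have "finite E" by (rule finite_subset) (simp add: finite_PiE)
  then have finB: "finite B" by (simp add: B_def)
  have hom_monomial: "homogeneous (\<Sum>j\<in>UNIV. a j) (monomial a)" for a
    unfolding monomial_def[abs_def] by (rule homogeneous_prod_power) (rule homogeneous_coordinate)
  have B: "b \<in> ?R \<and> (\<exists>d>0. homogeneous d b)" if "b \<in> B" for b
    using that unfolding B_def
  proof
    assume "b \<in> (\<lambda>a. reynolds (monomial a)) ` E"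
    then obtain a where a: "a \<in> E" "b = reynolds (monomial a)" by blast
    then obtain j where "a j \<noteq> 0" by (auto simp: E_def)
    then have "(\<Sum>j\<in>UNIV. a j) > 0" using member_le_sum[of j UNIV a] by simp
    then show ?thesis
      using a(2) reynolds_invariant[OF monomial_reduced] homogeneous_reynolds[OF hom_monomial] by blast
  next
    assume "b \<in> (\<lambda>(j, i) x. coeff (orbit_poly (coordinate j) x) i) ` (UNIV \<times> {..<?N})"
    then obtain j i where "i < ?N" "b = (\<lambda>x. coeff (orbit_poly (coordinate j) x) i)" by auto
    then show ?thesis
      using coeff_orbit_poly_invariant[OF coordinate_reduced, of j i]
        homogeneous_coeff_orbit_poly[OF homogeneous_coordinate, of i j]
      by (intro conjI exI[of _ "card G - i"]) simp_all
  qed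
  have mono: "reynolds (monomial a) \<in> ?J" if "a \<noteq> (\<lambda>_. 0)" for a
  proof (cases "\<forall>j. a j < ?N")
    case True
    then have "reynolds (monomial a) \<in> B" using that by (auto simp: B_def E_def)
    then show ?thesis using ideal_span_base[OF function_ring_invariant finB, of _ "\<lambda>b. b"] by blast
  next
    case False
    then obtain j where j: "?N \<le> a j" by (auto simp: not_less)
    let ?c = "\<lambda>i x. coeff (orbit_poly (coordinate j) x) i"
    define b where "b = a(j := a j - ?N)"
    have "a = (\<lambda>l. (if l = j then ?N else 0) + b l)" using j by (auto simp: b_def)
    then have "monomial a x = coordinate j x ^ ?N * monomial b x" for x
      using monomial_add[of "\<lambda>l. if l = j then ?N else 0" b x] monomial_single[of j ?N x] by simp
    then have *: "monomial a x = (\<Sum>i<?N. (- 1 * (coordinate j x ^ i * monomial b x)) * ?c i x)" for x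
      by (simp add: power_card_eq sum_distrib_left sum_distrib_right mult_ac)
    have r: "(\<lambda>x. - 1 * (coordinate j x ^ i * monomial b x)) \<in> reduced" for i
      using monomial_reduced[of "\<lambda>l. (if l = j then i else 0) + b l"]
      by (intro function_ring_cmult function_ring_reduced)
        (simp add: monomial_add[abs_def] monomial_single)
    have "reynolds (monomial a) = (\<lambda>x. \<Sum>i<?N. reynolds (\<lambda>x. - 1 * (coordinate j x ^ i * monomial b x)) x * ?c i x)"
    proof
      fix x
      have "reynolds (monomial a) x = reynolds (\<lambda>x. \<Sum>i<?N. (- 1 * (coordinate j x ^ i * monomial b x)) * ?c i x) x"
        using * by (simp add: reynolds_def)
      also have "\<dots> = (\<Sum>i<?N. reynolds (\<lambda>x. - 1 * (coordinate j x ^ i * monomial b x)) x * ?c i x)"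
        unfolding reynolds_sum
        by (intro sum.cong refl reynolds_mult coeff_orbit_poly_invariant coordinate_reduced)
      finally show "reynolds (monomial a) x = \<dots>" .
    qed
    moreover have "?c i \<in> ?J" if "i < ?N" for i
    proof -
      have "?c i \<in> B" using that unfolding B_def by (intro UnI2 image_eqI[of _ _ "(j, i)"]) auto
      then show ?thesis using ideal_span_base[OF function_ring_invariant finB, of _ "\<lambda>b. b"] by blast
    qed
    ultimately show ?thesis
      using r by (auto intro!: ideal_span_sum ideal_span_mult function_ring_invariant reynolds_invariant)
  qed
  \<comment> \<open>The constant accounts for the monomial 1 and vanishes for invariants of positive degree.\<close>
  have up_to_const: "\<exists>c. (\<lambda>x. reynolds f x - c) \<in> ?J" if "f \<in> monomial_span" for f
    using that
  proof induction
    case (base a)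
    show ?case
    proof (cases "a = (\<lambda>_. 0)")
      case True
      have "reynolds (monomial a) x - 1 = 0" for x
        using card_pos True by (simp add: reynolds_def monomial_def)
      then show ?thesis
        using ideal_span_zero[OF function_ring_invariant] by (intro exI[of _ 1]) simp
    next
      case False
      then show ?thesis using mono by (intro exI[of _ 0]) simp
    qed
  next
    case (add f g)
    then obtain c d where "(\<lambda>x. reynolds f x - c) \<in> ?J" "(\<lambda>x. reynolds g x - d) \<in> ?J" by blast
    from ideal_span_add[OF function_ring_invariant this]
    have "(\<lambda>x. reynolds (\<lambda>x. f x + g x) x - (c + d)) \<in> ?J"
      by (simp add: reynolds_def sum.distrib add_divide_distrib algebra_simps)
    then show ?case by blast
  next
    case (cmult f c)
    then obtain d where "(\<lambda>x. reynolds f x - d) \<in> ?J" by blast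
    from ideal_span_cmult[OF function_ring_invariant this, of c]
    have "(\<lambda>x. reynolds (\<lambda>x. c * f x) x - c * d) \<in> ?J"
      by (simp add: reynolds_def sum_distrib_left algebra_simps)
    then show ?case by blast
  qed
  have gen: "p \<in> ?J" if p: "p \<in> ?R" "homogeneous d p" "0 < d" for p d
  proof -
    obtain c where c: "(\<lambda>x. reynolds p x - c) \<in> ?J"
      using up_to_const[OF reduced_monomial_span[OF invariant_reduced[OF p(1)]]] by blast
    then have c: "(\<lambda>x. p x - c) \<in> ?J" using reynolds_id[OF p(1)] by simp
    then obtain u where u: "\<And>x. p x - c = (\<Sum>b\<in>B. u b x * b x)"
      by (rule ideal_spanE) (rule that)
    have "b 0 = 0" if "b \<in> B" for b using B[OF that] homogeneous_at_0 by blast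
    then have "p 0 - c = 0" unfolding u by (intro sum.neutral) simp
    then have "c = 0" using homogeneous_at_0[OF p(2,3)] by simp
    then show ?thesis using c by simp
  qed
  show thesis using that[OF finB B gen] .
qed

text \<open>
  In a generating set of least size no element is redundant.  The family is continued by zero, with
  degree 1, beyond the index \<open>k\<close>, so that homogeneity and positive degrees hold for all indices.
\<close>

lemma minimal_generators:
  obtains k f d where "\<And>i. f i \<in> invariant_ring G" "\<And>i. homogeneous (d i) (f i)" "\<And>i. 0 < d i"
    "\<And>p d. p \<in> invariant_ring G \<Longrightarrow> homogeneous d p \<Longrightarrow> 0 < d \<Longrightarrow> p \<in> ideal_span reduced {..<k :: nat} f"
    "\<And>i. i < k \<Longrightarrow> f i \<notin> ideal_span reduced ({..<k} - {i}) f"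
proof -
  let ?R = "invariant_ring G"
  define good where "good B \<longleftrightarrow> finite B \<and> (\<forall>b\<in>B. b \<in> ?R \<and> (\<exists>d>0. homogeneous d b)) \<and>
    (\<forall>p d. p \<in> ?R \<longrightarrow> homogeneous d p \<longrightarrow> 0 < d \<longrightarrow> p \<in> ideal_span reduced B (\<lambda>b. b))" for B
  have "\<exists>B. good B"
  proof -
    obtain B where "finite B" "\<And>b. b \<in> B \<Longrightarrow> b \<in> invariant_ring G \<and> (\<exists>d>0. homogeneous d b)"
    "\<And>p d. p \<in> invariant_ring G \<Longrightarrow> homogeneous d p \<Longrightarrow> 0 < d \<Longrightarrow> p \<in> ideal_span (invariant_ring G) B (\<lambda>b. b)"
      using positive_invariants_finitely_generated by blast
    moreover have "ideal_span ?R B (\<lambda>b. b) \<subseteq> ideal_span reduced B (\<lambda>b. b)"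
      using invariant_reduced by (intro ideal_span_mono subsetI)
    ultimately have "good B" by (simp add: good_def subset_iff)
    then show ?thesis ..
  qed
  then obtain B where B: "good B" "\<And>B'. good B' \<Longrightarrow> card B \<le> card B'"
    using ex_has_least_nat[of good _ card] by blast
  have finB: "finite B" using B(1) by (simp add: good_def)
  have minimal: "b \<notin> ideal_span reduced (B - {b}) (\<lambda>b. b)" if b: "b \<in> B" for b
  proof
    assume *: "b \<in> ideal_span reduced (B - {b}) (\<lambda>b. b)"
    have "c \<in> ideal_span reduced (B - {b}) (\<lambda>b. b)" if "c \<in> B" for c
      using * ideal_span_base[OF function_ring_reduced, of "B - {b}" c "\<lambda>b. b"] finB that by blast
    then have "p \<in> ideal_span reduced (B - {b}) (\<lambda>b. b)" if "p \<in> ideal_span reduced B (\<lambda>b. b)" for p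
      using ideal_span_trans[OF function_ring_reduced that] by blast
    then have "good (B - {b})" using B(1) by (simp add: good_def)
    from B(2)[OF this] show False using b finB by (meson card_Diff1_less not_less)
  qed
  obtain \<phi> where \<phi>: "bij_betw \<phi> {..<card B} B"
    using ex_bij_betw_nat_finite[OF finB] by (auto simp: atLeast0LessThan)
  define f where "f i = (if i < card B then \<phi> i else (\<lambda>_. 0))" for i
  have f: "i < card B \<Longrightarrow> f i \<in> B" for i using \<phi> by (auto simp: f_def bij_betw_def)
  define d where "d i = (if i < card B then (SOME d. d > 0 \<and> homogeneous d (f i)) else 1)" for i
  have d: "0 < d i \<and> homogeneous (d i) (f i)" for i
  proof (cases "i < card B")
    case True
    then have "\<exists>d. d > 0 \<and> homogeneous d (f i)" using f B(1) by (auto simp: good_def)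
    from someI_ex[OF this] show ?thesis using True by (simp add: d_def)
  qed (auto simp: d_def f_def homogeneous_def)
  have bij: "bij_betw f {..<card B} B"
    using \<phi> by (subst bij_betw_cong[of _ _ \<phi>]) (auto simp: f_def)
  show thesis
  proof (rule that[of f d "card B"])
    show "f i \<in> ?R" for i
      using f B(1) function_ring_invariant by (cases "i < card B") (auto simp: good_def function_ring_def f_def)
    show "homogeneous (d i) (f i)" "0 < d i" for i using d by auto
    fix p d assume "p \<in> ?R" "homogeneous d p" "0 < d"
    then have "p \<in> ideal_span reduced B (\<lambda>b. b)" using B(1) by (simp add: good_def)
    then obtain c where c: "\<And>b. b \<in> B \<Longrightarrow> c b \<in> reduced" "\<And>x. p x = (\<Sum>b\<in>B. c b x * b x)"
      by (rule ideal_spanE) blast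
    show "p \<in> ideal_span reduced {..<card B} f"
    proof (rule ideal_spanI[of _ "\<lambda>i. c (f i)"])
      show "c (f i) \<in> reduced" if "i \<in> {..<card B}" for i using c(1) f that by simp
      show "p x = (\<Sum>i<card B. c (f i) x * f i x)" for x
        unfolding c(2) sum.reindex_bij_betw[OF bij, symmetric] ..
    qed
  next
    fix i assume i: "i < card B"
    have bij': "bij_betw f ({..<card B} - {i}) (B - {f i})"
      using bij i f[OF i] by (auto simp: bij_betw_def inj_on_diff inj_on_def)
    show "f i \<notin> ideal_span reduced ({..<card B} - {i}) f"
    proof
      assume "f i \<in> ideal_span reduced ({..<card B} - {i}) f"
      then obtain c where c: "\<And>j. j \<in> {..<card B} - {i} \<Longrightarrow> c j \<in> reduced"
        "\<And>x. f i x = (\<Sum>j\<in>{..<card B} - {i}. c j x * f j x)" by (rule ideal_spanE) blast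
      let ?inv = "the_inv_into ({..<card B} - {i}) f"
      have "f i \<in> ideal_span reduced (B - {f i}) (\<lambda>b. b)"
      proof (rule ideal_spanI[of _ "\<lambda>b. c (?inv b)"])
        show "c (?inv b) \<in> reduced" if "b \<in> B - {f i}" for b
          using c(1) bij_betwE[OF bij_betw_the_inv_into[OF bij']] that by blast
        show "f i x = (\<Sum>b\<in>B - {f i}. c (?inv b) x * b x)" for x
          unfolding c(2) sum.reindex_bij_betw[OF bij', symmetric]
          using bij' by (intro sum.cong refl) (simp add: the_inv_into_f_f bij_betw_def)
      qed
      then show False using minimal f[OF i] by blast
    qed
  qed
qed

end

section \<open>Algebraic independence of minimal generators\<close>

lemma polynomials_in_eq: "polynomials_in k = generated_algebra ((\<lambda>i (y :: nat \<Rightarrow> complex). y i) ` {..<k})"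
  by (simp add: polynomials_in_def)

lemma polynomials_in_cong:
  assumes "p \<in> polynomials_in k" "\<And>i. i < k \<Longrightarrow> y i = z i"
  shows "p y = p z"
  using assms(1) unfolding polynomials_in_eq
  by induction (use assms(2) in auto)

lemma polynomials_in_variable: "i < k \<Longrightarrow> (\<lambda>y. y i) \<in> polynomials_in k"
  by (auto simp: polynomials_in_eq intro: generated_algebra.generator)

lemma polynomials_in_compose:
  assumes "p \<in> polynomials_in k" "function_ring A" "\<And>i. i < k \<Longrightarrow> f i \<in> A"
  shows "(\<lambda>x. p (\<lambda>i. f i x)) \<in> A"
  using assms(1) unfolding polynomials_in_eq
  by induction (use assms(2,3) in \<open>auto intro: function_ring_const function_ring_add function_ring_mult\<close>)

lemma function_ring_polynomials_in: "function_ring (polynomials_in k)"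
  by (auto simp: function_ring_def polynomials_in_eq intro: generated_algebra.intros)

context reflection_group
begin

text \<open>
  A relation between the generators would have a weighted homogeneous part \<open>q\<close>, chosen of least degree.
  Its partial derivatives, evaluated at the generators, are invariants \<open>P i\<close>, not all zero because
  \<open>q\<close> has least degree.  Differentiating the relation gives a syzygy between the \<open>P i\<close> for each
  coordinate direction \<open>v\<close>.  After elimination of those \<open>P j\<close> that the others generate, the
  coefficient \<open>h v i0\<close> of \<open>P i0\<close> lies in the ideal of the generators, and Euler's formula, applied to
  these coefficients, expresses \<open>f i0\<close> by the other generators.
\<close>

lemma minimal_generators_independent:
  fixes k :: nat
  assumes f: "\<And>i. f i \<in> invariant_ring G" "\<And>i. homogeneous (d i) (f i)" "\<And>i. 0 < d i"
    and pos: "\<And>p d. p \<in> invariant_ring G \<Longrightarrow> homogeneous d p \<Longrightarrow> 0 < d \<Longrightarrow> p \<in> ideal_span reduced {..<k} f"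
    and minimal: "\<And>i. i < k \<Longrightarrow> f i \<notin> ideal_span reduced ({..<k} - {i}) f"
    and p: "p \<in> polynomials_in k" "\<And>x. p (\<lambda>i. f i x) = 0"
  shows "p = (\<lambda>_. 0)"
proof (rule ccontr)
  assume nonzero: "p \<noteq> (\<lambda>_. 0)"
  \<comment> \<open>The variable \<open>y i\<close> has the degree of \<open>f i\<close>, so that substitution preserves degrees.\<close>
  define \<sigma> where "\<sigma> c y = (\<lambda>i. c ^ d i * y i)" for c :: complex and y :: "nat \<Rightarrow> complex"
  interpret wt: graded_algebra \<sigma> "(\<lambda>i (y :: nat \<Rightarrow> complex). y i) ` {..<k}"
    by standard (auto simp: \<sigma>_def weighted_homogeneous_def power_mult_distrib mult.assoc)
  have f_scale: "(\<lambda>i. f i (c *s x)) = \<sigma> c (\<lambda>i. f i x)" for c x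
    using f(2) by (auto simp: homogeneous_def \<sigma>_def)
  define relation where "relation n q \<longleftrightarrow> q \<in> polynomials_in k \<and> weighted_homogeneous \<sigma> n q \<and>
    q \<noteq> (\<lambda>_. 0) \<and> (\<forall>x. q (\<lambda>i. f i x) = 0)" for n q
  have "\<exists>n q. relation n q"
  proof -
    obtain N where N: "\<And>y. p y = (\<Sum>n\<le>N. graded_part \<sigma> n p y)"
      using wt.sum_graded_parts p(1) unfolding polynomials_in_eq by blast
    obtain n where n: "graded_part \<sigma> n p \<noteq> (\<lambda>_. 0)"
    proof (rule ccontr)
      assume "\<not> thesis"
      then have "p y = 0" for y using N[of y] that by (metis sum.neutral)
      then show False using nonzero by auto
    qed
    have "graded_part \<sigma> n p (\<lambda>i. f i x) = 0" for x
    proof -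
      have "p (\<sigma> t (\<lambda>i. f i x)) = poly 0 t" for t using p(2)[of "t *s x"] by (simp add: f_scale)
      from graded_part_eq[of p \<sigma>, OF this] show ?thesis by simp
    qed
    then have "relation n (graded_part \<sigma> n p)"
      using n wt.graded_part_in wt.weighted_homogeneous_graded_part p(1)
      by (simp add: relation_def polynomials_in_eq)
    then show ?thesis by blast
  qed
  then have "\<exists>n q. relation n q \<and> (\<forall>m r. relation m r \<longrightarrow> n \<le> m)"
    using LeastI_ex[of "\<lambda>n. \<exists>q. relation n q"] Least_le[of "\<lambda>n. \<exists>q. relation n q"] by blast
  then obtain n q where q: "relation n q" and least: "\<And>m r. relation m r \<Longrightarrow> n \<le> m" by blast
  have qk: "q \<in> polynomials_in k" and qh: "weighted_homogeneous \<sigma> n q" and q0: "q \<noteq> (\<lambda>_. 0)"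
    and qf: "\<And>x. q (\<lambda>i. f i x) = 0"
    using q by (auto simp: relation_def)

  have curve: "\<exists>\<gamma>. \<gamma> 0 = y \<and> (\<forall>j\<in>{..<k}. ((\<lambda>t. \<gamma> t j) has_field_derivative (if j = i then 1 else 0)) (at 0))"
    if "i \<in> {..<k}" for y :: "nat \<Rightarrow> complex" and i
    by (rule exI[of _ "\<lambda>t. y(i := y i + t)"]) (auto intro!: derivative_eq_intros)
  obtain D where D: "\<And>i. i < k \<Longrightarrow> D i \<in> polynomials_in k"
    "\<And>i. i < k \<Longrightarrow> d i \<le> n \<Longrightarrow> weighted_homogeneous \<sigma> (n - d i) (D i)"
    "\<And>i. i < k \<Longrightarrow> \<not> d i \<le> n \<Longrightarrow> D i = (\<lambda>_. 0)"
    "\<And>\<gamma> u t. (\<And>i. i < k \<Longrightarrow> ((\<lambda>t. \<gamma> t i) has_field_derivative u i) (at t)) \<Longrightarrow>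
       ((\<lambda>t. q (\<gamma> t)) has_field_derivative (\<Sum>i<k. D i (\<gamma> t) * u i)) (at t)"
    by (rule wt.homogeneous_partial_derivatives[of "{..<k}" "\<lambda>i y. y i" d q n])
      (use curve qk qh in \<open>auto simp: polynomials_in_eq weighted_homogeneous_def \<sigma>_def\<close>)
  define P where "P i x = D i (\<lambda>j. f j x)" for i x
  have P_inv: "P i \<in> invariant_ring G" if "i < k" for i
    unfolding P_def[abs_def]
    by (rule polynomials_in_compose[OF D(1)[OF that] function_ring_invariant f(1)])
  have P_hom: "homogeneous (n - d i) (P i)" if "i < k" for i
    using D(2,3)[OF that]
    by (cases "d i \<le> n") (auto simp: P_def homogeneous_def f_scale weighted_homogeneous_def)

  have some_P: "\<exists>i<k. P i \<noteq> (\<lambda>_. 0)"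
  proof (rule ccontr)
    assume "\<not> ?thesis"
    then have P0: "P i = (\<lambda>_. 0)" if "i < k" for i using that by blast
    have D0: "D i = (\<lambda>_. 0)" if i: "i < k" for i
    proof (rule ccontr)
      assume "D i \<noteq> (\<lambda>_. 0)"
      then have "d i \<le> n" "relation (n - d i) (D i)"
        using D(1-3)[OF i] P0[OF i] by (auto simp: relation_def P_def fun_eq_iff)
      then show False using least f(3)[of i] by fastforce
    qed
    \<comment> \<open>Euler's formula for the weights leaves the case of a constant \<open>q\<close>, which would vanish.\<close>
    have "of_nat n * q y = 0" for y
    proof -
      have "((\<lambda>t. q (\<sigma> t y)) has_field_derivative (\<Sum>i<k. D i (\<sigma> 1 y) * (of_nat (d i) * y i))) (at 1)"
        by (rule D(4)) (auto simp: \<sigma>_def intro!: derivative_eq_intros)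
      moreover have "((\<lambda>t. q (\<sigma> t y)) has_field_derivative of_nat n * q y) (at 1)"
        using qh unfolding weighted_homogeneous_def by (auto intro!: derivative_eq_intros)
      ultimately show ?thesis using D0 DERIV_unique by fastforce
    qed
    then have "n = 0" using q0 by fastforce
    moreover have "\<sigma> 0 y = (\<lambda>_. 0)" for y using f(3) by (auto simp: \<sigma>_def)
    ultimately have "q y = q (\<lambda>_. 0)" for y
      using qh[unfolded weighted_homogeneous_def, rule_format, of 0 y] by simp
    then show False using q0 qf by (metis ext)
  qed

  have "\<exists>A. A \<subseteq> {..<k} \<and> (\<forall>j<k. P j \<in> ideal_span (invariant_ring G) A P) \<and>
    (\<forall>A'. A' \<subseteq> {..<k} \<and> (\<forall>j<k. P j \<in> ideal_span (invariant_ring G) A' P) \<longrightarrow> card A \<le> card A')"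
    by (rule ex_has_least_nat[of "\<lambda>A. A \<subseteq> {..<k} \<and> (\<forall>j<k. P j \<in> ideal_span (invariant_ring G) A P)" "{..<k}" card,
        simplified conj_assoc]) (auto intro: ideal_span_base function_ring_invariant)
  then obtain A where A: "A \<subseteq> {..<k}" "\<And>j. j < k \<Longrightarrow> P j \<in> ideal_span (invariant_ring G) A P"
    and A_least: "\<And>A'. A' \<subseteq> {..<k} \<Longrightarrow> (\<And>j. j < k \<Longrightarrow> P j \<in> ideal_span (invariant_ring G) A' P) \<Longrightarrow> card A \<le> card A'"
    by blast
  have finA: "finite A" using A(1) finite_subset by blast
  have "A \<noteq> {}"
  proof
    assume "A = {}"
    then have "P j = (\<lambda>_. 0)" if "j < k" for j using A(2)[OF that] by (auto simp: ideal_span_def)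
    then show False using some_P by blast
  qed
  then obtain i0 where i0: "i0 \<in> A" by blast
  have i0k: "i0 < k" using i0 A(1) by blast
  have not_span: "P i0 \<notin> ideal_span (invariant_ring G) (A - {i0}) P"
  proof
    assume *: "P i0 \<in> ideal_span (invariant_ring G) (A - {i0}) P"
    have "P i \<in> ideal_span (invariant_ring G) (A - {i0}) P" if "i \<in> A" for i
      using * ideal_span_base[OF function_ring_invariant, of "A - {i0}" i P] finA that by (cases "i = i0") auto
    then have "P j \<in> ideal_span (invariant_ring G) (A - {i0}) P" if "j < k" for j
      using ideal_span_trans[OF function_ring_invariant A(2)[OF that]] by blast
    then have "card A \<le> card (A - {i0})" using A(1) by (intro A_least) auto
    then show False using i0 finA by (meson card_Diff1_less not_less)
  qed
  have "\<exists>c. (\<forall>i\<in>A. c i \<in> invariant_ring G) \<and> (\<forall>x. P j x = (\<Sum>i\<in>A. c i x * P i x))" if "j < k" for j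
    using A(2)[OF that] by (auto simp: ideal_span_def)
  then have "\<forall>j. \<exists>c. j < k \<longrightarrow> (\<forall>i\<in>A. c i \<in> invariant_ring G) \<and> (\<forall>x. P j x = (\<Sum>i\<in>A. c i x * P i x))"
    by blast
  from choice[OF this] obtain c where c: "\<And>j i. j < k \<Longrightarrow> i \<in> A \<Longrightarrow> c j i \<in> invariant_ring G"
    "\<And>j x. j < k \<Longrightarrow> P j x = (\<Sum>i\<in>A. c j i x * P i x)"
    by blast

  have "\<exists>E. (\<forall>v. E v \<in> polynomial_functions) \<and>
     (\<forall>x v. ((\<lambda>t. f i (x + t *s axis v 1)) has_field_derivative E v x) (at 0)) \<and>
     (\<forall>x. (\<Sum>v\<in>UNIV. E v x * x $ v) = of_nat (d i) * f i x)" for i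
    by (rule polynomial_partial_derivatives[OF reduced_polynomial[OF invariant_reduced[OF f(1)]] f(2,3), of i])
      blast
  then have "\<forall>i. \<exists>E. (\<forall>v. E v \<in> polynomial_functions) \<and>
     (\<forall>x v. ((\<lambda>t. f i (x + t *s axis v 1)) has_field_derivative E v x) (at 0)) \<and>
     (\<forall>x. (\<Sum>v\<in>UNIV. E v x * x $ v) = of_nat (d i) * f i x)" ..
  from choice[OF this] obtain E where E: "\<And>i v. E i v \<in> polynomial_functions"
    "\<And>i x v. ((\<lambda>t. f i (x + t *s axis v 1)) has_field_derivative E i v x) (at 0)"
    "\<And>i x. (\<Sum>v\<in>UNIV. E i v x * x $ v) = of_nat (d i) * f i x"
    by blast
  have chain: "(\<Sum>i<k. P i x * E i v x) = 0" for x v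
  proof -
    have "((\<lambda>t. q (\<lambda>i. f i (x + t *s axis v 1))) has_field_derivative
        (\<Sum>i<k. D i (\<lambda>i. f i (x + 0 *s axis v 1)) * E i v x)) (at 0)"
      by (rule D(4)) (rule E(2))
    moreover have "((\<lambda>t. q (\<lambda>i. f i (x + t *s axis v 1))) has_field_derivative 0) (at 0)"
      by (simp add: qf)
    ultimately show ?thesis using DERIV_unique by (fastforce simp: P_def)
  qed
  \<comment> \<open>The coefficient of \<open>P i\<close> after the \<open>P j\<close> outside \<open>A\<close> have been substituted.\<close>
  let ?C = "{..<k} - A"
  define h where "h v i x = E i v (proj x) + (\<Sum>j\<in>?C. c j i x * E j v (proj x))" for v i x
  have "h v i0 \<in> ideal_span reduced {..<k} f" for v
  proof (rule syzygy[OF _ f(1) pos finA i0, where g = P and e = "\<lambda>i. n - d i" and h = "h v"])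
    show "h v i \<in> reduced" if "i \<in> A" for i
      unfolding h_def[abs_def]
      by (intro function_ring_add function_ring_sum function_ring_mult function_ring_reduced
          compose_proj_reduced E(1) invariant_reduced c(1)) (use that in auto)
    fix x
    have "(\<Sum>i\<in>A. h v i x * P i x)
        = (\<Sum>i\<in>A. E i v (proj x) * P i x) + (\<Sum>i\<in>A. \<Sum>j\<in>?C. c j i x * E j v (proj x) * P i x)"
      by (simp add: h_def distrib_right sum.distrib sum_distrib_right)
    also have "(\<Sum>i\<in>A. \<Sum>j\<in>?C. c j i x * E j v (proj x) * P i x)
        = (\<Sum>j\<in>?C. E j v (proj x) * P j x)"
      using c(2) by (subst sum.swap) (simp add: sum_distrib_left mult_ac)
    also have "(\<Sum>i\<in>A. E i v (proj x) * P i x) + \<dots> = (\<Sum>i<k. E i v (proj x) * P i x)"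
      using sum.subset_diff[OF A(1), of "\<lambda>i. E i v (proj x) * P i x"] by simp
    also have "\<dots> = (\<Sum>i<k. P i (proj x) * E i v (proj x))"
      using reduced_proj[OF invariant_reduced[OF P_inv]] by (intro sum.cong) (auto simp: mult.commute)
    finally show "(\<Sum>i\<in>A. h v i x * P i x) = 0" using chain by simp
  qed (use P_inv P_hom A(1) not_span in auto)
  then have "\<forall>v. \<exists>b. (\<forall>l\<in>{..<k}. b l \<in> reduced) \<and> (\<forall>x. h v i0 x = (\<Sum>l<k. b l x * f l x))"
    unfolding ideal_span_def mem_Collect_eq by (rule allI)
  from choice[OF this] obtain b where b: "\<And>v l. l < k \<Longrightarrow> b v l \<in> reduced"
    "\<And>v x. h v i0 x = (\<Sum>l<k. b v l x * f l x)"
    by blast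

  define a where "a l x = (\<Sum>v\<in>UNIV. b v l x * coordinate v x)" for l x
  define r where "r l x = a l x - (if l \<in> A then 0 else of_nat (d l) * c l i0 x)" for l x
  have a_red: "a l \<in> reduced" if "l < k" for l
    unfolding a_def[abs_def]
    by (intro function_ring_sum function_ring_mult function_ring_reduced b(1)[OF that] coordinate_reduced)
  have r_red: "r l \<in> reduced" if "l < k" for l
    unfolding r_def[abs_def]
  proof (intro function_ring_diff function_ring_reduced a_red that)
    show "(\<lambda>x. if l \<in> A then 0 else of_nat (d l) * c l i0 x) \<in> reduced"
    proof (cases "l \<in> A")
      case True
      then show ?thesis using function_ring_const[OF function_ring_reduced] by simp
    next
      case False
      then show ?thesis
        using function_ring_cmult[OF function_ring_reduced invariant_reduced[OF c(1)[OF that i0]]] by simp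
    qed
  qed
  have Euler: "(\<Sum>v\<in>UNIV. E i v (proj x) * coordinate v x) = of_nat (d i) * f i x" for i x
    using E(3)[of i "proj x"] reduced_proj[OF invariant_reduced[OF f(1)]] by (simp add: coordinate_def)
  have main: "of_nat (d i0) * f i0 x = (\<Sum>l<k. r l x * f l x)" for x
  proof -
    have "(\<Sum>l<k. a l x * f l x) = (\<Sum>v\<in>UNIV. h v i0 x * coordinate v x)"
      unfolding b(2) a_def sum_distrib_right by (subst sum.swap) (simp add: mult_ac)
    also have "\<dots> = of_nat (d i0) * f i0 x +
        (\<Sum>v\<in>UNIV. \<Sum>j\<in>?C. c j i0 x * E j v (proj x) * coordinate v x)"
      by (simp add: h_def distrib_right sum.distrib sum_distrib_right Euler)
    also have "(\<Sum>v\<in>UNIV. \<Sum>j\<in>?C. c j i0 x * E j v (proj x) * coordinate v x)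
        = (\<Sum>j\<in>?C. c j i0 x * (of_nat (d j) * f j x))"
      by (subst sum.swap) (simp add: Euler[symmetric] sum_distrib_left mult.assoc)
    also have "\<dots> = (\<Sum>l<k. (if l \<in> A then 0 else of_nat (d l) * c l i0 x) * f l x)"
      by (rule sum.mono_neutral_cong_left) (auto simp: mult_ac)
    finally show ?thesis
      by (simp add: r_def left_diff_distrib sum_subtractf)
  qed
  have pf: "p \<in> reduced \<Longrightarrow> p \<in> generated_algebra (range (\<lambda>i x. x $ i))" for p
    using reduced_polynomial by (simp add: polynomial_functions_def)
  \<comment> \<open>In degree \<open>d i0\<close> the coefficient of \<open>f i0\<close> has degree 0, but \<open>a i0\<close> has no constant term.\<close>
  define s where "s l = (if d l \<le> d i0 then graded_part vec_scale (d i0 - d l) (r l) else (\<lambda>_. 0))" for l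
  have s_red: "s l \<in> reduced" if "l < k" for l
    using graded_part_reduced[OF r_red[OF that]] function_ring_const[OF function_ring_reduced] by (simp add: s_def)
  have graded: "of_nat (d i0) * f i0 x = (\<Sum>l<k. s l x * f l x)" for x
  proof -
    have "of_nat (d i0) * f i0 x = graded_part vec_scale (d i0) (\<lambda>x. of_nat (d i0) * f i0 x) x"
      using f(2)[of i0] by (subst vec_grading.graded_part_homogeneous[of "d i0"])
        (auto simp: weighted_homogeneous_def homogeneous_def)
    also have "\<dots> = graded_part vec_scale (d i0) (\<lambda>x. \<Sum>l<k. r l x * f l x) x"
      by (simp add: main)
    also have "\<dots> = (\<Sum>l<k. graded_part vec_scale (d i0) (\<lambda>x. r l x * f l x) x)"
      by (intro vec_grading.graded_part_sum generated_algebra.mult pf r_red invariant_reduced f(1)) auto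
    also have "\<dots> = (\<Sum>l<k. s l x * f l x)"
      using vec_grading.graded_part_mult_homogeneous[OF pf[OF r_red] pf[OF invariant_reduced[OF f(1)]]
          f(2)[unfolded homogeneous_iff_weighted]]
      by (intro sum.cong) (simp_all add: s_def)
    finally show ?thesis .
  qed
  have "s i0 x = 0" for x
  proof -
    have "s i0 x = graded_part vec_scale 0 (\<lambda>x. \<Sum>v\<in>UNIV. b v i0 x * coordinate v x) x"
      using i0 by (simp add: s_def r_def[abs_def] a_def)
    also have "\<dots> = (\<Sum>v\<in>UNIV. graded_part vec_scale 0 (\<lambda>x. b v i0 x * coordinate v x) x)"
      by (intro vec_grading.graded_part_sum generated_algebra.mult pf b(1) coordinate_reduced i0k)
    also have "\<dots> = 0"
      using vec_grading.graded_part_mult_homogeneous[OF pf[OF b(1)[OF i0k]] pf[OF coordinate_reduced]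
          homogeneous_coordinate[unfolded homogeneous_iff_weighted]] by simp
    finally show ?thesis .
  qed
  then have others: "of_nat (d i0) * f i0 x = (\<Sum>l\<in>{..<k} - {i0}. s l x * f l x)" for x
    using graded[of x] i0k by (simp add: sum.remove[of "{..<k}" i0])
  have "f i0 x = (\<Sum>l\<in>{..<k} - {i0}. inverse (of_nat (d i0)) * s l x * f l x)" for x
  proof -
    have "f i0 x = inverse (of_nat (d i0)) * (of_nat (d i0) * f i0 x)" using f(3)[of i0] by simp
    then show ?thesis unfolding others by (simp add: sum_distrib_left mult.assoc)
  qed
  then have "f i0 \<in> ideal_span reduced ({..<k} - {i0}) f"
    by (intro ideal_spanI[of _ "\<lambda>l x. inverse (of_nat (d i0)) * s l x"])
      (use s_red in \<open>auto intro: function_ring_cmult function_ring_reduced\<close>)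
  then show False using minimal[OF i0k] by blast
qed

end

context matrix_group
begin

text \<open>
  An invariant of positive degree is a combination of the generators, whose coefficients can be
  averaged and then have lower degree.
\<close>

lemma ideal_generators_generate_homogeneous:
  fixes k :: nat
  assumes f: "\<And>i. f i \<in> invariant_ring G" "\<And>i. homogeneous (d i) (f i)" "\<And>i. 0 < d i"
    and pos: "\<And>p d. p \<in> invariant_ring G \<Longrightarrow> homogeneous d p \<Longrightarrow> 0 < d \<Longrightarrow> p \<in> ideal_span reduced {..<k} f"
    and "p \<in> invariant_ring G" "homogeneous n p"
  shows "\<exists>P\<in>polynomials_in k. \<forall>x. p x = P (\<lambda>i. f i x)"
  using assms(5,6)
proof (induction n arbitrary: p rule: less_induct)
  case (less n)
  have pf: "q \<in> reduced \<Longrightarrow> q \<in> generated_algebra (range (\<lambda>i x. x $ i))" for q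
    using reduced_polynomial by (simp add: polynomial_functions_def)
  show ?case
  proof (cases "n = 0")
    case True
    then have "p x = p 0" for x
      using less.prems(2) unfolding homogeneous_def by (metis mult_1 power_0 vector_smult_lzero)
    then show ?thesis
      by (intro bexI[of _ "\<lambda>_. p 0"]) (auto simp: function_ring_const[OF function_ring_polynomials_in])
  next
    case False
    then have "p \<in> ideal_span reduced {..<k} f" using pos less.prems by blast
    then obtain b where b: "\<And>l. l < k \<Longrightarrow> b l \<in> reduced" "\<And>x. p x = (\<Sum>l<k. b l x * f l x)"
      by (auto simp: ideal_span_def)
    define b' where "b' l = (if d l \<le> n then graded_part vec_scale (n - d l) (b l) else (\<lambda>_. 0))" for l
    have b'_red: "b' l \<in> reduced" if "l < k" for l
      using graded_part_reduced[OF b(1)[OF that]] function_ring_const[OF function_ring_reduced] by (simp add: b'_def)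
    have b'_hom: "homogeneous (n - d l) (b' l)" if "l < k" for l
      using vec_grading.weighted_homogeneous_graded_part[OF pf[OF b(1)[OF that]]]
      by (auto simp: b'_def homogeneous_iff_weighted weighted_homogeneous_def)
    have "p x = (\<Sum>l<k. b' l x * f l x)" for x
    proof -
      have "p x = graded_part vec_scale n p x"
        using less.prems(2) vec_grading.graded_part_homogeneous[of n p n x]
        by (simp add: homogeneous_iff_weighted)
      also have "\<dots> = graded_part vec_scale n (\<lambda>x. \<Sum>l<k. b l x * f l x) x"
        using b(2) by (simp add: graded_part_def)
      also have "\<dots> = (\<Sum>l<k. graded_part vec_scale n (\<lambda>x. b l x * f l x) x)"
        by (intro vec_grading.graded_part_sum generated_algebra.mult pf b invariant_reduced f(1)) auto
      also have "\<dots> = (\<Sum>l<k. b' l x * f l x)"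
        using vec_grading.graded_part_mult_homogeneous[OF pf[OF b(1)] pf[OF invariant_reduced[OF f(1)]]
            f(2)[unfolded homogeneous_iff_weighted]]
        by (intro sum.cong) (simp_all add: b'_def)
      finally show ?thesis .
    qed
    then have p_eq: "p = (\<lambda>x. \<Sum>l<k. b' l x * f l x)" by auto
    have "p x = (\<Sum>l<k. reynolds (b' l) x * f l x)" for x
    proof -
      have "p x = reynolds (\<lambda>x. \<Sum>l<k. b' l x * f l x) x"
        using reynolds_id[OF less.prems(1)] p_eq by simp
      also have "\<dots> = (\<Sum>l<k. reynolds (b' l) x * f l x)"
        unfolding reynolds_sum by (intro sum.cong refl reynolds_mult f(1))
      finally show ?thesis .
    qed
    moreover have "\<exists>P\<in>polynomials_in k. \<forall>x. reynolds (b' l) x = P (\<lambda>i. f i x)" if "l < k" for l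
      using that False f(3)[of l]
      by (intro less.IH[of "n - d l"] reynolds_invariant homogeneous_reynolds b'_red b'_hom) auto
    then obtain P where P: "\<And>l. l < k \<Longrightarrow> P l \<in> polynomials_in k"
      "\<And>l x. l < k \<Longrightarrow> reynolds (b' l) x = P l (\<lambda>i. f i x)" by metis
    ultimately have "\<forall>x. p x = (\<Sum>l<k. P l (\<lambda>i. f i x) * f l x)" by simp
    moreover have "(\<lambda>y. \<Sum>l<k. P l y * y l) \<in> polynomials_in k"
      by (intro function_ring_sum function_ring_mult function_ring_polynomials_in P(1) polynomials_in_variable) auto
    ultimately show ?thesis by (intro bexI[of _ "\<lambda>y. \<Sum>l<k. P l y * y l"])
  qed
qed

lemma ideal_generators_generate:
  fixes k :: nat
  assumes f: "\<And>i. f i \<in> invariant_ring G" "\<And>i. homogeneous (d i) (f i)" "\<And>i. 0 < d i"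
    and pos: "\<And>p d. p \<in> invariant_ring G \<Longrightarrow> homogeneous d p \<Longrightarrow> 0 < d \<Longrightarrow> p \<in> ideal_span reduced {..<k} f"
    and p: "p \<in> invariant_ring G"
  shows "\<exists>P\<in>polynomials_in k. \<forall>x. p x = P (\<lambda>i. f i x)"
proof -
  have pf: "p \<in> generated_algebra (range (\<lambda>i x. x $ i))"
    using reduced_polynomial[OF invariant_reduced[OF p]] by (simp add: polynomial_functions_def)
  have "homogeneous n (graded_part vec_scale n p)" for n
    using vec_grading.weighted_homogeneous_graded_part[OF pf] by (simp add: homogeneous_iff_weighted)
  then have "\<exists>P\<in>polynomials_in k. \<forall>x. graded_part vec_scale n p x = P (\<lambda>i. f i x)" for n
    using graded_part_invariant[OF p]
    by (intro ideal_generators_generate_homogeneous[OF f pos])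
  then obtain P where P: "\<And>n. P n \<in> polynomials_in k"
    "\<And>n x. graded_part vec_scale n p x = P n (\<lambda>i. f i x)" by metis
  obtain N where "\<And>x. p x = (\<Sum>n\<le>N. graded_part vec_scale n p x)"
    using vec_grading.sum_graded_parts[OF pf] by blast
  then have "\<forall>x. p x = (\<Sum>n\<le>N. P n (\<lambda>i. f i x))" using P(2) by simp
  moreover have "(\<lambda>y. \<Sum>n\<le>N. P n y) \<in> polynomials_in k"
    by (intro function_ring_sum function_ring_polynomials_in P(1))
  ultimately show ?thesis by (intro bexI[of _ "\<lambda>y. \<Sum>n\<le>N. P n y"])
qed

end

section \<open>Surjectivity of the quotient map\<close>

text \<open>Modulo \<open>J\<close> the generators may be replaced by their values at \<open>b\<close>.\<close>

lemma function_ring_eval_mod: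
  assumes "p \<in> generated_algebra S" "function_ring A"
    and J: "\<And>p q. p \<in> J \<Longrightarrow> q \<in> J \<Longrightarrow> (\<lambda>x. p x + q x) \<in> J" "\<And>a p. a \<in> A \<Longrightarrow> p \<in> J \<Longrightarrow> (\<lambda>x. a x * p x) \<in> J"
      "(\<lambda>_. 0) \<in> J"
    and S: "\<And>f. f \<in> S \<Longrightarrow> (\<lambda>x. f (\<phi> x)) \<in> A" "\<And>f. f \<in> S \<Longrightarrow> (\<lambda>x. f (\<phi> x) - f b) \<in> J"
  shows "(\<lambda>x. p (\<phi> x) - p b) \<in> J"
proof -
  have "(\<lambda>x. p (\<phi> x)) \<in> A \<and> (\<lambda>x. p (\<phi> x) - p b) \<in> J"
    using assms(1)
  proof induction
    case (generator f)
    then show ?case using S by blast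
  next
    case (const c)
    show ?case using J(3) function_ring_const[OF assms(2)] by simp
  next
    case (add f g)
    have "(\<lambda>x. (f (\<phi> x) - f b) + (g (\<phi> x) - g b)) \<in> J" using J(1) add.IH by blast
    then show ?case using add.IH function_ring_add[OF assms(2)] by (simp add: algebra_simps)
  next
    case (mult f g)
    have "(\<lambda>x. f (\<phi> x) * (g (\<phi> x) - g b) + g b * (f (\<phi> x) - f b)) \<in> J"
      using J(1)[OF J(2) J(2)[OF function_ring_const[OF assms(2)]]] mult.IH by blast
    then show ?case using mult.IH function_ring_mult[OF assms(2)] by (simp add: algebra_simps)
  qed
  then show ?thesis ..
qed

context matrix_group
begin

definition is_ideal :: "(complex ^ 'n \<Rightarrow> complex) set \<Rightarrow> bool" where
  "is_ideal J \<longleftrightarrow> (\<forall>p\<in>J. \<forall>q\<in>J. (\<lambda>x. p x + q x) \<in> J) \<and> (\<forall>a\<in>reduced. \<forall>p\<in>J. (\<lambda>x. a x * p x) \<in> J) \<and>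
     (\<lambda>_. 0) \<in> J"

lemma is_ideal_add: "is_ideal J \<Longrightarrow> p \<in> J \<Longrightarrow> q \<in> J \<Longrightarrow> (\<lambda>x. p x + q x) \<in> J"
  by (simp add: is_ideal_def)

lemma is_ideal_mult: "is_ideal J \<Longrightarrow> a \<in> reduced \<Longrightarrow> p \<in> J \<Longrightarrow> (\<lambda>x. a x * p x) \<in> J"
  by (simp add: is_ideal_def)

lemma is_ideal_cmult: "is_ideal J \<Longrightarrow> p \<in> J \<Longrightarrow> (\<lambda>x. c * p x) \<in> J"
  by (intro is_ideal_mult function_ring_const function_ring_reduced)

text \<open>
  If adding \<open>u - z\<close> for a root \<open>z\<close> of \<open>q\<close> gives the unit ideal, then \<open>J\<close> contains the quotient of
  \<open>q (u)\<close> by \<open>u - z\<close>, and the argument continues with this polynomial of lower degree.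
\<close>

lemma adjoin_root:
  assumes "is_ideal J" "(\<lambda>_. 1) \<notin> J" "u \<in> reduced" "q \<noteq> 0" "(\<lambda>x. poly q (u x)) \<in> J"
  shows "\<exists>z J'. is_ideal J' \<and> J \<subseteq> J' \<and> (\<lambda>_. 1) \<notin> J' \<and> (\<lambda>x. u x - z) \<in> J'"
  using assms(4,5)
proof (induction "degree q" arbitrary: q)
  case 0
  then obtain c where c: "q = [:c:]" "c \<noteq> 0" using degree_eq_zeroE by (metis pCons_eq_0_iff)
  have "(\<lambda>x. (1 / c) * poly q (u x)) \<in> J" by (rule is_ideal_cmult[OF assms(1) 0(3)])
  then show ?case using c assms(2) by simp
next
  case (Suc n)
  then have "\<not> constant (poly q)" by (simp add: constant_degree)
  then obtain z where "poly q z = 0" using fundamental_theorem_of_algebra by blast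
  then obtain q' where q': "q = [:- z, 1:] * q'" using poly_eq_0_iff_dvd dvdE by metis
  define J' where "J' = {\<lambda>x. w x + h x * (u x - z) | w h. w \<in> J \<and> h \<in> reduced}"
  have u': "(\<lambda>x. u x - z) \<in> reduced"
    by (intro function_ring_diff function_ring_const function_ring_reduced assms(3))
  have "is_ideal J'"
    unfolding is_ideal_def
  proof (intro conjI ballI)
    fix p p' assume "p \<in> J'" "p' \<in> J'"
    then obtain w h w' h' where *: "w \<in> J" "h \<in> reduced" "p = (\<lambda>x. w x + h x * (u x - z))"
      "w' \<in> J" "h' \<in> reduced" "p' = (\<lambda>x. w' x + h' x * (u x - z))" by (auto simp: J'_def)
    have "(\<lambda>x. p x + p' x) = (\<lambda>x. (w x + w' x) + (h x + h' x) * (u x - z))"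
      by (simp add: * algebra_simps)
    moreover have "(\<lambda>x. w x + w' x) \<in> J" "(\<lambda>x. h x + h' x) \<in> reduced"
      using * assms(1) function_ring_add[OF function_ring_reduced] by (auto simp: is_ideal_def)
    ultimately show "(\<lambda>x. p x + p' x) \<in> J'"
      unfolding J'_def mem_Collect_eq by (intro exI[of _ "\<lambda>x. w x + w' x"] exI[of _ "\<lambda>x. h x + h' x"]) simp
  next
    fix a p assume a: "a \<in> reduced" and "p \<in> J'"
    then obtain w h where *: "w \<in> J" "h \<in> reduced" "p = (\<lambda>x. w x + h x * (u x - z))"
      by (auto simp: J'_def)
    have "(\<lambda>x. a x * p x) = (\<lambda>x. a x * w x + (a x * h x) * (u x - z))"
      by (simp add: * algebra_simps)
    moreover have "(\<lambda>x. a x * w x) \<in> J" "(\<lambda>x. a x * h x) \<in> reduced"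
      using * a assms(1) function_ring_mult[OF function_ring_reduced] by (auto simp: is_ideal_def)
    ultimately show "(\<lambda>x. a x * p x) \<in> J'"
      unfolding J'_def mem_Collect_eq by (intro exI[of _ "\<lambda>x. a x * w x"] exI[of _ "\<lambda>x. a x * h x"]) simp
  next
    show "(\<lambda>_. 0) \<in> J'"
      using assms(1) function_ring_const[OF function_ring_reduced, of 0] unfolding J'_def mem_Collect_eq
      by (intro exI[of _ "\<lambda>_. 0"]) (simp add: is_ideal_def)
  qed
  moreover have "J \<subseteq> J'"
  proof
    fix w assume "w \<in> J"
    then show "w \<in> J'"
      using function_ring_const[OF function_ring_reduced, of 0] unfolding J'_def mem_Collect_eq
      by (intro exI[of _ w] exI[of _ "\<lambda>_. 0"]) simp
  qed
  moreover have "(\<lambda>x. u x - z) \<in> J'"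
    using assms(1) function_ring_const[OF function_ring_reduced, of 1] unfolding J'_def mem_Collect_eq
    by (intro exI[of _ "\<lambda>_. 0"] exI[of _ "\<lambda>_. 1"]) (simp add: is_ideal_def)
  ultimately show ?case
  proof (cases "(\<lambda>_. 1) \<in> J'")
    case True
    then obtain w h where wh: "w \<in> J" "h \<in> reduced" "\<And>x. 1 = w x + h x * (u x - z)"
      unfolding J'_def mem_Collect_eq by metis
    have q'_red: "(\<lambda>x. poly q' (u x)) \<in> reduced"
    proof -
      have "(\<lambda>x. u x ^ i) \<in> reduced" for i
        using function_ring_prod[OF function_ring_reduced, of "{..<i}" "\<lambda>_. u"] assms(3) by simp
      then show ?thesis
        unfolding poly_altdef by (intro function_ring_sum function_ring_cmult function_ring_reduced)
    qed
    have "(\<lambda>x. poly q' (u x) * w x + h x * poly q (u x)) \<in> J"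
      by (intro is_ideal_add is_ideal_mult assms(1) q'_red wh(1,2) Suc.prems(2))
    moreover have "poly q' (u x) * w x + h x * poly q (u x) = poly q' (u x)" for x
    proof -
      have "poly q' (u x) * w x + h x * poly q (u x) = poly q' (u x) * (w x + h x * (u x - z))"
        by (simp add: q' algebra_simps)
      then show ?thesis using wh(3)[of x] by simp
    qed
    ultimately have "(\<lambda>x. poly q' (u x)) \<in> J" by simp
    moreover have q'0: "q' \<noteq> 0" using Suc.prems(1) q' by auto
    moreover have "n = degree q'"
      using Suc.hyps(2) degree_mult_eq[of "[:- z, 1:]" q'] q'0 unfolding q' by simp
    ultimately show ?thesis using Suc.hyps(1) by blast
  qed blast
qed

text \<open>
  The fibre of the quotient map over \<open>c\<close> is not empty: averaging shows that the ideal of the fibre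
  is proper, and since each coordinate is integral over the invariants, a common zero is found by
  adjoining one root at a time.
\<close>

lemma quotient_map_surjective:
  fixes k :: nat
  assumes f: "\<And>i. i < k \<Longrightarrow> f i \<in> invariant_ring G"
    and generate: "\<And>p. p \<in> invariant_ring G \<Longrightarrow> \<exists>P\<in>polynomials_in k. \<forall>x. p x = P (\<lambda>i. f i x)"
    and independent: "\<And>p. p \<in> polynomials_in k \<Longrightarrow> (\<And>x. p (\<lambda>i. f i x) = 0) \<Longrightarrow> p = (\<lambda>_. 0)"
  shows "\<exists>x. \<forall>i<k. f i x = c i"
proof -
  define J0 where "J0 = ideal_span reduced {..<k} (\<lambda>i x. f i x - c i)"
  have J0: "is_ideal J0"
    unfolding is_ideal_def J0_def
    by (intro conjI ballI ideal_span_add ideal_span_mult ideal_span_zero function_ring_reduced)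
  have fc_inv: "(\<lambda>x. f i x - c i) \<in> invariant_ring G" if "i < k" for i
    by (intro function_ring_diff function_ring_const function_ring_invariant f that)
  have proper: "(\<lambda>_. 1) \<notin> J0"
  proof
    assume "(\<lambda>_. 1) \<in> J0"
    then obtain h where h: "\<And>i. i < k \<Longrightarrow> h i \<in> reduced" "\<And>x. 1 = (\<Sum>i<k. h i x * (f i x - c i))"
      by (auto simp: J0_def ideal_span_def)
    have "\<exists>P\<in>polynomials_in k. \<forall>x. reynolds (h i) x = P (\<lambda>i. f i x)" if "i < k" for i
      using generate reynolds_invariant h(1)[OF that] by blast
    then obtain P where P: "\<And>i. i < k \<Longrightarrow> P i \<in> polynomials_in k"
      "\<And>i x. i < k \<Longrightarrow> reynolds (h i) x = P i (\<lambda>i. f i x)" by metis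
    let ?Q = "\<lambda>y. (\<Sum>i<k. P i y * (y i - c i)) - 1"
    have "?Q = (\<lambda>_. 0)"
    proof (rule independent)
      show "?Q \<in> polynomials_in k"
        by (intro function_ring_diff function_ring_sum function_ring_mult function_ring_const
            function_ring_polynomials_in P(1) polynomials_in_variable) auto
      fix x
      have "1 = reynolds (\<lambda>x. \<Sum>i<k. h i x * (f i x - c i)) x"
        using h(2) card_pos by (simp add: reynolds_def)
      also have "\<dots> = (\<Sum>i<k. reynolds (h i) x * (f i x - c i))"
        unfolding reynolds_sum using fc_inv by (intro sum.cong refl reynolds_mult) auto
      finally show "?Q (\<lambda>i. f i x) = 0" using P(2) by simp
    qed
    then have "?Q c = 0" by metis
    then show False by simp
  qed
  have univariate: "\<exists>q. q \<noteq> 0 \<and> (\<lambda>x. poly q (coordinate j x)) \<in> J0" for j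
  proof -
    have "\<exists>P\<in>polynomials_in k. \<forall>x. coeff (orbit_poly (coordinate j) x) i = P (\<lambda>i. f i x)" for i
      using generate[OF coeff_orbit_poly_invariant[OF coordinate_reduced]] by blast
    then obtain P where P: "\<And>i. P i \<in> polynomials_in k"
      "\<And>i x. coeff (orbit_poly (coordinate j) x) i = P i (\<lambda>i. f i x)" by metis
    define q where "q = monom 1 (card G) + (\<Sum>i<card G. monom (P i c) i)"
    have "coeff q (card G) = 1" by (simp add: q_def coeff_sum)
    then have "q \<noteq> 0" by auto
    moreover have "(\<lambda>x. \<Sum>i<card G. (- 1 * coordinate j x ^ i) * (P i (\<lambda>i. f i x) - P i c)) \<in> J0"
      unfolding J0_def
    proof (intro ideal_span_sum ideal_span_mult function_ring_reduced)
      fix i assume "i \<in> {..<card G}"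
      show "(\<lambda>x. - 1 * coordinate j x ^ i) \<in> reduced"
        using function_ring_prod[OF function_ring_reduced, of "{..<i}" "\<lambda>_. coordinate j"]
        by (intro function_ring_cmult function_ring_reduced) (simp add: coordinate_reduced)
      show "(\<lambda>x. P i (\<lambda>i. f i x) - P i c) \<in> ideal_span reduced {..<k} (\<lambda>i x. f i x - c i)"
        by (rule function_ring_eval_mod[OF P(1)[unfolded polynomials_in_eq] function_ring_reduced])
          (use ideal_span_base[OF function_ring_reduced, of "{..<k}" _ "\<lambda>i x. f i x - c i"]
            invariant_reduced f in \<open>auto intro: ideal_span_add ideal_span_mult ideal_span_zero function_ring_reduced\<close>)
    qed
    moreover have "(\<Sum>i<card G. (- 1 * coordinate j x ^ i) * (P i (\<lambda>i. f i x) - P i c)) = poly q (coordinate j x)" for x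
    proof -
      have "coordinate j x ^ card G = (\<Sum>i<card G. - P i (\<lambda>i. f i x) * coordinate j x ^ i)"
        by (simp add: power_card_eq P(2))
      then show ?thesis
        by (simp add: q_def poly_sum poly_monom sum_subtractf sum_negf algebra_simps)
    qed
    ultimately show ?thesis by auto
  qed
  have "\<exists>J. is_ideal J \<and> J0 \<subseteq> J \<and> (\<lambda>_. 1) \<notin> J \<and> (\<forall>j\<in>V. \<exists>z. (\<lambda>x. coordinate j x - z) \<in> J)" for V :: "'n set"
    using finite[of V]
  proof induction
    case empty
    then show ?case using J0 proper by blast
  next
    case (insert j V)
    then obtain J where J: "is_ideal J" "J0 \<subseteq> J" "(\<lambda>_. 1) \<notin> J" "\<forall>j\<in>V. \<exists>z. (\<lambda>x. coordinate j x - z) \<in> J"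
      by blast
    obtain q where "q \<noteq> 0" "(\<lambda>x. poly q (coordinate j x)) \<in> J" using univariate J(2) by blast
    from adjoin_root[OF J(1,3) coordinate_reduced this]
    obtain z J' where "is_ideal J'" "J \<subseteq> J'" "(\<lambda>_. 1) \<notin> J'" "(\<lambda>x. coordinate j x - z) \<in> J'" by blast
    then show ?case using J by (intro exI[of _ J']) blast
  qed
  from this[of UNIV] obtain J where J': "is_ideal J" "J0 \<subseteq> J" "(\<lambda>_. 1) \<notin> J"
    "\<forall>j. \<exists>z. (\<lambda>x. coordinate j x - z) \<in> J"
    by auto
  obtain z where z: "\<And>j. (\<lambda>x. coordinate j x - z j) \<in> J" using choice[OF J'(4)] by blast
  note J = J'(1-3) z
  define b :: "complex ^ 'n" where "b = (\<chi> j. z j)"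
  have "f i b = c i" if i: "i < k" for i
  proof (rule ccontr)
    assume ne: "f i b \<noteq> c i"
    have "(\<lambda>x. f i (proj x) - f i b) \<in> J"
      by (rule function_ring_eval_mod[where S = "range (\<lambda>i x. x $ i)" and A = reduced])
        (use J(1,4) reduced_polynomial[OF invariant_reduced[OF f[OF i]]] function_ring_reduced coordinate_reduced
          in \<open>auto simp: is_ideal_def polynomial_functions_def b_def coordinate_def[abs_def]\<close>)
    then have "(\<lambda>x. f i x - f i b) \<in> J" using reduced_proj[OF invariant_reduced[OF f[OF i]]] by simp
    moreover have "(\<lambda>x. f i x - c i) \<in> J"
      using J(2) ideal_span_base[OF function_ring_reduced, of "{..<k}" i "\<lambda>i x. f i x - c i"] i
      by (auto simp: J0_def)
    ultimately have "(\<lambda>x. (f i x - c i) + (- 1) * (f i x - f i b)) \<in> J"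
      by (intro is_ideal_add is_ideal_cmult J(1))
    then have "(\<lambda>_. f i b - c i) \<in> J" by (simp add: algebra_simps)
    from is_ideal_cmult[OF J(1) this, of "1 / (f i b - c i)"] show False using ne J(3) by simp
  qed
  then show ?thesis by blast
qed

end

section \<open>Real dimension, general position and images of small dimension\<close>

lemma scaleR_eq_smult: "c *\<^sub>R (x :: complex ^ 'n) = complex_of_real c *s x"
  by (simp add: vec_eq_iff) (simp add: scaleR_conv_of_real)

lemma norm_smult: "norm (c *s (x :: complex ^ 'n)) = cmod c * norm x"
  by (simp add: norm_vec_def norm_mult L2_set_right_distrib)

lemma complex_subspace_imp_subspace:
  "vec.subspace E \<Longrightarrow> subspace (E :: (complex ^ 'n) set)"
  unfolding subspace_def scaleR_eq_smult
  by (auto intro: vec.subspace_0 vec.subspace_add vec.subspace_scale)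

lemma dim_complex_line:
  assumes "b \<noteq> (0 :: complex ^ 'n)"
  shows "dim (range (\<lambda>c. c *s b)) = 2"
proof -
  have lin: "linear (\<lambda>c. c *s b)"
    by (rule linearI) (simp_all add: vec_eq_iff algebra_simps)
  have "inj (\<lambda>c. c *s b)"
    using assms by (auto simp: inj_on_def)
  then have "dim (range (\<lambda>c. c *s b)) = dim (UNIV :: complex set)"
    using dim_image_eq[OF lin, of UNIV] by simp
  then show ?thesis by simp
qed

lemma dim_complex_span:
  assumes "finite B" "vec.independent B"
  shows "dim (vec.span (B :: (complex ^ 'n) set)) = 2 * card B"
  using assms
proof (induction B rule: finite_induct)
  case empty
  show ?case by simp
next
  case (insert b B)
  then have indep: "vec.independent B" "b \<notin> vec.span B"
    by (auto simp: vec.independent_insert)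
  let ?S = "vec.span B" and ?T = "range (\<lambda>c. c *s b)"
  have b: "b \<noteq> 0" using indep(2) vec.span_zero by auto
  have S: "subspace ?S" by (intro complex_subspace_imp_subspace vec.subspace_span)
  have T: "subspace ?T"
    using complex_subspace_imp_subspace[OF vec.subspace_span, of "{b}"] by (simp add: vec.span_singleton)
  have "?S \<inter> ?T = {0}"
  proof (intro equalityI subsetI)
    fix x assume x: "x \<in> ?S \<inter> ?T"
    then obtain c where c: "x = c *s b" by auto
    have "c = 0"
    proof (rule ccontr)
      assume "c \<noteq> 0"
      then have "b = inverse c *s x" using c by simp
      then show False using x indep(2) vec.span_scale by blast
    qed
    then show "x \<in> {0}" using c by simp
  qed (use vec.span_zero in \<open>auto intro: image_eqI[of _ _ 0]\<close>)
  moreover have "{x + y |x y. x \<in> ?S \<and> y \<in> ?T} = vec.span (insert b B)"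
  proof -
    have "x \<in> vec.span (insert b B) \<longleftrightarrow> (\<exists>k. x - k *s b \<in> ?S)" for x
      by (simp add: vec.span_insert)
    moreover have "(\<exists>k. x - k *s b \<in> ?S) \<longleftrightarrow> (\<exists>u v. x = u + v \<and> u \<in> ?S \<and> v \<in> ?T)" for x
      by (metis (no_types, lifting) add_diff_cancel diff_add_cancel imageE rangeI)
    ultimately show ?thesis by auto
  qed
  ultimately have "dim (vec.span (insert b B)) = dim ?S + dim ?T"
    using dim_sums_Int[OF S T] by simp
  then show ?case using insert indep(1) dim_complex_line[OF b] by simp
qed

lemma dim_complex_subspace:
  assumes "vec.subspace (E :: (complex ^ 'n) set)"
  shows "dim E = 2 * vec.dim E"
proof -
  obtain B where B: "B \<subseteq> E" "vec.independent B" "E \<subseteq> vec.span B" "card B = vec.dim E"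
    using vec.basis_exists[of E] by blast
  have "vec.span B \<subseteq> E" using vec.span_minimal[OF B(1) assms] .
  then have "E = vec.span B" using B(3) by blast
  then show ?thesis
    using dim_complex_span[OF vec.finiteI_independent[OF B(2)] B(2)] B(4) by simp
qed

text \<open>
  If \<open>x\<close> avoids all subspaces but \<open>T0\<close>, and \<open>y\<close> is not in \<open>T0\<close>, then the line \<open>x + t y\<close> meets each of
  the subspaces at most once.
\<close>

lemma ex_avoiding_subspaces:
  fixes S :: "'a::real_vector set"
  assumes "finite \<T>" "\<And>T. T \<in> \<T> \<Longrightarrow> subspace T" "\<And>T. T \<in> \<T> \<Longrightarrow> \<not> S \<subseteq> T" "subspace S"
  shows "\<exists>x\<in>S. \<forall>T\<in>\<T>. x \<notin> T"
  using assms(1-3)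
proof (induction \<T> rule: finite_induct)
  case empty
  show ?case using subspace_0[OF assms(4)] by blast
next
  case (insert T0 \<T>)
  then obtain x where x: "x \<in> S" "\<forall>T\<in>\<T>. x \<notin> T" by auto
  obtain y where y: "y \<in> S" "y \<notin> T0" using insert.prems(2)[of T0] by blast
  show ?case
  proof (cases "x \<in> T0")
    case False
    then show ?thesis using x by blast
  next
    case True
    have "finite {t. x + t *\<^sub>R y \<in> T}" if T: "T \<in> \<T>" for T
    proof -
      have sub: "subspace T" using insert.prems(1) T by blast
      have "t = t'" if *: "x + t *\<^sub>R y \<in> T" "x + t' *\<^sub>R y \<in> T" for t t'
      proof (rule ccontr)
        assume "t \<noteq> t'"
        have "(x + t *\<^sub>R y) - (x + t' *\<^sub>R y) \<in> T" using subspace_diff[OF sub *] .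
        then have "(t - t') *\<^sub>R y \<in> T" by (simp add: algebra_simps)
        from subspace_scale[OF sub this, of "inverse (t - t')"] have "y \<in> T" using \<open>t \<noteq> t'\<close> by simp
        then have "(x + t *\<^sub>R y) - t *\<^sub>R y \<in> T"
          using * sub subspace_diff subspace_scale by blast
        then show False using x(2) T by simp
      qed
      then have "{t. x + t *\<^sub>R y \<in> T} \<subseteq> {SOME t. x + t *\<^sub>R y \<in> T}"
        using someI[of "\<lambda>t. x + t *\<^sub>R y \<in> T"] by auto
      then show ?thesis using finite_subset by blast
    qed
    then have "finite ({0} \<union> (\<Union>T\<in>\<T>. {t. x + t *\<^sub>R y \<in> T}))" using insert.hyps(1) by blast
    then obtain t :: real where t: "t \<notin> {0} \<union> (\<Union>T\<in>\<T>. {t. x + t *\<^sub>R y \<in> T})"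
      using ex_new_if_finite[OF infinite_UNIV_char_0] by blast
    have sub: "subspace T0" using insert.prems(1) by blast
    have "x + t *\<^sub>R y \<notin> T0"
    proof
      assume "x + t *\<^sub>R y \<in> T0"
      from subspace_diff[OF sub this True] have "t *\<^sub>R y \<in> T0" by simp
      from subspace_scale[OF sub this, of "inverse t"] show False using y(2) t by simp
    qed
    moreover have "x + t *\<^sub>R y \<in> S" using x(1) y(1) assms(4) subspace_add subspace_scale by blast
    ultimately show ?thesis using t by blast
  qed
qed

lemma ex_generic_vector_of_maps:
  fixes E :: "'a::real_vector set"
  assumes "finite \<F>" "\<And>f. f \<in> \<F> \<Longrightarrow> linear f" "subspace E"
  shows "\<exists>e\<in>E. \<forall>f\<in>\<F>. f e = e \<longrightarrow> (\<forall>x\<in>E. f x = x)"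
proof -
  have sub: "subspace {x. f x = x}" if "f \<in> \<F>" for f
    using assms(2)[OF that] by (auto simp: subspace_def linear_0 linear_add linear_scale)
  have "\<exists>e\<in>E. \<forall>T\<in>(\<lambda>f. {x. f x = x}) ` {f \<in> \<F>. \<not> E \<subseteq> {x. f x = x}}. e \<notin> T"
    by (rule ex_avoiding_subspaces) (use assms(1,3) sub in auto)
  then obtain e where e: "e \<in> E" "\<And>f. f \<in> \<F> \<Longrightarrow> \<not> E \<subseteq> {x. f x = x} \<Longrightarrow> f e \<noteq> e" by auto
  show ?thesis
  proof (intro bexI[OF _ e(1)] ballI impI)
    fix f x assume "f \<in> \<F>" "f e = e" "x \<in> E"
    then have "E \<subseteq> {x. f x = x}" using e(2) by metis
    then show "f x = x" using \<open>x \<in> E\<close> by auto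
  qed
qed

lemma ex_form_nonzero:
  assumes "finite Y" "0 \<notin> Y"
  shows "\<exists>a :: complex ^ 'n. \<forall>y\<in>Y. (\<Sum>i\<in>UNIV. a $ i * y $ i) \<noteq> 0"
proof -
  let ?T = "\<lambda>y :: complex ^ 'n. {a :: complex ^ 'n. (\<Sum>i\<in>UNIV. a $ i * y $ i) = 0}"
  have "\<exists>a\<in>UNIV. \<forall>T\<in>?T ` Y. a \<notin> T"
  proof (rule ex_avoiding_subspaces)
    fix T assume "T \<in> ?T ` Y"
    then obtain y where y: "y \<in> Y" "T = ?T y" by blast
    show "subspace T"
      unfolding y subspace_def
      by (auto simp: distrib_right sum.distrib simp flip: scaleR_sum_right)
    obtain j where "y $ j \<noteq> 0" using y(1) assms(2) by (metis vec_eq_iff zero_index)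
    then have "axis j 1 \<notin> T"
      by (simp add: y axis_def if_distrib[of "\<lambda>x. x * _"] cong: if_cong)
    then show "\<not> UNIV \<subseteq> T" by blast
  qed (use assms(1) in auto)
  then show ?thesis by auto
qed

lemma polynomial_differentiable:
  fixes p :: "complex ^ 'n \<Rightarrow> complex"
  assumes "p \<in> polynomial_functions" shows "p differentiable (at x)"
  using assms unfolding polynomial_functions_def
proof induction
  case (generator f)
  then obtain i where "f = (\<lambda>x. x $ i)" by blast
  then show ?case using bounded_linear_imp_differentiable[OF bounded_linear_vec_nth] by simp
qed (auto intro: differentiable_add differentiable_mult)

lemma polynomial_continuous:
  fixes p :: "complex ^ 'n \<Rightarrow> complex"
  assumes "p \<in> polynomial_functions" shows "continuous_on A p"
  using polynomial_differentiable[OF assms] differentiable_imp_continuous_within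
  by (meson continuous_at_imp_continuous_on)

text \<open>
  Differentiable maps do not raise dimension, relative to a subspace of the target: adding the
  missing directions of the target to the source reduces this to the fact that images of null sets
  are null.
\<close>

lemma not_covered_by_small_images:
  fixes F :: "'a::euclidean_space \<Rightarrow> 'b::euclidean_space"
  assumes "finite \<T>" "\<And>T. T \<in> \<T> \<Longrightarrow> subspace T" "\<And>T. T \<in> \<T> \<Longrightarrow> dim T < dim L"
    and "subspace L" and F: "\<And>x. F differentiable (at x)"
  shows "\<not> L \<subseteq> (\<Union>T\<in>\<T>. F ` T)"
proof
  assume cover: "L \<subseteq> (\<Union>T\<in>\<T>. F ` T)"
  obtain B where B: "B \<subseteq> L" "pairwise orthogonal B" "\<And>x. x \<in> B \<Longrightarrow> norm x = 1"
    "independent B" "card B = dim L" "span B = L"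
    using orthonormal_basis_subspace[OF assms(4)] by blast
  have finB: "finite B" using B(4) independent_imp_finite by blast
  \<comment> \<open>The orthogonal projection onto \<open>L\<close>.\<close>
  define P where "P x = (\<Sum>b\<in>B. (x \<bullet> b) *\<^sub>R b)" for x
  have P: "linear P"
    by (rule linearI) (simp_all add: P_def inner_add_left scaleR_add_left sum.distrib scaleR_sum_right)
  have PL: "P x \<in> L" for x
    unfolding P_def using B(1) assms(4) by (intro subspace_sum subspace_scale) auto
  have P_id: "P x = x" if "x \<in> L" for x
    unfolding P_def using orthonormal_basis_expand[OF B(2,3) _ finB] B(6) that by blast
  have negl: "\<exists>N. negligible N \<and> (\<forall>y. P y \<in> F ` T \<longrightarrow> y \<in> N)" if T: "T \<in> \<T>" for T
  proof -
    obtain T' where T': "subspace T'" "T' \<subseteq> span L" "dim T' = dim T"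
      using choose_subspace_of_subspace[of "dim T" L] assms(3)[OF T] by auto
    have "span L = L" using assms(4) by (simp add: span_eq_iff)
    then have T'L: "T' \<subseteq> L" using T'(2) by (simp only:)
    obtain A where A: "linear A" "A ` T' = T"
      by (rule isometries_subspaces[OF T'(1) assms(2)[OF T] T'(3)])
    \<comment> \<open>\<open>F\<close> on \<open>T\<close>, which \<open>A\<close> identifies with the subspace \<open>T'\<close> of \<open>L\<close>, and the identity across \<open>L\<close>.\<close>
    define \<phi> where "\<phi> x = F (A (P x)) + (x - P x)" for x
    have "bounded_linear P" "bounded_linear A" using P A(1) linear_conv_bounded_linear by auto
    then have dP: "P differentiable (at x)" and dA: "A differentiable (at y)" for x y
      using bounded_linear_imp_differentiable by blast+
    have diff: "\<phi> differentiable (at x)" for x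
      unfolding \<phi>_def[abs_def]
      by (intro differentiable_add differentiable_diff differentiable_ident dP
          differentiable_compose[OF F differentiable_compose[OF dA dP]])
    define N where "N = {x. P x \<in> T'}"
    have subN: "subspace N"
      unfolding N_def using linear_subspace_vimage[OF P T'(1)] by (simp add: vimage_def)
    have "T' \<noteq> L" using T'(3) assms(3)[OF T] by auto
    then obtain l where "l \<in> L" "l \<notin> T'" using T'L by blast
    then have "l \<notin> N" using P_id by (simp add: N_def)
    then have "dim N < DIM('b)"
      using dim_eq_full[of N] subN dim_subset_UNIV[of N] by (metis UNIV_I le_neq_implies_less span_eq_iff)
    then have "negligible N" by (rule negligible_lowdim)
    then have "negligible (\<phi> ` N)"
      by (intro negligible_differentiable_image_negligible order_refl)
        (auto simp: differentiable_on_def intro: differentiable_at_withinI diff)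
    moreover have "y \<in> \<phi> ` N" if y: "P y \<in> F ` T" for y
    proof -
      obtain t where t: "t \<in> T'" "P y = F (A t)" using y A(2) by auto
      have "P (t + (y - P y)) = t"
        using P_id[OF PL[of y]] P_id[of t] t(1) T'L
        by (simp add: linear_add[OF P] linear_diff[OF P] subset_iff)
      then have "t + (y - P y) \<in> N" "y = \<phi> (t + (y - P y))"
        using t by (simp_all add: N_def \<phi>_def)
      then show ?thesis by blast
    qed
    ultimately show ?thesis by blast
  qed
  then have "\<forall>T. \<exists>N. T \<in> \<T> \<longrightarrow> negligible N \<and> (\<forall>y. P y \<in> F ` T \<longrightarrow> y \<in> N)" by blast
  from choice[OF this] obtain N where N: "\<And>T. T \<in> \<T> \<Longrightarrow> negligible (N T)"
    "\<And>T y. T \<in> \<T> \<Longrightarrow> P y \<in> F ` T \<Longrightarrow> y \<in> N T" by blast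
  have "negligible (\<Union>(N ` \<T>))" using assms(1) N(1) by (intro negligible_Union) auto
  moreover have "y \<in> \<Union>(N ` \<T>)" for y
  proof -
    have "P y \<in> (\<Union>T\<in>\<T>. F ` T)" using cover PL by blast
    then show ?thesis using N(2) by blast
  qed
  then have "\<Union>(N ` \<T>) = UNIV" by blast
  ultimately show False by simp
qed

section \<open>The quotient map in coordinates\<close>

definition coordinate_space :: "'k set \<Rightarrow> (complex ^ 'k) set" where
  "coordinate_space J = {y. \<forall>j. j \<notin> J \<longrightarrow> y $ j = 0}"

lemma subspace_coordinate_space: "subspace (coordinate_space J)"
  by (auto simp: coordinate_space_def subspace_def)

lemma dim_coordinate_space: "dim (coordinate_space (J :: 'k::finite set)) = 2 * card J"
proof -
  have "vec.subspace (coordinate_space J)"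
    by (auto simp: coordinate_space_def vec.subspace_def)
  then show ?thesis
    using dim_complex_subspace[of "coordinate_space J"] dim_substandard_cart[of J, where 'a = complex]
    unfolding coordinate_space_def by simp
qed

text \<open>
  The functions \<open>f i\<close> with \<open>i < k\<close>, placed at the coordinates \<open>\<iota> i\<close> of a space whose dimension is a
  type, and zero elsewhere.
\<close>

definition coordinate_map ::
    "nat \<Rightarrow> (nat \<Rightarrow> 'k) \<Rightarrow> (nat \<Rightarrow> complex ^ 'n \<Rightarrow> complex) \<Rightarrow> complex ^ 'n \<Rightarrow> complex ^ 'k" where
  "coordinate_map k \<iota> f x = (\<chi> j. if j \<in> \<iota> ` {..<k} then f (the_inv_into {..<k} \<iota> j) x else 0)"

lemma coordinate_map_nth:
  "inj_on \<iota> {..<k} \<Longrightarrow> i < k \<Longrightarrow> coordinate_map k \<iota> f x $ \<iota> i = f i x"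
  by (simp add: coordinate_map_def the_inv_into_f_f)

lemma coordinate_map_nth_outside: "j \<notin> \<iota> ` {..<k} \<Longrightarrow> coordinate_map k \<iota> f x $ j = 0"
  by (simp add: coordinate_map_def)

lemma coordinate_map_eqI:
  assumes "inj_on \<iota> {..<k}" "\<And>i. i < k \<Longrightarrow> y $ \<iota> i = f i x" "\<And>j. j \<notin> \<iota> ` {..<k} \<Longrightarrow> y $ j = 0"
  shows "y = coordinate_map k \<iota> f x"
  unfolding vec_eq_iff
proof
  fix j show "y $ j = coordinate_map k \<iota> f x $ j"
    using assms(2,3)
    by (cases "j \<in> \<iota> ` {..<k}") (auto simp: coordinate_map_nth[OF assms(1)] coordinate_map_nth_outside)
qed

lemma coordinate_map_component_polynomial:
  assumes "inj_on \<iota> {..<k}" "\<And>i. i < k \<Longrightarrow> f i \<in> polynomial_functions"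
  shows "(\<lambda>x. coordinate_map k \<iota> f x $ j) \<in> polynomial_functions"
proof (cases "j \<in> \<iota> ` {..<k}")
  case True
  then obtain i where "i < k" "j = \<iota> i" by auto
  then show ?thesis using assms(2) by (simp add: coordinate_map_nth[OF assms(1)])
next
  case False
  then show ?thesis by (simp add: coordinate_map_nth_outside polynomial_intros(1))
qed

lemma coordinate_map_differentiable:
  fixes \<iota> :: "nat \<Rightarrow> 'k::finite"
  assumes "inj_on \<iota> {..<k}" "\<And>i. i < k \<Longrightarrow> f i \<in> polynomial_functions"
  shows "coordinate_map k \<iota> f differentiable (at x)"
proof -
  have "(\<lambda>x. \<Sum>j\<in>UNIV. axis j (coordinate_map k \<iota> f x $ j)) differentiable (at x)"
  proof (intro differentiable_sum ballI)
    fix j :: 'k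
    have "bounded_linear (\<lambda>c :: complex. axis j c)"
      by (rule linear_conv_bounded_linear[THEN iffD1]) (rule linearI, auto simp: vec_eq_iff axis_def)
    moreover have "(\<lambda>x. coordinate_map k \<iota> f x $ j) differentiable (at x)"
      by (rule polynomial_differentiable[OF coordinate_map_component_polynomial[OF assms]])
    ultimately show "(\<lambda>x. axis j (coordinate_map k \<iota> f x $ j)) differentiable (at x)"
      by (rule differentiable_compose[OF bounded_linear_imp_differentiable])
  qed simp
  moreover have "(\<Sum>j\<in>UNIV. axis j (y $ j)) = y" for y :: "complex ^ 'k"
    by (simp add: vec_eq_iff axis_def sum_component)
  ultimately show ?thesis by simp
qed

lemma coordinate_map_continuous:
  assumes "inj_on \<iota> {..<k}" "\<And>i. i < k \<Longrightarrow> f i \<in> polynomial_functions"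
  shows "continuous_on A (coordinate_map k \<iota> f)"
  using coordinate_map_differentiable[OF assms] differentiable_imp_continuous_within
  by (meson continuous_at_imp_continuous_on)

context matrix_group
begin

lemma continuous_act: "continuous_on A (act g)"
proof -
  have "continuous_on A (\<lambda>x. \<chi> i. act g x $ i)"
    by (intro continuous_on_vec_lambda polynomial_continuous polynomial_act_coordinate)
  then show ?thesis by simp
qed

lemma linear_act: "linear (act g)"
  by (rule linearI) (simp_all add: act_add scaleR_eq_smult act_scale)

lemma ex_generic_vector:
  assumes "subspace E"
  shows "\<exists>e\<in>E. \<forall>g\<in>G. act g e = e \<longrightarrow> (\<forall>x\<in>E. act g x = x)"
  using ex_generic_vector_of_maps[of "act ` G" E] finite_group linear_act assms by auto

text \<open>
  A generic vector \<open>e\<close> of \<open>E\<close> is moved by each element that does not fix \<open>E\<close> pointwise.  By continuity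
  such an element moves a small ball around \<open>e\<close> off itself.
\<close>

lemma ex_slice:
  assumes "subspace E"
  shows "\<exists>U. openin (top_of_set E) U \<and> U \<noteq> {} \<and> (\<forall>x\<in>U. \<forall>g\<in>G. act g x \<in> U \<longrightarrow> act g x = x)"
proof -
  obtain e where e: "e \<in> E" "\<And>g x. g \<in> G \<Longrightarrow> act g e = e \<Longrightarrow> x \<in> E \<Longrightarrow> act g x = x"
    using ex_generic_vector[OF assms] by blast
  define H where "H = {g \<in> G. act g e \<noteq> e}"
  have "\<exists>r>0. \<forall>x\<in>ball e r. act g x \<notin> ball e r" if g: "g \<in> H" for g
  proof -
    define \<delta> where "\<delta> = dist (act g e) e"
    have "\<delta> > 0" using g by (simp add: \<delta>_def H_def)
    have "continuous (at e) (act g)"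
      using continuous_act[of UNIV g] by (simp add: continuous_on_eq_continuous_at)
    then obtain r where r: "r > 0" "\<And>x. dist x e < r \<Longrightarrow> dist (act g x) (act g e) < \<delta> / 2"
      using \<open>\<delta> > 0\<close> unfolding continuous_at_eps_delta by (auto dest!: spec[of _ "\<delta> / 2"])
    have "act g x \<notin> ball e (min r (\<delta> / 2))" if "x \<in> ball e (min r (\<delta> / 2))" for x
    proof
      assume "act g x \<in> ball e (min r (\<delta> / 2))"
      then have "dist (act g x) e < \<delta> / 2" by (simp add: dist_commute)
      moreover have "dist (act g x) (act g e) < \<delta> / 2" using that r(2)[of x] by (simp add: dist_commute)
      ultimately have "dist (act g e) e < \<delta>"
        using dist_triangle_half_r[of "act g x" "act g e" \<delta> e] by blast
      then show False by (simp add: \<delta>_def)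
    qed
    then show ?thesis using r(1) \<open>\<delta> > 0\<close> by (intro exI[of _ "min r (\<delta> / 2)"]) auto
  qed
  then have "\<forall>g. \<exists>r. g \<in> H \<longrightarrow> r > 0 \<and> (\<forall>x\<in>ball e r. act g x \<notin> ball e r)" by blast
  from choice[OF this] obtain r where r: "\<And>g. g \<in> H \<Longrightarrow> r g > 0"
    "\<And>g x. g \<in> H \<Longrightarrow> x \<in> ball e (r g) \<Longrightarrow> act g x \<notin> ball e (r g)" by blast
  define R where "R = Min (insert 1 (r ` H))"
  have finH: "finite H" using finite_group by (simp add: H_def)
  have R: "R > 0" "\<And>g. g \<in> H \<Longrightarrow> R \<le> r g"
    using finH r(1) by (auto simp: R_def)
  show ?thesis
  proof (intro exI[of _ "E \<inter> ball e R"] conjI ballI impI)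
    show "openin (top_of_set E) (E \<inter> ball e R)" by (simp add: openin_open_Int)
    show "E \<inter> ball e R \<noteq> {}" using e(1) R(1) by auto
    fix x g assume x: "x \<in> E \<inter> ball e R" and g: "g \<in> G" and gx: "act g x \<in> E \<inter> ball e R"
    have "g \<notin> H"
    proof
      assume "g \<in> H"
      then have "ball e R \<subseteq> ball e (r g)" using R(2) by (simp add: subset_ball)
      then show False using r(2)[OF \<open>g \<in> H\<close>, of x] x gx by blast
    qed
    then show "act g x = x" using g e(2) x by (auto simp: H_def)
  qed
qed

lemma eq_of_generators:
  assumes "\<exists>P\<in>polynomials_in k. \<forall>x. p x = P (\<lambda>i. f i x)" "\<And>i. i < k \<Longrightarrow> f i x = f i y"
  shows "p x = p y"
proof -
  obtain P where P: "P \<in> polynomials_in k" "\<And>x. p x = P (\<lambda>i. f i x)" using assms(1) by blast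
  show ?thesis unfolding P(2) by (rule polynomials_in_cong[OF P(1)]) (rule assms(2))
qed

lemma orbit_product_invariant:
  assumes "f \<in> reduced"
  shows "(\<lambda>x. \<Prod>g\<in>G. f (act g x)) \<in> invariant_ring G"
  unfolding invariant_ring_iff
proof (intro conjI ballI allI)
  show "(\<lambda>x. \<Prod>g\<in>G. f (act g x)) \<in> reduced"
    using compose_act_reduced[OF assms] by (intro function_ring_prod function_ring_reduced) blast
  show "(\<Prod>g\<in>G. f (act g (act h x))) = (\<Prod>g\<in>G. f (act g x))" if "h \<in> G" for h x
    using prod.reindex_bij_betw[OF bij_mult_right[OF that], of "\<lambda>g. f (act g x)"]
    by (simp add: act_mult)
qed

text \<open>
  A linear form takes different values at \<open>y\<close> and on the orbit of \<open>x\<close> if it avoids finitely many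
  hyperplanes; a product over the group makes this difference invariant.
\<close>

lemma invariants_separate_orbits:
  assumes "proj x = x" "proj y = y" "\<And>p. p \<in> invariant_ring G \<Longrightarrow> p x = p y"
  shows "\<exists>g\<in>G. y = act g x"
proof (rule ccontr)
  assume *: "\<not> ?thesis"
  have "finite ((\<lambda>g. act g x - y) ` G)" "0 \<notin> (\<lambda>g. act g x - y) ` G"
    using finite_group * by auto
  from ex_form_nonzero[OF this] obtain a :: "complex ^ 'n" where
    a: "\<And>g. g \<in> G \<Longrightarrow> (\<Sum>i\<in>UNIV. a $ i * (act g x - y) $ i) \<noteq> 0" by blast
  define l where "l z = (\<Sum>i\<in>UNIV. a $ i * proj z $ i) - (\<Sum>i\<in>UNIV. a $ i * y $ i)" for z
  have "l \<in> reduced"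
    unfolding l_def[abs_def] coordinate_def[symmetric]
    by (intro function_ring_diff function_ring_sum function_ring_cmult function_ring_const
        function_ring_reduced coordinate_reduced)
  then have "(\<Prod>g\<in>G. l (act g x)) = (\<Prod>g\<in>G. l (act g y))"
    using assms(3)[OF orbit_product_invariant] by blast
  moreover have "(\<Prod>g\<in>G. l (act g y)) = 0"
    using finite_group one_in assms(2)
    by (intro prod_zero bexI[of _ "mat 1"]) (auto simp: act_one l_def)
  moreover have "l (act g x) \<noteq> 0" if "g \<in> G" for g
    using a[OF that] proj_act[OF that, of x] assms(1)
    by (simp add: l_def right_diff_distrib sum_subtractf)
  then have "(\<Prod>g\<in>G. l (act g x)) \<noteq> 0" using finite_group by (simp add: prod_zero_iff)
  ultimately show False by simp
qed

text \<open>
  Since invariants separate orbits, their generators define a locally injective map on each subspace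
  of the reflection representation.  By invariance of domain, the subspace is at most as large as the
  coordinate space that receives it, and fills an open part of it in the case of equality.
\<close>

lemma
  fixes \<iota> :: "nat \<Rightarrow> 'k::finite"
  assumes f: "\<And>i. i < k \<Longrightarrow> f i \<in> invariant_ring G"
    and generate: "\<And>p. p \<in> invariant_ring G \<Longrightarrow> \<exists>P\<in>polynomials_in k. \<forall>x. p x = P (\<lambda>i. f i x)"
    and inj: "inj_on \<iota> {..<k}"
    and E: "subspace E" "\<And>x. x \<in> E \<Longrightarrow> proj x = x"
    and J: "J \<subseteq> {..<k}" "\<And>x i. x \<in> E \<Longrightarrow> i < k \<Longrightarrow> i \<notin> J \<Longrightarrow> f i x = 0"
  shows dim_le_coordinates: "dim E \<le> 2 * card J"
    and coordinate_map_open_image: "dim E = 2 * card J \<Longrightarrow>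
      \<exists>U. U \<noteq> {} \<and> openin (top_of_set (coordinate_space (\<iota> ` J))) U \<and> U \<subseteq> coordinate_map k \<iota> f ` E"
proof -
  let ?F = "coordinate_map k \<iota> f" and ?L = "coordinate_space (\<iota> ` J)"
  obtain U where U: "openin (top_of_set E) U" "U \<noteq> {}"
    "\<And>x g. x \<in> U \<Longrightarrow> g \<in> G \<Longrightarrow> act g x \<in> U \<Longrightarrow> act g x = x"
    using ex_slice[OF E(1)] by blast
  have UE: "U \<subseteq> E" using U(1) openin_imp_subset by blast
  have cont: "continuous_on U ?F"
    by (rule coordinate_map_continuous[OF inj reduced_polynomial[OF invariant_reduced[OF f]]])
  have into: "?F \<in> U \<rightarrow> ?L"
  proof
    fix x assume x: "x \<in> U"
    have "?F x $ j = 0" if "j \<notin> \<iota> ` J" for j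
    proof (cases "j \<in> \<iota> ` {..<k}")
      case True
      then obtain i where i: "i < k" "j = \<iota> i" by auto
      then show ?thesis using that x UE J(2)[of x i] by (auto simp: coordinate_map_nth[OF inj])
    next
      case False
      then show ?thesis by (rule coordinate_map_nth_outside)
    qed
    then show "?F x \<in> ?L" by (simp add: coordinate_space_def)
  qed
  have "inj_on ?F U"
  proof (rule inj_onI)
    fix x y assume xy: "x \<in> U" "y \<in> U" "?F x = ?F y"
    have "f i x = f i y" if "i < k" for i
      using xy(3) coordinate_map_nth[OF inj that] by metis
    then have "p x = p y" if "p \<in> invariant_ring G" for p
      using eq_of_generators[OF generate[OF that]] by blast
    then obtain g where "g \<in> G" "y = act g x"
      using invariants_separate_orbits E(2) xy(1,2) UE by blast
    then show "x = y" using U(3) xy(1,2) by metis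
  qed
  note injective = this
  have card: "dim ?L = 2 * card J"
  proof -
    have "card (\<iota> ` J) = card J" using card_image inj_on_subset[OF inj J(1)] by blast
    then show ?thesis by (simp add: dim_coordinate_space)
  qed
  show "dim E \<le> 2 * card J"
    using invariance_of_dimension_subspaces[OF U(1) E(1) subspace_coordinate_space cont into injective U(2)]
    by (simp add: card)
  assume "dim E = 2 * card J"
  then have "openin (top_of_set ?L) (?F ` U)"
    using invariance_of_domain_subspaces[OF U(1) E(1) subspace_coordinate_space _ cont into injective]
    by (simp add: card)
  then show "\<exists>U. U \<noteq> {} \<and> openin (top_of_set ?L) U \<and> U \<subseteq> ?F ` E"
    using U(2) image_mono[OF UE, of ?F] by (intro exI[of _ "?F ` U"] conjI) simp_all
qed

section \<open>The number of basic invariants\<close>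

lemma vec_subspace_fixed_space: "vec.subspace (fixed_space G)"
  by (auto simp: vec.subspace_def fixed_space_def act_zero act_add act_scale)

lemma dim_reflection_representation: "dim {x. proj x = x} = 2 * reflection_rank G"
  and subspace_reflection_representation: "subspace {x. proj x = x}"
  and reflection_rank_le: "reflection_rank G \<le> CARD('n)"
proof -
  let ?U = "{x. proj x = x}" and ?F = "fixed_space G"
  have "vec.subspace ?U"
    using proj_scale[of 0 0] by (auto simp: vec.subspace_def proj_add proj_scale)
  then show U: "subspace ?U" by (rule complex_subspace_imp_subspace)
  have F: "subspace ?F" using vec_subspace_fixed_space by (rule complex_subspace_imp_subspace)
  have "?U \<inter> ?F = {0}"
    using proj_fixed proj_scale[of 0 0] vec.subspace_0[OF vec_subspace_fixed_space] by auto
  moreover have "{x + y |x y. x \<in> ?U \<and> y \<in> ?F} = UNIV"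
  proof -
    have "\<exists>x y. z = x + y \<and> x \<in> ?U \<and> y \<in> ?F" for z
      by (intro exI[of _ "proj z"] exI[of _ "average z"]) (simp add: proj_proj average_in_fixed, simp add: proj_def)
    then show ?thesis by auto
  qed
  ultimately have "dim ?U + dim ?F = 2 * CARD('n)"
    using dim_sums_Int[OF U F] by simp
  moreover have "dim ?F = 2 * vec.dim ?F" using dim_complex_subspace[OF vec_subspace_fixed_space] .
  ultimately show "dim ?U = 2 * reflection_rank G" by (simp add: reflection_rank_def)
  show "reflection_rank G \<le> CARD('n)" by (simp add: reflection_rank_def)
qed

end

context reflection_group
begin

text \<open>
  The theorem of Chevalley.  What remains is to count the generators: with more than the rank, rank
  plus one of them would map a space onto one of larger dimension; with fewer, a locally injective
  map would lower the dimension.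
\<close>

theorem ex_basic_invariants: "\<exists>fs ds. basic_invariants G fs ds"
proof -
  obtain k f d where f: "\<And>i. f i \<in> invariant_ring G" "\<And>i. homogeneous (d i) (f i)" "\<And>i. 0 < d i"
    and pos: "\<And>p d. p \<in> invariant_ring G \<Longrightarrow> homogeneous d p \<Longrightarrow> 0 < d \<Longrightarrow> p \<in> ideal_span reduced {..<k :: nat} f"
    and minimal: "\<And>i. i < k \<Longrightarrow> f i \<notin> ideal_span reduced ({..<k} - {i}) f"
    by (rule minimal_generators) blast
  have independent: "p = (\<lambda>_. 0)" if "p \<in> polynomials_in k" "\<And>x. p (\<lambda>i. f i x) = 0" for p
    by (rule minimal_generators_independent[OF f pos minimal that])
  have generate: "\<exists>P\<in>polynomials_in k. \<forall>x. p x = P (\<lambda>i. f i x)" if "p \<in> invariant_ring G" for p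
    by (rule ideal_generators_generate[OF f pos that])
  let ?U = "{x. proj x = x}"
  have "k \<le> reflection_rank G"
  proof (rule ccontr)
    assume large: "\<not> k \<le> reflection_rank G"
    define k' where "k' = Suc (reflection_rank G)"
    have k': "k' \<le> k" using large by (simp add: k'_def)
    \<comment> \<open>The rank can be \<open>CARD('n)\<close>, so the target needs one more coordinate.\<close>
    have "card {..<k'} \<le> CARD('n option)" using reflection_rank_le by (simp add: k'_def)
    then obtain \<iota> :: "nat \<Rightarrow> 'n option" where inj: "inj_on \<iota> {..<k'}"
      using card_le_inj[of "{..<k'}" "UNIV :: 'n option set"] by auto
    let ?L = "coordinate_space (\<iota> ` {..<k'})"
    have "\<not> ?L \<subseteq> (\<Union>T\<in>{?U}. coordinate_map k' \<iota> f ` T)"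
    proof (rule not_covered_by_small_images)
      show "dim T < dim ?L" if "T \<in> {?U}" for T
        using that dim_reflection_representation card_image[OF inj]
        by (simp add: dim_coordinate_space k'_def)
      show "coordinate_map k' \<iota> f differentiable (at x)" for x
        by (rule coordinate_map_differentiable[OF inj reduced_polynomial[OF invariant_reduced[OF f(1)]]])
    qed (use subspace_reflection_representation subspace_coordinate_space in auto)
    moreover have "?L \<subseteq> coordinate_map k' \<iota> f ` ?U"
    proof
      fix y assume y: "y \<in> ?L"
      obtain x where x: "\<And>i. i < k \<Longrightarrow> f i x = y $ \<iota> i"
        using quotient_map_surjective[OF f(1) generate independent, of "\<lambda>i. y $ \<iota> i"] by blast
      have "y = coordinate_map k' \<iota> f (proj x)"
        using y x k' reduced_proj[OF invariant_reduced[OF f(1)]]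
        by (intro coordinate_map_eqI[OF inj]) (auto simp: coordinate_space_def)
      then show "y \<in> coordinate_map k' \<iota> f ` ?U" using proj_proj by blast
    qed
    ultimately show False by simp
  qed
  moreover have "reflection_rank G \<le> k"
  proof -
    have "k \<le> CARD('n)" using calculation reflection_rank_le by simp
    then obtain \<iota> :: "nat \<Rightarrow> 'n" where inj: "inj_on \<iota> {..<k}"
      using card_le_inj[of "{..<k}" "UNIV :: 'n set"] by auto
    have "dim ?U \<le> 2 * card {..<k}"
      by (rule dim_le_coordinates[OF f(1) generate inj subspace_reflection_representation]) auto
    then show ?thesis by (simp add: dim_reflection_representation)
  qed
  ultimately have k: "k = reflection_rank G" by simp
  let ?fs = "map f [0..<k]" and ?ds = "map d [0..<k]"
  have "basic_invariants G ?fs ?ds"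
    unfolding basic_invariants_def
  proof (intro conjI)
    show "length ?fs = reflection_rank G" using k by simp
    show "list_all2 homogeneous ?ds ?fs" using f(2) by (simp add: list_all2_conv_all_nth)
    show "algebraically_independent ?fs"
      unfolding algebraically_independent_def
    proof (intro ballI impI)
      fix p assume p: "p \<in> polynomials_in (length ?fs)" "\<forall>x. p (\<lambda>i. (?fs ! i) x) = 0"
      have "p (\<lambda>i. f i x) = p (\<lambda>i. (?fs ! i) x)" for x
        by (rule polynomials_in_cong[OF p(1)]) simp
      then show "p = (\<lambda>_. 0)" using p by (intro independent) auto
    qed
    show "generated_algebra (set ?fs) = invariant_ring G"
    proof (intro equalityI subsetI)
      fix p assume "p \<in> generated_algebra (set ?fs)"
      then show "p \<in> invariant_ring G"
        by induction (use f(1) function_ring_invariant in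
            \<open>auto intro: function_ring_const function_ring_add function_ring_mult\<close>)
    next
      fix p assume "p \<in> invariant_ring G"
      then obtain P where P: "P \<in> polynomials_in k" "\<And>x. p x = P (\<lambda>i. f i x)" using generate by blast
      have "(\<lambda>x. P (\<lambda>i. f i x)) \<in> generated_algebra (set ?fs)"
        by (rule polynomials_in_compose[OF P(1)])
          (auto simp: function_ring_def intro: generated_algebra.intros)
      moreover have "p = (\<lambda>x. P (\<lambda>i. f i x))" using P(2) by (rule ext)
      ultimately show "p \<in> generated_algebra (set ?fs)" by (simp only:)
    qed
  qed
  then show ?thesis by blast
qed

end

section \<open>Dimensions of eigenspaces\<close>

definition eigenspace :: "real ^ 'n ^ 'n \<Rightarrow> complex \<Rightarrow> (complex ^ 'n) set" where
  "eigenspace g z = {x. act g x = z *s x}"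

lemma subspace_eigenspace: "subspace (eigenspace g z)"
  by (rule complex_subspace_imp_subspace)
    (auto simp: vec.subspace_def eigenspace_def act_zero act_add act_scale vec.scale_right_distrib mult.commute)

lemma primitive_root_power_eq_1:
  assumes "0 < m" "primitive_root_of_unity m z"
  shows "z ^ d = 1 \<longleftrightarrow> m dvd d"
proof -
  have "z ^ d = z ^ (d mod m) * (z ^ m) ^ (d div m)"
    by (simp flip: power_mult power_add)
  then have "z ^ d = z ^ (d mod m)" using assms(2) by (simp add: primitive_root_of_unity_def)
  moreover have "d mod m < m" using assms(1) by simp
  ultimately show ?thesis
    using assms(2) unfolding primitive_root_of_unity_def by (metis dvd_eq_mod_eq_0 gr0I power_0)
qed

context matrix_group
begin

lemma eigenspace_proj:
  assumes "g \<in> G" "z \<noteq> 1" "x \<in> eigenspace g z"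
  shows "proj x = x"
proof -
  have "average x = z *s average x"
    using average_act[OF assms(1), of x] assms(3) by (simp add: eigenspace_def average_scale)
  then have "(1 - z) *s average x = 0" by (simp add: vec.scale_left_diff_distrib)
  then have "average x = 0" using assms(2) unfolding vec.scale_eq_0_iff by simp
  then show ?thesis by (simp add: proj_def)
qed

end

text \<open>
  Springer's theory of eigenspaces, for an arbitrary system of basic invariants.  Dimensions are real,
  hence the factors 2.
\<close>

locale eigenspace_setup = matrix_group G for G :: "(real ^ 'n ^ 'n) set" +
  fixes fs ds m z
  assumes basic: "basic_invariants G fs ds" and m_pos: "0 < m" and z_ne_1: "z \<noteq> 1"
    and z: "primitive_root_of_unity m z"
begin

abbreviation "k \<equiv> length fs"

definition divisible :: "nat set" where
  "divisible = {i. i < length ds \<and> m dvd ds ! i}"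

lemma length_ds: "length ds = k"
  using basic by (auto simp: basic_invariants_def list_all2_lengthD)

lemma fs_homogeneous: "i < k \<Longrightarrow> homogeneous (ds ! i) (fs ! i)"
  using basic by (auto simp: basic_invariants_def list_all2_conv_all_nth)

lemma fs_invariant: "i < k \<Longrightarrow> fs ! i \<in> invariant_ring G"
  using basic nth_mem generated_algebra.generator unfolding basic_invariants_def by metis

lemma fs_generate:
  assumes "p \<in> invariant_ring G"
  shows "\<exists>P\<in>polynomials_in k. \<forall>x. p x = P (\<lambda>i. (fs ! i) x)"
proof -
  have "p \<in> generated_algebra (set fs)" using assms basic by (simp add: basic_invariants_def)
  then show ?thesis
  proof induction
    case (generator f)
    then obtain i where "i < k" "f = fs ! i" by (auto simp: in_set_conv_nth)
    then show ?case by (intro bexI[of _ "\<lambda>y. y i"] polynomials_in_variable) auto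
  next
    case (const c)
    show ?case by (rule bexI[of _ "\<lambda>_. c"]) (auto intro: function_ring_const function_ring_polynomials_in)
  next
    case (add f g)
    then obtain P Q where "P \<in> polynomials_in k" "\<forall>x. f x = P (\<lambda>i. (fs ! i) x)"
      "Q \<in> polynomials_in k" "\<forall>x. g x = Q (\<lambda>i. (fs ! i) x)" by blast
    then show ?case
      by (intro bexI[of _ "\<lambda>y. P y + Q y"] function_ring_add function_ring_polynomials_in) auto
  next
    case (mult f g)
    then obtain P Q where "P \<in> polynomials_in k" "\<forall>x. f x = P (\<lambda>i. (fs ! i) x)"
      "Q \<in> polynomials_in k" "\<forall>x. g x = Q (\<lambda>i. (fs ! i) x)" by blast
    then show ?case
      by (intro bexI[of _ "\<lambda>y. P y * Q y"] function_ring_mult function_ring_polynomials_in) auto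
  qed
qed

lemma fs_independent:
  "p \<in> polynomials_in k \<Longrightarrow> (\<And>x. p (\<lambda>i. (fs ! i) x) = 0) \<Longrightarrow> p = (\<lambda>_. 0)"
  using basic by (auto simp: basic_invariants_def algebraically_independent_def)

lemma divisible_subset: "divisible \<subseteq> {..<k}"
  by (auto simp: divisible_def length_ds)

text \<open>On an eigenspace for \<open>z\<close>, an invariant of degree \<open>d\<close> is multiplied by \<open>z ^ d\<close> and unchanged.\<close>

lemma fs_vanish:
  assumes "g \<in> G" "x \<in> eigenspace g z" "i < k" "i \<notin> divisible"
  shows "(fs ! i) x = 0"
proof -
  have "(fs ! i) x = (fs ! i) (act g x)"
    using fs_invariant[OF assms(3)] assms(1) by (simp add: invariant_ring_iff)
  also have "\<dots> = z ^ (ds ! i) * (fs ! i) x"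
    using assms(2) fs_homogeneous[OF assms(3)] by (simp add: eigenspace_def homogeneous_def)
  finally have "(fs ! i) x * (1 - z ^ (ds ! i)) = 0" by (simp add: algebra_simps)
  moreover have "z ^ (ds ! i) \<noteq> 1"
    using assms(3,4) primitive_root_power_eq_1[OF m_pos z] by (auto simp: divisible_def length_ds)
  ultimately show ?thesis by simp
qed

lemma ex_index: obtains \<iota> :: "nat \<Rightarrow> 'n" where "inj_on \<iota> {..<k}"
proof -
  have "k \<le> CARD('n)" using basic reflection_rank_le by (simp add: basic_invariants_def)
  then show thesis using card_le_inj[of "{..<k}" "UNIV :: 'n set"] that by auto
qed

lemma dim_eigenspace_le:
  assumes "g \<in> G"
  shows "dim (eigenspace g z) \<le> 2 * card divisible"
proof -
  obtain \<iota> :: "nat \<Rightarrow> 'n" where inj: "inj_on \<iota> {..<k}" by (rule ex_index)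
  show ?thesis
    by (rule dim_le_coordinates[OF fs_invariant fs_generate inj subspace_eigenspace
          eigenspace_proj[OF assms z_ne_1] divisible_subset fs_vanish[OF assms]])
qed

text \<open>
  The common zeros of the basic invariants of degree not divisible by \<open>m\<close> map onto a coordinate
  space, and they are the union of the eigenspaces: such a vector \<open>x\<close> and \<open>z *s x\<close> have the same
  invariants, hence lie in one orbit.
\<close>

lemma ex_large_eigenspace: "\<exists>g\<in>G. 2 * card divisible \<le> dim (eigenspace g z)"
proof (rule ccontr)
  assume small: "\<not> ?thesis"
  obtain \<iota> :: "nat \<Rightarrow> 'n" where inj: "inj_on \<iota> {..<k}" by (rule ex_index)
  let ?f = "\<lambda>i. fs ! i" and ?L = "coordinate_space (\<iota> ` divisible)"
  let ?F = "coordinate_map k \<iota> ?f"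
  have "\<not> ?L \<subseteq> (\<Union>T\<in>(\<lambda>g. eigenspace g z) ` G. ?F ` T)"
  proof (rule not_covered_by_small_images)
    fix T assume T: "T \<in> (\<lambda>g. eigenspace g z) ` G"
    then show "subspace T" using subspace_eigenspace by blast
    have "card (\<iota> ` divisible) = card divisible"
      using card_image inj_on_subset[OF inj divisible_subset] by blast
    then show "dim T < dim ?L" using small T by (auto simp: dim_coordinate_space not_le)
  next
    show "?F differentiable (at x)" for x
      by (rule coordinate_map_differentiable[OF inj reduced_polynomial[OF invariant_reduced[OF fs_invariant]]])
  qed (use finite_group subspace_coordinate_space in auto)
  moreover have "?L \<subseteq> (\<Union>T\<in>(\<lambda>g. eigenspace g z) ` G. ?F ` T)"
  proof
    fix y assume y: "y \<in> ?L"
    obtain x' where x': "\<And>i. i < k \<Longrightarrow> ?f i x' = y $ \<iota> i"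
      using quotient_map_surjective[OF fs_invariant fs_generate fs_independent, of "\<lambda>i. y $ \<iota> i"] by blast
    define x where "x = proj x'"
    have x: "proj x = x" "\<And>i. i < k \<Longrightarrow> ?f i x = y $ \<iota> i"
      using x' reduced_proj[OF invariant_reduced[OF fs_invariant]] by (simp_all add: x_def proj_proj)
    have "?f i x = ?f i (z *s x)" if i: "i < k" for i
    proof (cases "i \<in> divisible")
      case True
      then have "z ^ (ds ! i) = 1" using primitive_root_power_eq_1[OF m_pos z] by (simp add: divisible_def)
      then show ?thesis using fs_homogeneous[OF i] by (simp add: homogeneous_def)
    next
      case False
      then have "\<iota> i \<notin> \<iota> ` divisible"
        using inj_on_image_mem_iff[OF inj, of i divisible] i divisible_subset by simp
      then have "?f i x = 0" using y x(2)[OF i] by (simp add: coordinate_space_def)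
      then show ?thesis using fs_homogeneous[OF i] by (simp add: homogeneous_def)
    qed
    then have "p x = p (z *s x)" if "p \<in> invariant_ring G" for p
      using eq_of_generators[OF fs_generate[OF that]] by blast
    then obtain g where "g \<in> G" "z *s x = act g x"
      using invariants_separate_orbits[of x "z *s x"] x(1) by (auto simp: proj_scale)
    then have "x \<in> eigenspace g z" by (simp add: eigenspace_def)
    moreover have "y = ?F x"
      using y x(2) divisible_subset by (intro coordinate_map_eqI[OF inj]) (auto simp: coordinate_space_def)
    ultimately show "y \<in> (\<Union>T\<in>(\<lambda>g. eigenspace g z) ` G. ?F ` T)" using \<open>g \<in> G\<close> by blast
  qed
  ultimately show False by blast
qed

text \<open>
  An invariant that vanishes on an eigenspace of largest dimension vanishes, as a polynomial in the
  basic invariants, on an open part of the coordinate space that contains the image of all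
  eigenspaces, hence on all eigenspaces.  So the orbits of eigenvectors meet that eigenspace.
\<close>

lemma eigenvector_in_large_eigenspace:
  assumes g: "g \<in> G" "dim (eigenspace g z) = 2 * card divisible"
    and v: "g' \<in> G" "v \<in> eigenspace g' z"
  shows "\<exists>w\<in>G. act w v \<in> eigenspace g z"
proof (rule ccontr)
  assume none: "\<not> ?thesis"
  let ?E = "eigenspace g z" and ?f = "\<lambda>i. fs ! i"
  obtain \<iota> :: "nat \<Rightarrow> 'n" where inj: "inj_on \<iota> {..<k}" by (rule ex_index)
  let ?L = "coordinate_space (\<iota> ` divisible)" and ?F = "coordinate_map k \<iota> ?f"
  define M where "M x = act g x - z *s x" for x
  have "finite ((\<lambda>w. M (act w v)) ` G)" "0 \<notin> (\<lambda>w. M (act w v)) ` G"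
    using finite_group none by (auto simp: M_def eigenspace_def)
  from ex_form_nonzero[OF this] obtain a :: "complex ^ 'n" where
    a: "\<And>w. w \<in> G \<Longrightarrow> (\<Sum>i\<in>UNIV. a $ i * M (act w v) $ i) \<noteq> 0" by blast
  \<comment> \<open>A linear form that vanishes on \<open>?E\<close> and nowhere on the orbit of \<open>v\<close>; its product over the group
    is an invariant that vanishes on \<open>?E\<close> but not at \<open>v\<close>.\<close>
  define l where "l x = (\<Sum>i\<in>UNIV. a $ i * M (proj x) $ i)" for x
  have "(\<lambda>x. \<Sum>i\<in>UNIV. a $ i * M x $ i) \<in> polynomial_functions"
    unfolding M_def vector_minus_component vector_smult_component
    by (intro polynomial_intros polynomial_act_coordinate polynomial_coordinate)
  then have l: "l \<in> reduced" unfolding l_def[abs_def] by (rule compose_proj_reduced)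
  obtain P where P: "P \<in> polynomials_in k" "\<And>x. (\<Prod>w\<in>G. l (act w x)) = P (\<lambda>i. ?f i x)"
    using fs_generate[OF orbit_product_invariant[OF l]] by blast
  have P_E: "P (\<lambda>i. ?f i x) = 0" if "x \<in> ?E" for x
  proof -
    have "l (act (mat 1) x) = 0"
      using eigenspace_proj[OF g(1) z_ne_1 that] that by (simp add: act_one l_def M_def eigenspace_def)
    then show ?thesis unfolding P(2)[symmetric] using finite_group one_in by (intro prod_zero) auto
  qed
  have pv: "proj v = v" using eigenspace_proj[OF v(1) z_ne_1 v(2)] .
  have P_v: "P (\<lambda>i. ?f i v) \<noteq> 0"
    unfolding P(2)[symmetric] using a finite_group proj_act[of _ v] pv by (auto simp: l_def prod_zero_iff)
  obtain U where U: "U \<noteq> {}" "openin (top_of_set ?L) U" "U \<subseteq> ?F ` ?E"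
    using coordinate_map_open_image[OF fs_invariant fs_generate inj subspace_eigenspace
        eigenspace_proj[OF g(1) z_ne_1] divisible_subset fs_vanish[OF g(1)] g(2)] by blast
  obtain y0 where y0: "y0 \<in> U" using U(1) by blast
  then obtain r where r: "r > 0" "ball y0 r \<inter> ?L \<subseteq> U"
    using U(2) unfolding openin_contains_ball by blast
  define y1 where "y1 = ?F v"
  have y0L: "y0 \<in> ?L" using U(2) y0 openin_imp_subset by blast
  have y1L: "y1 \<in> ?L"
  proof -
    have "?F v $ j = 0" if "j \<notin> \<iota> ` divisible" for j
    proof (cases "j \<in> \<iota> ` {..<k}")
      case True
      then obtain i where "i < k" "j = \<iota> i" by auto
      then show ?thesis using that fs_vanish[OF v, of i] by (auto simp: coordinate_map_nth[OF inj])
    qed (rule coordinate_map_nth_outside)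
    then show ?thesis by (simp add: y1_def coordinate_space_def)
  qed
  \<comment> \<open>On the line from \<open>y0\<close> to the image of \<open>v\<close> the invariant is a polynomial with infinitely many zeros.\<close>
  let ?y = "\<lambda>t :: complex. y0 + t *s (y1 - y0)"
  have "\<exists>q. \<forall>t. P (\<lambda>i. ?y t $ \<iota> i) = poly q t"
  proof (rule generated_algebra_poly_along_curve[OF P(1)[unfolded polynomials_in_eq]])
    fix h :: "(nat \<Rightarrow> complex) \<Rightarrow> complex" assume "h \<in> (\<lambda>i y. y i) ` {..<k}"
    then obtain i where "h = (\<lambda>y. y i)" by blast
    then have "\<forall>t. h (\<lambda>i. ?y t $ \<iota> i) = poly [:y0 $ \<iota> i, (y1 - y0) $ \<iota> i:] t" by (simp add: algebra_simps)
    then show "\<exists>q. \<forall>t. h (\<lambda>i. ?y t $ \<iota> i) = poly q t" by blast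
  qed
  then obtain q where q: "\<And>t. P (\<lambda>i. ?y t $ \<iota> i) = poly q t" by blast
  have small: "poly q t = 0" if t: "cmod t * norm (y1 - y0) < r" for t
  proof -
    have "dist y0 (?y t) = norm (t *s (y1 - y0))"
      by (subst dist_commute) (simp only: dist_norm add_diff_cancel_left')
    then have "?y t \<in> ball y0 r" using t unfolding norm_smult by simp
    moreover have "?y t \<in> ?L" using y0L y1L by (simp add: coordinate_space_def)
    ultimately obtain x where x: "x \<in> ?E" "?y t = ?F x" using r(2) U(3) by blast
    have "P (\<lambda>i. ?y t $ \<iota> i) = P (\<lambda>i. ?f i x)"
      unfolding x(2) by (rule polynomials_in_cong[OF P(1)]) (rule coordinate_map_nth[OF inj])
    then show ?thesis using P_E[OF x(1)] q by simp
  qed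
  have "infinite {t. poly q t = 0}"
  proof -
    define s where "s = r / (norm (y1 - y0) + 1)"
    have s: "s > 0" using r(1) by (simp add: s_def add_nonneg_pos)
    define e where "e n = complex_of_real (s / (real n + 1))" for n
    have "range e \<subseteq> {t. poly q t = 0}"
    proof clarify
      fix n
      have "cmod (e n) * norm (y1 - y0) \<le> s * norm (y1 - y0)"
      proof (intro mult_right_mono)
        have "\<bar>s / (real n + 1)\<bar> \<le> s" using s by (simp add: field_simps)
        then show "cmod (e n) \<le> s" unfolding e_def by (simp only: norm_of_real)
      qed simp
      also have "\<dots> < s * (norm (y1 - y0) + 1)" using s by simp
      also have "\<dots> = r" by (simp add: s_def add_nonneg_eq_0_iff)
      finally show "poly q (e n) = 0" by (rule small)
    qed
    moreover have "inj e"
    proof (rule injI)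
      fix a b assume "e a = e b"
      then have "s / (real a + 1) = s / (real b + 1)" unfolding e_def by (simp only: of_real_eq_iff)
      then show "a = b" using s by (simp add: field_simps)
    qed
    then have "infinite (range e)" by (rule range_inj_infinite)
    ultimately show ?thesis by (rule infinite_super)
  qed
  then have "q = 0" using poly_roots_finite by blast
  then have "P (\<lambda>i. y1 $ \<iota> i) = 0" using q[of 1] by simp
  moreover have "P (\<lambda>i. y1 $ \<iota> i) = P (\<lambda>i. ?f i v)"
    unfolding y1_def by (rule polynomials_in_cong[OF P(1)]) (rule coordinate_map_nth[OF inj])
  ultimately show False using P_v by simp
qed

end

section \<open>Roots\<close>

context matrix_group
begin

text \<open>An inner product that the group preserves, for which its reflections are orthogonal.\<close>

definition ip :: "real ^ 'n \<Rightarrow> real ^ 'n \<Rightarrow> real" where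
  "ip x y = (\<Sum>g\<in>G. (g *v x) \<bullet> (g *v y))"

lemma ip_commute: "ip x y = ip y x"
  by (simp add: ip_def inner_commute)

lemma ip_add_left: "ip (x + y) z = ip x z + ip y z"
  by (simp add: ip_def matrix_vector_right_distrib inner_add_left sum.distrib)

lemma ip_scale_left: "ip (c *\<^sub>R x) y = c * ip x y"
  by (simp add: ip_def matrix_vector_mult_scaleR sum_distrib_left)

lemma ip_minus_left: "ip (- x) y = - ip x y"
  using ip_scale_left[of "-1" x y] by simp

lemma ip_diff_left: "ip (x - y) z = ip x z - ip y z"
  using ip_add_left[of x "- y" z] by (simp add: ip_minus_left)

lemma ip_zero_left: "ip 0 y = 0"
  using ip_scale_left[of 0 0 y] by simp

lemma ip_sum_left: "ip (\<Sum>i\<in>I. f i) y = (\<Sum>i\<in>I. ip (f i) y)"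
  by (induction I rule: infinite_finite_induct) (simp_all add: ip_zero_left ip_add_left)

lemma ip_add_right: "ip z (x + y) = ip z x + ip z y"
  using ip_add_left[of x y z] by (simp add: ip_commute)

lemma ip_scale_right: "ip y (c *\<^sub>R x) = c * ip y x"
  using ip_scale_left[of c x y] by (simp add: ip_commute)

lemma ip_minus_right: "ip y (- x) = - ip y x"
  using ip_minus_left[of x y] by (simp add: ip_commute)

lemma ip_sum_right: "ip y (\<Sum>i\<in>I. f i) = (\<Sum>i\<in>I. ip y (f i))"
  using ip_sum_left[of f I y] by (simp add: ip_commute)

lemma ip_pos: "x \<noteq> 0 \<Longrightarrow> 0 < ip x x"
  unfolding ip_def using one_in finite_group by (intro sum_pos2[of _ "mat 1"]) auto

lemma ip_invariant: "g \<in> G \<Longrightarrow> ip (g *v x) (g *v y) = ip x y"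
  using sum.reindex_bij_betw[OF bij_mult_right, of g "\<lambda>h. (h *v x) \<bullet> (h *v y)"]
  by (simp add: ip_def matrix_vector_mul_assoc)

text \<open>Roots are normalized to length 1 for the invariant inner product, so each reflection has two.\<close>

definition has_root :: "real ^ 'n ^ 'n \<Rightarrow> real ^ 'n \<Rightarrow> bool" where
  "has_root s a \<longleftrightarrow> ip a a = 1 \<and> (\<forall>x. s *v x = x - (2 * ip x a) *\<^sub>R a)"

definition roots :: "(real ^ 'n) set" where
  "roots = {a. \<exists>s\<in>G. has_root s a}"

lemma has_root_apply: "has_root s a \<Longrightarrow> s *v x = x - (2 * ip x a) *\<^sub>R a"
  by (simp add: has_root_def)

lemma has_root_self: "has_root s a \<Longrightarrow> s *v a = - a"
  by (simp add: has_root_def scaleR_2)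

lemma has_root_unit: "has_root s a \<Longrightarrow> ip a a = 1"
  by (simp add: has_root_def)

lemma has_root_minus: "has_root s a \<Longrightarrow> has_root s (- a)"
  by (simp add: has_root_def ip_minus_left ip_minus_right)

lemma has_root_involution:
  assumes "has_root s a" shows "s ** s = mat 1"
  unfolding matrix_eq matrix_vector_mul_assoc[symmetric]
  by (simp add: has_root_apply[OF assms] has_root_unit[OF assms] ip_diff_left ip_scale_left
      flip: scaleR_add_left)

lemma has_root_conjugate:
  assumes "w \<in> G" "w' ** w = mat 1" "w ** w' = mat 1" "has_root s a"
  shows "has_root (w ** s ** w') (w *v a)"
  unfolding has_root_def
proof (intro conjI allI)
  show "ip (w *v a) (w *v a) = 1" using assms(4) by (simp add: ip_invariant[OF assms(1)] has_root_def)
  fix x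
  have x: "w *v (w' *v x) = x" using assms(3) by (simp add: matrix_vector_mul_assoc)
  then have "ip (w' *v x) a = ip x (w *v a)" using ip_invariant[OF assms(1), of "w' *v x" a] by simp
  moreover have "(w ** s ** w') *v x = w *v (s *v (w' *v x))"
    by (simp add: matrix_vector_mul_assoc matrix_mul_assoc)
  ultimately show "(w ** s ** w') *v x = x - (2 * ip x (w *v a)) *\<^sub>R (w *v a)"
    using x by (simp add: has_root_apply[OF assms(4)] matrix_vector_mult_diff_distrib matrix_vector_mult_scaleR)
qed

lemma root_image:
  assumes "w \<in> G" "a \<in> roots" shows "w *v a \<in> roots"
proof -
  obtain w' where w': "w' \<in> G" "w' ** w = mat 1" "w ** w' = mat 1" using inverse_in[OF assms(1)] by blast
  obtain s where "s \<in> G" "has_root s a" using assms(2) by (auto simp: roots_def)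
  then have "has_root (w ** s ** w') (w *v a)" "w ** s ** w' \<in> G"
    using has_root_conjugate[OF assms(1) w'(2,3)] mult_in assms(1) w'(1) by blast+
  then show ?thesis by (auto simp: roots_def)
qed

lemma root_minus: "a \<in> roots \<Longrightarrow> - a \<in> roots"
  using has_root_minus by (auto simp: roots_def)

lemma finite_roots: "finite roots"
proof -
  have "finite {a. has_root s a}" for s
  proof (cases "\<exists>a. has_root s a")
    case True
    then obtain a where a: "has_root s a" by blast
    have "b = a \<or> b = - a" if b: "has_root s b" for b
    proof -
      have "- b = b - (2 * ip b a) *\<^sub>R a" using has_root_self[OF b] has_root_apply[OF a, of b] by simp
      then have "2 *\<^sub>R b = 2 *\<^sub>R (ip b a *\<^sub>R a)" by (simp add: algebra_simps scaleR_2)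
      then have eq: "b = ip b a *\<^sub>R a" by (simp only: scaleR_cancel_left) simp
      have "ip b b = ip b a * ip b a"
        using arg_cong[OF eq, of "ip b"] by (simp add: ip_scale_right)
      then have "ip b a * ip b a = 1" using has_root_unit[OF b] by simp
      then have "ip b a = 1 \<or> ip b a = -1" by (simp add: square_eq_1_iff)
      then show ?thesis using eq by (metis scaleR_minus1_left scaleR_one)
    qed
    then have "{a. has_root s a} \<subseteq> {a, - a}" by blast
    then show ?thesis using finite_subset by blast
  qed simp
  then have "finite (\<Union>s\<in>G. {a. has_root s a})" using finite_group by blast
  moreover have "roots = (\<Union>s\<in>G. {a. has_root s a})" by (auto simp: roots_def)
  ultimately show ?thesis by simp
qed

lemma linear_ip: "linear (\<lambda>x. ip x a)"
  by (rule linearI) (simp_all add: ip_add_left ip_scale_left)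

lemma reflection_if_root:
  assumes "has_root s a"
  shows "reflection s"
  unfolding reflection_def
proof
  show "s ** s = mat 1" by (rule has_root_involution[OF assms])
  have a: "a \<noteq> 0" using has_root_unit[OF assms] ip_zero_left[of 0] by auto
  have "{x. s *v x = x} = {x. ip x a = 0}"
    using a by (auto simp: has_root_apply[OF assms])
  also have "\<dots> = {x. adjoint (\<lambda>x. ip x a) 1 \<bullet> x = 0}"
    using adjoint_works[OF linear_ip, of _ a 1] by (simp add: inner_commute)
  also have "dim \<dots> = CARD('n) - 1"
  proof -
    have "adjoint (\<lambda>x. ip x a) 1 \<bullet> a = 1"
      using adjoint_works[OF linear_ip, of a a 1] has_root_unit[OF assms] by (simp add: inner_commute)
    then have "adjoint (\<lambda>x. ip x a) 1 \<noteq> 0" by auto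
    then show ?thesis by (simp add: dim_hyperplane)
  qed
  finally show "dim {x. s *v x = x} + 1 = CARD('n)" by simp
qed

lemma ex_root:
  assumes "s \<in> G" "reflection s"
  shows "\<exists>a. has_root s a"
proof -
  obtain a b where ab: "a \<noteq> 0" "b \<noteq> 0" "\<And>x. s *v x = x - (b \<bullet> x) *\<^sub>R a"
    using reflection_form[OF assms(2)] by blast
  have "s *v (s *v b) = b" using assms(2) by (simp add: reflection_def matrix_vector_mul_assoc)
  then have "(b \<bullet> b) * (2 - b \<bullet> a) = 0"
    using ab(1) by (simp add: ab(3) inner_diff_right algebra_simps flip: scaleR_add_left scaleR_diff_left)
  then have "b \<bullet> a = 2" using ab(2) by simp
  then have sa: "s *v a = - a" by (simp add: ab(3) scaleR_2)
  have b: "(b \<bullet> x) * ip a a = 2 * ip x a" for x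
  proof -
    have "ip (s *v x) (s *v a) = ip x a" by (rule ip_invariant[OF assms(1)])
    then show ?thesis
      unfolding sa by (simp add: ab(3) ip_minus_right ip_diff_left ip_scale_left)
  qed
  define c where "c = 1 / sqrt (ip a a)"
  have c: "c * c * ip a a = 1" "ip a a > 0" using ip_pos[OF ab(1)] by (simp_all add: c_def)
  have "has_root s (c *\<^sub>R a)"
    unfolding has_root_def
  proof (intro conjI allI)
    show "ip (c *\<^sub>R a) (c *\<^sub>R a) = 1" using c by (simp add: ip_scale_left ip_scale_right mult.assoc)
    fix x
    have "2 * ip x (c *\<^sub>R a) * c = (c * c * ip a a) * (b \<bullet> x)"
      using b[of x] by (simp add: ip_scale_right algebra_simps)
    then have "b \<bullet> x = 2 * ip x (c *\<^sub>R a) * c" using c by simp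
    then show "s *v x = x - (2 * ip x (c *\<^sub>R a)) *\<^sub>R (c *\<^sub>R a)" unfolding ab(3) by simp
  qed
  then show ?thesis by blast
qed

lemma ex_regular: "\<exists>z. \<forall>a\<in>roots. ip a z \<noteq> 0"
proof -
  have "\<exists>z\<in>UNIV. \<forall>T\<in>(\<lambda>a. {z. ip a z = 0}) ` roots. z \<notin> T"
  proof (rule ex_avoiding_subspaces)
    fix T assume "T \<in> (\<lambda>a. {z. ip a z = 0}) ` roots"
    then obtain a where a: "a \<in> roots" "T = {z. ip a z = 0}" by blast
    show "subspace T"
      unfolding a subspace_def using ip_zero_left[of a] by (auto simp: ip_add_right ip_scale_right ip_commute[of a 0])
    have "a \<notin> T" using a has_root_unit by (auto simp: roots_def)
    then show "\<not> UNIV \<subseteq> T" by blast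
  qed (use finite_roots in auto)
  then show ?thesis by auto
qed

end

section \<open>Simple roots and the free action on chambers\<close>

definition matrix_word :: "(real ^ 'n ^ 'n) list \<Rightarrow> real ^ 'n ^ 'n" where
  "matrix_word ss = foldr (**) ss (mat 1)"

lemma matrix_word_simps [simp]:
  "matrix_word [] = mat 1" "matrix_word (s # ss) = s ** matrix_word ss"
  by (simp_all add: matrix_word_def)

lemma matrix_word_append: "matrix_word (ss @ ts) = matrix_word ss ** matrix_word ts"
  by (induction ss) (simp_all add: matrix_mul_assoc)

lemma matrix_word_rev:
  assumes "\<And>s. s \<in> set ss \<Longrightarrow> s ** s = mat 1"
  shows "matrix_word (rev ss) ** matrix_word ss = mat 1"
  using assms
proof (induction ss)
  case (Cons s ss)
  have "matrix_word (rev (s # ss)) ** matrix_word (s # ss)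
      = matrix_word (rev ss) ** (s ** s) ** matrix_word ss"
    by (simp add: matrix_word_append matrix_mul_assoc)
  then show ?case using Cons by simp
qed simp

text \<open>
  A chamber is given by a vector \<open>z\<close> off all reflecting hyperplanes, and a set of simple roots by
  minimality among the sets of positive roots whose cone contains all positive roots.
\<close>

locale chamber = reflection_group G for G :: "(real ^ 'n ^ 'n) set" +
  fixes z :: "real ^ 'n"
  assumes regular: "\<And>a. a \<in> roots \<Longrightarrow> ip a z \<noteq> 0"
begin

definition positive :: "(real ^ 'n) set" where
  "positive = {a \<in> roots. ip a z > 0}"

definition generates_cone :: "(real ^ 'n) set \<Rightarrow> bool" where
  "generates_cone D \<longleftrightarrow> D \<subseteq> positive \<and>
     (\<forall>b\<in>positive. \<exists>c. (\<forall>a\<in>D. 0 \<le> c a) \<and> b = (\<Sum>a\<in>D. c a *\<^sub>R a))"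

definition simple :: "(real ^ 'n) set" where
  "simple = (SOME D. generates_cone D \<and> (\<forall>D'. generates_cone D' \<longrightarrow> card D \<le> card D'))"

lemma finite_positive: "finite positive"
  using finite_roots by (simp add: positive_def)

lemma simple_minimal:
  shows "generates_cone simple" "generates_cone D' \<Longrightarrow> card simple \<le> card D'"
proof -
  have "generates_cone positive"
    unfolding generates_cone_def
  proof (intro conjI ballI order_refl)
    fix b assume b: "b \<in> positive"
    have "(\<Sum>a\<in>positive. (if a = b then 1 else 0) *\<^sub>R a) = b"
      using b finite_positive by (simp add: if_distrib[of "\<lambda>c. c *\<^sub>R _"] cong: if_cong)
    then show "\<exists>c. (\<forall>a\<in>positive. 0 \<le> c a) \<and> b = (\<Sum>a\<in>positive. c a *\<^sub>R a)"
      by (intro exI[of _ "\<lambda>a. if a = b then 1 else 0"]) auto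
  qed
  then have "\<exists>D. generates_cone D \<and> (\<forall>D'. generates_cone D' \<longrightarrow> card D \<le> card D')"
    by (rule ex_has_least_nat)
  from someI_ex[OF this] show "generates_cone simple" "generates_cone D' \<Longrightarrow> card simple \<le> card D'"
    by (auto simp: simple_def)
qed

lemma simple_positive: "simple \<subseteq> positive"
  using simple_minimal(1) by (simp add: generates_cone_def)

lemma finite_simple: "finite simple"
  using finite_subset[OF simple_positive finite_positive] .

lemma positive_combination:
  assumes "b \<in> positive"
  obtains c where "\<And>a. a \<in> simple \<Longrightarrow> 0 \<le> c a" "b = (\<Sum>a\<in>simple. c a *\<^sub>R a)"
proof -
  have "\<exists>c. (\<forall>a\<in>simple. 0 \<le> c a) \<and> b = (\<Sum>a\<in>simple. c a *\<^sub>R a)"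
    using simple_minimal(1) assms by (simp add: generates_cone_def)
  then show thesis using that by blast
qed

lemma simple_not_redundant:
  assumes "a \<in> simple" "\<And>b. b \<in> simple - {a} \<Longrightarrow> 0 \<le> c b"
  shows "a \<noteq> (\<Sum>b\<in>simple - {a}. c b *\<^sub>R b)"
proof
  assume a: "a = (\<Sum>b\<in>simple - {a}. c b *\<^sub>R b)"
  have "generates_cone (simple - {a})"
    unfolding generates_cone_def
  proof (intro conjI ballI)
    show "simple - {a} \<subseteq> positive" using simple_positive by blast
    fix b assume "b \<in> positive"
    then obtain d where d: "\<And>e. e \<in> simple \<Longrightarrow> 0 \<le> d e" "b = (\<Sum>e\<in>simple. d e *\<^sub>R e)"
      using positive_combination by blast
    have "b = d a *\<^sub>R a + (\<Sum>e\<in>simple - {a}. d e *\<^sub>R e)"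
      unfolding d(2) using assms(1) finite_simple by (rule sum.remove[rotated])
    also have "d a *\<^sub>R a = (\<Sum>e\<in>simple - {a}. (d a * c e) *\<^sub>R e)"
      by (subst a) (simp add: scaleR_sum_right)
    finally have "b = (\<Sum>e\<in>simple - {a}. (d a * c e + d e) *\<^sub>R e)"
      by (simp add: sum.distrib scaleR_add_left)
    moreover have "0 \<le> d a * c e + d e" if "e \<in> simple - {a}" for e
      using that d(1) assms by auto
    ultimately show "\<exists>c. (\<forall>e\<in>simple - {a}. 0 \<le> c e) \<and> b = (\<Sum>e\<in>simple - {a}. c e *\<^sub>R e)"
      by (intro exI[of _ "\<lambda>e. d a * c e + d e"] conjI ballI)
  qed
  then have "card simple \<le> card (simple - {a})" by (rule simple_minimal(2))
  then show False using assms(1) finite_simple by (meson card_Diff1_less not_less)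
qed

text \<open>
  If \<open>b\<close> and \<open>- s b\<close> were both nonnegative combinations of simple roots, their sum, a multiple of \<open>a\<close>,
  would be one.  Then either \<open>a\<close> is in the cone of the other simple roots, against minimality, or \<open>b\<close> is
  a multiple of \<open>a\<close>.
\<close>

lemma simple_reflection_positive:
  assumes "a \<in> simple" "s \<in> G" "has_root s a" "b \<in> positive" "b \<noteq> a"
  shows "s *v b \<in> positive"
proof (rule ccontr)
  assume not_pos: "s *v b \<notin> positive"
  have sb: "s *v b \<in> roots" using root_image[OF assms(2)] assms(4) by (simp add: positive_def)
  then have neg: "- (s *v b) \<in> positive"
    using not_pos regular[OF sb] root_minus[OF sb] by (simp add: positive_def ip_minus_left)
  obtain c where c: "\<And>e. e \<in> simple \<Longrightarrow> 0 \<le> c e" "b = (\<Sum>e\<in>simple. c e *\<^sub>R e)"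
    using positive_combination[OF assms(4)] by blast
  obtain d where d: "\<And>e. e \<in> simple \<Longrightarrow> 0 \<le> d e" "- (s *v b) = (\<Sum>e\<in>simple. d e *\<^sub>R e)"
    using positive_combination[OF neg] by blast
  let ?T = "simple - {a}"
  have split: "(\<Sum>e\<in>simple. f e *\<^sub>R e) = f a *\<^sub>R a + (\<Sum>e\<in>?T. f e *\<^sub>R e)" for f :: "real ^ 'n \<Rightarrow> real"
    using assms(1) finite_simple by (rule sum.remove[rotated])
  define k where "k = 2 * ip b a - c a - d a"
  have "b + (- (s *v b)) = (2 * ip b a) *\<^sub>R a" by (simp add: has_root_apply[OF assms(3)])
  then have "(\<Sum>e\<in>simple. (c e + d e) *\<^sub>R e) = (2 * ip b a) *\<^sub>R a"
    unfolding d(2) by (subst (asm) c(2)) (simp add: scaleR_add_left sum.distrib)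
  then have k: "k *\<^sub>R a = (\<Sum>e\<in>?T. (c e + d e) *\<^sub>R e)"
    unfolding split by (simp add: k_def algebra_simps)
  have pz: "ip e z > 0" if "e \<in> simple" for e using that simple_positive by (auto simp: positive_def)
  have kz: "k * ip a z = (\<Sum>e\<in>?T. (c e + d e) * ip e z)"
    using arg_cong[OF k, of "\<lambda>x. ip x z"] by (simp add: ip_scale_left ip_sum_left)
  have nonneg: "0 \<le> (c e + d e) * ip e z" if "e \<in> ?T" for e
    using that c(1) d(1) pz[of e] by (intro mult_nonneg_nonneg) (auto simp: less_imp_le)
  then have "0 \<le> k * ip a z" unfolding kz by (rule sum_nonneg)
  then have "0 \<le> k" using pz[OF assms(1)] by (simp add: zero_le_mult_iff)
  show False
  proof (cases "k = 0")
    case False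
    then have "a = inverse k *\<^sub>R (k *\<^sub>R a)" by simp
    also have "\<dots> = (\<Sum>e\<in>?T. (inverse k * (c e + d e)) *\<^sub>R e)"
      unfolding k by (simp add: scaleR_sum_right)
    finally show False
      using simple_not_redundant[OF assms(1), of "\<lambda>e. inverse k * (c e + d e)"] c(1) d(1) \<open>0 \<le> k\<close> by simp
  next
    case True
    then have "(\<Sum>e\<in>?T. (c e + d e) * ip e z) = 0" using kz by simp
    then have "(c e + d e) * ip e z = 0" if "e \<in> ?T" for e
      using sum_nonneg_eq_0_iff[of ?T "\<lambda>e. (c e + d e) * ip e z"] nonneg finite_simple that by simp
    then have "c e = 0" if "e \<in> ?T" for e
      using that pz[of e] c(1)[of e] d(1)[of e] by force
    then have b: "b = c a *\<^sub>R a" using c(2) split[of c] by simp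
    have "ip b b = 1" using assms(4) has_root_unit by (auto simp: positive_def roots_def)
    then have "c a * c a = 1"
      unfolding b using has_root_unit[OF assms(3)] by (simp add: ip_scale_left ip_scale_right)
    then have "c a = 1" using c(1)[OF assms(1)] by (auto simp: square_eq_1_iff)
    then show False using b assms(5) by simp
  qed
qed

definition simple_reflections :: "(real ^ 'n ^ 'n) set" where
  "simple_reflections = {s \<in> G. \<exists>a\<in>simple. has_root s a}"

lemma simple_reflection_involution: "s \<in> simple_reflections \<Longrightarrow> s ** s = mat 1"
  using has_root_involution by (auto simp: simple_reflections_def)

lemma simple_word_in: "set ss \<subseteq> simple_reflections \<Longrightarrow> matrix_word ss \<in> G"
  by (induction ss) (auto simp: one_in simple_reflections_def intro: mult_in)

text \<open>
  Among the positive roots in the orbit of \<open>b\<close> under simple reflections, one of least height over \<open>z\<close>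
  is simple: otherwise some simple reflection lowers it further.
\<close>

lemma positive_root_to_simple:
  assumes "b \<in> positive"
  shows "\<exists>ss. set ss \<subseteq> simple_reflections \<and> matrix_word ss *v b \<in> simple"
proof -
  define X where "X = {c \<in> positive. \<exists>ss. set ss \<subseteq> simple_reflections \<and> c = matrix_word ss *v b}"
  have "finite X" using finite_positive by (simp add: X_def)
  moreover have "b \<in> X" using assms by (auto simp: X_def intro!: exI[of _ "[]"])
  ultimately obtain c where c: "c \<in> X" "\<And>d. d \<in> X \<Longrightarrow> ip c z \<le> ip d z"
    using arg_min_if_finite[of X "\<lambda>c. ip c z"] by (metis empty_iff leI)
  have cpos: "c \<in> positive" using c(1) by (simp add: X_def)
  obtain ss where ss: "set ss \<subseteq> simple_reflections" "c = matrix_word ss *v b"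
    using c(1) by (auto simp: X_def)
  have "c \<in> simple"
  proof (rule ccontr)
    assume not_simple: "c \<notin> simple"
    obtain f where f: "\<And>a. a \<in> simple \<Longrightarrow> 0 \<le> f a" "c = (\<Sum>a\<in>simple. f a *\<^sub>R a)"
      using positive_combination[OF cpos] by blast
    have "ip c c = 1" using cpos has_root_unit by (auto simp: positive_def roots_def)
    then have "(\<Sum>a\<in>simple. f a * ip c a) = 1"
      using arg_cong[OF f(2), of "ip c"] by (simp add: ip_sum_right ip_scale_right)
    then obtain a where a: "a \<in> simple" "f a * ip c a > 0"
      using sum_nonpos[of simple "\<lambda>a. f a * ip c a"] by (force simp: not_less)
    then have "ip c a > 0" using f(1)[OF a(1)] by (simp add: zero_less_mult_iff)
    have "a \<in> roots" using a(1) simple_positive by (auto simp: positive_def)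
    then obtain s where s: "s \<in> G" "has_root s a" by (auto simp: roots_def)
    have "s *v c \<in> positive"
      using simple_reflection_positive[OF a(1) s cpos] not_simple a(1) by blast
    then have "s *v c \<in> X"
      using ss s a(1) unfolding X_def
      by (auto simp: simple_reflections_def matrix_vector_mul_assoc intro!: exI[of _ "s # ss"])
    from c(2)[OF this] have "2 * ip c a * ip a z \<le> 0"
      by (simp add: has_root_apply[OF s(2)] ip_diff_left ip_scale_left)
    moreover have "ip a z > 0" using a(1) simple_positive by (auto simp: positive_def)
    ultimately show False using \<open>ip c a > 0\<close> by (simp add: mult_le_0_iff)
  qed
  then show ?thesis using ss by blast
qed

lemma simple_reflections_generate:
  assumes "g \<in> G"
  shows "\<exists>ss. set ss \<subseteq> simple_reflections \<and> g = matrix_word ss"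
  using assms
proof (induction rule: group_induct)
  case one
  show ?case by (intro exI[of _ "[]"]) simp
next
  case (reflection s)
  obtain a where a: "has_root s a" using ex_root[OF reflection] by blast
  obtain b where b: "has_root s b" "b \<in> positive"
  proof (cases "ip a z > 0")
    case True
    then show ?thesis using that[OF a] a reflection by (auto simp: positive_def roots_def)
  next
    case False
    moreover have "a \<in> roots" using a reflection by (auto simp: roots_def)
    ultimately have "- a \<in> positive" using regular[of a] root_minus by (simp add: positive_def ip_minus_left)
    then show ?thesis using that[OF has_root_minus[OF a]] by blast
  qed
  obtain ss where ss: "set ss \<subseteq> simple_reflections" "matrix_word ss *v b \<in> simple"
    using positive_root_to_simple[OF b(2)] by blast
  let ?u = "matrix_word ss" and ?u' = "matrix_word (rev ss)"
  have u'u: "?u' ** ?u = mat 1"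
    using ss(1) simple_reflection_involution by (intro matrix_word_rev) blast
  have uu': "?u ** ?u' = mat 1"
    using matrix_word_rev[of "rev ss"] ss(1) simple_reflection_involution by auto
  have "has_root (?u ** s ** ?u') (?u *v b)"
    using has_root_conjugate[OF simple_word_in[OF ss(1)] u'u uu' b(1)] .
  moreover have "?u ** s ** ?u' \<in> G"
    using mult_in simple_word_in[of ss] simple_word_in[of "rev ss"] ss(1) reflection(1) by simp
  ultimately have "?u ** s ** ?u' \<in> simple_reflections" using ss(2) by (auto simp: simple_reflections_def)
  moreover have "matrix_word (rev ss @ (?u ** s ** ?u') # ss) = (?u' ** ?u) ** s ** (?u' ** ?u)"
    by (simp add: matrix_word_append matrix_mul_assoc)
  then have "s = matrix_word (rev ss @ (?u ** s ** ?u') # ss)" using u'u by simp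
  ultimately show ?case using ss(1) by (intro exI[of _ "rev ss @ (?u ** s ** ?u') # ss"]) simp
next
  case (mult g h)
  then obtain ss ts where "set ss \<subseteq> simple_reflections" "g = matrix_word ss"
    "set ts \<subseteq> simple_reflections" "h = matrix_word ts" by blast
  then show ?case by (intro exI[of _ "ss @ ts"]) (simp add: matrix_word_append)
qed

lemma word_sign_change:
  assumes "set ts \<subseteq> simple_reflections" "a \<in> positive" "matrix_word ts *v a \<notin> positive"
  shows "\<exists>us t vs. ts = us @ t # vs \<and> matrix_word vs *v a \<in> positive \<and> t *v (matrix_word vs *v a) \<notin> positive"
  using assms
proof (induction ts)
  case (Cons t ts)
  show ?case
  proof (cases "matrix_word ts *v a \<in> positive")
    case True
    then show ?thesis
      using Cons.prems(3) by (intro exI[of _ "[]"] exI[of _ t] exI[of _ ts]) (simp add: matrix_vector_mul_assoc)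
  next
    case False
    then obtain us t' vs where "ts = us @ t' # vs" "matrix_word vs *v a \<in> positive"
      "t' *v (matrix_word vs *v a) \<notin> positive" using Cons by auto
    then show ?thesis by (intro exI[of _ "t # us"] exI[of _ t'] exI[of _ vs]) simp
  qed
qed simp

text \<open>
  The group acts freely on chambers.  In a shortest word of simple reflections for an element that
  preserves the positive roots, the last root changes sign along the word, at a letter that can be
  cancelled against the last one.
\<close>

lemma preserves_positive_imp_one:
  assumes "w \<in> G" "\<And>a. a \<in> positive \<Longrightarrow> w *v a \<in> positive"
  shows "w = mat 1"
proof -
  have "\<exists>ss. (set ss \<subseteq> simple_reflections \<and> w = matrix_word ss) \<and>
      (\<forall>ts. set ts \<subseteq> simple_reflections \<and> w = matrix_word ts \<longrightarrow> length ss \<le> length ts)"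
    using simple_reflections_generate[OF assms(1)] by (elim exE) (rule ex_has_least_nat)
  then obtain ss where ss: "set ss \<subseteq> simple_reflections" "w = matrix_word ss"
    and shortest: "\<And>ts. set ts \<subseteq> simple_reflections \<Longrightarrow> w = matrix_word ts \<Longrightarrow> length ss \<le> length ts" by blast
  show ?thesis
  proof (cases ss rule: rev_cases)
    case Nil
    then show ?thesis using ss by simp
  next
    case (snoc ts s)
    then obtain a where a: "a \<in> simple" "has_root s a" "s \<in> G"
      using ss(1) by (auto simp: simple_reflections_def)
    have apos: "a \<in> positive" using a(1) simple_positive by blast
    have "w *v a = - (matrix_word ts *v a)"
      using ss(2) snoc has_root_self[OF a(2)] matrix_vector_mult_scaleR[of "matrix_word ts" "-1" a]
      by (simp add: matrix_word_append flip: matrix_vector_mul_assoc)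
    then have "ip (matrix_word ts *v a) z < 0"
      using assms(2)[OF apos] by (simp add: positive_def ip_minus_left)
    then have "matrix_word ts *v a \<notin> positive" by (simp add: positive_def)
    moreover have ts: "set ts \<subseteq> simple_reflections" using ss(1) snoc by simp
    ultimately obtain us t vs where dec: "ts = us @ t # vs" "matrix_word vs *v a \<in> positive"
      "t *v (matrix_word vs *v a) \<notin> positive"
      using word_sign_change apos by blast
    have vs: "set vs \<subseteq> simple_reflections" and us: "set us \<subseteq> simple_reflections" using dec(1) ts by auto
    have "t \<in> simple_reflections" using dec(1) ts by auto
    then obtain b where b: "b \<in> simple" "has_root t b" "t \<in> G" by (auto simp: simple_reflections_def)
    have eq: "matrix_word vs *v a = b"
      using simple_reflection_positive[OF b(1,3,2) dec(2)] dec(3) by blast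
    have "matrix_word vs ** s = t ** matrix_word vs"
      unfolding matrix_eq
    proof
      fix x
      have "ip (matrix_word vs *v x) b = ip x a"
        unfolding eq[symmetric] by (rule ip_invariant[OF simple_word_in[OF vs]])
      then show "(matrix_word vs ** s) *v x = (t ** matrix_word vs) *v x"
        by (simp add: matrix_vector_mul_assoc[symmetric] has_root_apply[OF a(2)] has_root_apply[OF b(2)]
            matrix_vector_mult_diff_distrib matrix_vector_mult_scaleR eq)
    qed
    then have "matrix_word ss = matrix_word us ** (t ** t) ** matrix_word vs"
      by (simp add: snoc dec(1) matrix_word_append matrix_mul_assoc[symmetric])
    then have "w = matrix_word (us @ vs)"
      using ss(2) has_root_involution[OF b(2)] by (simp add: matrix_word_append)
    then have "length ss \<le> length (us @ vs)" using us vs by (intro shortest) auto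
    then show ?thesis by (simp add: snoc dec(1))
  qed
qed

end

section \<open>Stabilizers\<close>

definition real_part :: "complex ^ 'n \<Rightarrow> real ^ 'n" where "real_part v = (\<chi> i. Re (v $ i))"
definition imag_part :: "complex ^ 'n \<Rightarrow> real ^ 'n" where "imag_part v = (\<chi> i. Im (v $ i))"
definition complexify :: "real ^ 'n \<Rightarrow> complex ^ 'n" where "complexify x = (\<chi> i. complex_of_real (x $ i))"

lemma act_complexify: "act g (complexify x) = complexify (g *v x)"
  by (simp add: vec_eq_iff act_nth complexify_def matrix_vector_mult_def)

lemma complexify_eq_iff: "complexify x = complexify y \<longleftrightarrow> x = y"
  by (simp add: vec_eq_iff complexify_def)

lemma act_fixes_iff:
  "act g v = v \<longleftrightarrow> g *v real_part v = real_part v \<and> g *v imag_part v = imag_part v"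
  by (auto simp: vec_eq_iff act_nth complex_eq_iff real_part_def imag_part_def matrix_vector_mult_def
      Re_sum Im_sum)

context matrix_group
begin

lemma ex_generic_real_vector:
  fixes E :: "(real ^ 'n) set"
  assumes "subspace E"
  shows "\<exists>e\<in>E. \<forall>g\<in>G. g *v e = e \<longrightarrow> (\<forall>x\<in>E. g *v x = x)"
  using ex_generic_vector_of_maps[of "(*v) ` G" E] finite_group assms by auto

text \<open>
  Choose \<open>p\<close> such that \<open>p g z\<close> is as close as possible to \<open>z\<close>.  If the hyperplane of a reflection \<open>t\<close>
  in \<open>P\<close> separated the two, then \<open>t p g z\<close> would be closer.
\<close>

lemma ex_closest:
  assumes z: "\<And>a. a \<in> roots \<Longrightarrow> ip a z \<noteq> 0"
    and P: "P \<subseteq> G" "mat 1 \<in> P" "\<And>p q. p \<in> P \<Longrightarrow> q \<in> P \<Longrightarrow> p ** q \<in> P"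
    and g: "g \<in> G"
  shows "\<exists>p\<in>P. \<forall>t a. t \<in> P \<longrightarrow> has_root t a \<longrightarrow> ip a ((p ** g) *v z) * ip a z > 0"
proof -
  have "finite P" using P(1) finite_group finite_subset by blast
  then have "finite ((\<lambda>p. ip ((p ** g) *v z) z) ` P)" "(\<lambda>p. ip ((p ** g) *v z) z) ` P \<noteq> {}" using P(2) by auto
  from Max_in[OF this] Max_ge[OF this(1)] obtain p where p: "p \<in> P"
    "\<And>q. q \<in> P \<Longrightarrow> ip ((q ** g) *v z) z \<le> ip ((p ** g) *v z) z" by auto
  show ?thesis
  proof (intro bexI[OF _ p(1)] allI impI)
    fix t a assume t: "t \<in> P" "has_root t a"
    let ?y = "(p ** g) *v z"
    have "ip ((t ** p ** g) *v z) z \<le> ip ?y z" using p(2)[OF P(3)[OF t(1) p(1)]] .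
    then have "ip (t *v ?y) z \<le> ip ?y z"
      by (simp add: matrix_vector_mul_assoc matrix_mul_assoc)
    then have "ip ?y a * ip a z \<ge> 0"
      by (simp add: has_root_apply[OF t(2)] ip_diff_left ip_scale_left mult.commute)
    moreover have a: "a \<in> roots" using t P(1) by (auto simp: roots_def)
    then have "ip a z \<noteq> 0" by (rule z)
    moreover have "ip a ?y \<noteq> 0"
    proof -
      have pg: "p ** g \<in> G" using mult_in p(1) P(1) g by blast
      then obtain h where h: "h \<in> G" "h ** (p ** g) = mat 1" using inverse_in by blast
      have "ip a ?y = ip (h *v a) (h *v ?y)" using ip_invariant[OF h(1)] by simp
      also have "h *v ?y = z" using h(2) by (simp add: matrix_vector_mul_assoc)
      finally show ?thesis using z[OF root_image[OF h(1) a]] by simp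
    qed
    ultimately show "ip a ?y * ip a z > 0" by (simp add: ip_commute[of a ?y] less_le)
  qed
qed

text \<open>
  An element that acts on \<open>E\<close> by a scalar can be corrected by the pointwise stabilizer of \<open>E\<close>
  to an element that preserves a chamber of that stabilizer, and an orbit sum in this chamber is
  fixed.  The sum is not zero if the stabilizer contains a reflection.
\<close>

lemma ex_fixing_element:
  assumes g: "g \<in> G" "\<And>x. x \<in> E \<Longrightarrow> act g x = c *s x"
    and t0: "t0 \<in> G" "reflection t0" "\<And>x. x \<in> E \<Longrightarrow> act t0 x = x"
  shows "\<exists>h\<in>G. (\<forall>x\<in>E. act h x = c *s x) \<and> (\<exists>y. y \<noteq> 0 \<and> h *v y = y)"
proof -
  define P where "P = {p \<in> G. \<forall>x\<in>E. act p x = x}"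
  obtain z where z: "\<And>a. a \<in> roots \<Longrightarrow> ip a z \<noteq> 0" using ex_regular by blast
  have "\<exists>p\<in>P. \<forall>t a. t \<in> P \<longrightarrow> has_root t a \<longrightarrow> ip a ((p ** g) *v z) * ip a z > 0"
    by (rule ex_closest[OF z _ _ _ g(1)]) (auto simp: P_def one_in act_one mult_in act_mult)
  then obtain p where p: "p \<in> P"
    "\<And>t a. t \<in> P \<Longrightarrow> has_root t a \<Longrightarrow> ip a ((p ** g) *v z) * ip a z > 0" by blast
  define h where "h = p ** g"
  have hG: "h \<in> G" using p(1) g(1) mult_in by (simp add: h_def P_def)
  have hE: "act h x = c *s x" if "x \<in> E" for x
    using p(1) g(2)[OF that] that by (simp add: h_def act_mult act_scale P_def)
  obtain h' where h': "h' \<in> G" "h' ** h = mat 1" "h ** h' = mat 1" using inverse_in[OF hG] by blast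
  have conj: "h' ** t ** h \<in> P" if "t \<in> P" for t
  proof -
    have "act (h' ** t ** h) x = x" if x: "x \<in> E" for x
    proof -
      have "act t (act h x) = act h x" using \<open>t \<in> P\<close> x by (simp add: hE act_scale P_def)
      then have "act (h' ** t ** h) x = act (h' ** h) x" by (simp add: act_mult)
      then show ?thesis by (simp add: h' act_one)
    qed
    then show ?thesis using that hG h'(1) mult_in by (simp add: P_def)
  qed
  \<comment> \<open>Multiplication by \<open>h\<close> permutes the elements that keep \<open>z\<close> in its chamber for \<open>P\<close>.\<close>
  define K where "K = {k \<in> G. \<forall>t a. t \<in> P \<longrightarrow> has_root t a \<longrightarrow> ip a (k *v z) * ip a z > 0}"
  have finK: "finite K" using finite_group by (simp add: K_def)
  have "mat 1 \<in> K"
  proof -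
    have "ip a z * ip a z > 0" if "t \<in> P" "has_root t a" for t a
    proof -
      have "a \<in> roots" using that by (auto simp: P_def roots_def)
      from z[OF this] show ?thesis using not_real_square_gt_zero[of "ip a z"] by blast
    qed
    then show ?thesis by (auto simp: K_def one_in)
  qed
  have hK: "h ** k \<in> K" if k: "k \<in> K" for k
    unfolding K_def mem_Collect_eq
  proof (intro conjI allI impI)
    show "h ** k \<in> G" using k hG mult_in by (simp add: K_def)
    fix t a assume t: "t \<in> P" "has_root t a"
    have root: "has_root (h' ** t ** h) (h' *v a)" using has_root_conjugate[OF h'(1,3,2) t(2)] .
    have eq: "ip (h' *v a) x = ip a (h *v x)" for x
      using ip_invariant[OF hG, of "h' *v a" x] h'(3) by (simp add: matrix_vector_mul_assoc)
    have "ip (h' *v a) (k *v z) * ip (h' *v a) z > 0"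
      using k conj[OF t(1)] root by (auto simp: K_def)
    then have "ip a ((h ** k) *v z) * ip a (h *v z) > 0" by (simp add: eq matrix_vector_mul_assoc)
    moreover have "ip a (h *v z) * ip a z > 0" using p(2)[OF t] by (simp add: h_def)
    ultimately show "ip a ((h ** k) *v z) * ip a z > 0" by (auto simp: zero_less_mult_iff)
  qed
  have inj: "inj_on (\<lambda>k. h ** k) K"
  proof (rule inj_onI)
    fix k l assume "h ** k = h ** l"
    then have "h' ** h ** k = h' ** h ** l" by (simp add: matrix_mul_assoc[symmetric])
    then show "k = l" by (simp add: h'(2))
  qed
  have bij: "bij_betw (\<lambda>k. h ** k) K K"
    using inj endo_inj_surj[OF finK _ inj] hK by (auto simp: bij_betw_def)
  define y where "y = (\<Sum>k\<in>K. k *v z)"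
  have "h *v y = (\<Sum>k\<in>K. (h ** k) *v z)"
    unfolding y_def by (induction K rule: infinite_finite_induct)
      (simp_all add: matrix_vector_right_distrib matrix_vector_mul_assoc)
  also have "\<dots> = y" unfolding y_def by (rule sum.reindex_bij_betw[OF bij])
  finally have "h *v y = y" .
  moreover have "y \<noteq> 0"
  proof
    assume "y = 0"
    obtain a where a: "has_root t0 a" using ex_root[OF t0(1,2)] by blast
    have t0P: "t0 \<in> P" using t0 by (simp add: P_def)
    have "ip a y * ip a z = (\<Sum>k\<in>K. ip a (k *v z) * ip a z)"
      by (simp add: y_def ip_sum_right sum_distrib_right)
    also have "\<dots> > 0"
      using finK \<open>mat 1 \<in> K\<close> a t0P by (intro sum_pos) (auto simp: K_def)
    finally show False using \<open>y = 0\<close> ip_zero_left[of a] by (simp add: ip_commute[of a 0])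
  qed
  ultimately show ?thesis using hG hE by blast
qed

end

context reflection_group
begin

text \<open>
  Let \<open>w\<close> fix \<open>u\<close>, and let \<open>z\<close> be off all hyperplanes.  After a correction of \<open>w\<close> by the reflections that
  fix \<open>u\<close>, the images of \<open>z\<close> and of \<open>u + \<epsilon> z\<close> are on the same side of the hyperplanes through \<open>u\<close>
  as before.  For the other hyperplanes this holds when \<open>\<epsilon>\<close> is small.  So the corrected element
  preserves a chamber and is trivial.
\<close>

lemma real_stabilizer_generated:
  "generate GL {s \<in> G. s *v u = u \<and> reflection s} = {g \<in> G. g *v u = u}"
proof
  let ?H = "{s \<in> G. s *v u = u \<and> reflection s}" and ?S = "{g \<in> G. g *v u = u}"
  define P where "P = generate GL ?H"
  have H: "?H \<subseteq> carrier GL" using reflection_in_GL by blast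
  have subP: "subgroup P GL" unfolding P_def by (rule group.generate_is_subgroup[OF group_GL H])
  have "g \<in> ?S" if "g \<in> generate GL ?H" for g
    using that
  proof induction
    case (inv h)
    then show ?case using inv_reflection[of h] by simp
  qed (auto simp: GL_def one_in mult_in simp flip: matrix_vector_mul_assoc)
  then have PS: "P \<subseteq> ?S" unfolding P_def by (rule subsetI)
  then show "generate GL ?H \<subseteq> ?S" by (simp add: P_def)
  show "?S \<subseteq> generate GL ?H"
  proof
    fix w assume w: "w \<in> ?S"
    obtain z where z: "\<And>a. a \<in> roots \<Longrightarrow> ip a z \<noteq> 0" using ex_regular by blast
    have "\<exists>p\<in>P. \<forall>t a. t \<in> P \<longrightarrow> has_root t a \<longrightarrow> ip a ((p ** w) *v z) * ip a z > 0"
    proof (rule ex_closest[OF z])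
      show "mat 1 \<in> P" using subgroup.one_closed[OF subP] by (simp add: GL_def)
      show "p ** q \<in> P" if "p \<in> P" "q \<in> P" for p q
        using subgroup.m_closed[OF subP that] by (simp add: GL_def)
    qed (use PS w in auto)
    then obtain p where p: "p \<in> P"
      "\<And>t a. t \<in> P \<Longrightarrow> has_root t a \<Longrightarrow> ip a ((p ** w) *v z) * ip a z > 0" by blast
    define g where "g = p ** w"
    have gG: "g \<in> G" and gu: "g *v u = u"
      using p(1) PS w mult_in by (auto simp: g_def simp flip: matrix_vector_mul_assoc)
    define A where "A = {a \<in> roots. ip a u \<noteq> 0}"
    have finA: "finite A" using finite_roots by (simp add: A_def)
    define \<epsilon> where "\<epsilon> = Min (insert 1 ((\<lambda>a. \<bar>ip a u\<bar> / (\<bar>ip a z\<bar> + \<bar>ip a (g *v z)\<bar> + 1)) ` A))"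
    have \<epsilon>: "\<epsilon> > 0"
      using finA unfolding \<epsilon>_def by (subst Min_gr_iff) (auto simp: A_def intro!: divide_pos_pos add_nonneg_pos)
    have \<epsilon>_small: "\<epsilon> * \<bar>ip a z\<bar> < \<bar>ip a u\<bar>" "\<epsilon> * \<bar>ip a (g *v z)\<bar> < \<bar>ip a u\<bar>" if "a \<in> A" for a
    proof -
      let ?D = "\<bar>ip a z\<bar> + \<bar>ip a (g *v z)\<bar> + 1"
      have "\<epsilon> \<le> \<bar>ip a u\<bar> / ?D" using finA that unfolding \<epsilon>_def by (intro Min_le) auto
      then have "\<epsilon> * ?D \<le> \<bar>ip a u\<bar>" by (simp add: pos_le_divide_eq add_nonneg_pos)
      moreover have "\<epsilon> * \<bar>ip a z\<bar> < \<epsilon> * ?D" "\<epsilon> * \<bar>ip a (g *v z)\<bar> < \<epsilon> * ?D"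
        using \<epsilon> by (auto intro!: mult_strict_left_mono)
      ultimately show "\<epsilon> * \<bar>ip a z\<bar> < \<bar>ip a u\<bar>" "\<epsilon> * \<bar>ip a (g *v z)\<bar> < \<bar>ip a u\<bar>" by linarith+
    qed
    define z' where "z' = u + \<epsilon> *\<^sub>R z"
    have gz': "g *v z' = u + \<epsilon> *\<^sub>R (g *v z)"
      by (simp add: z'_def matrix_vector_right_distrib matrix_vector_mult_scaleR gu)
    have same_side: "ip a (g *v z') * ip a z' > 0" if a: "a \<in> roots" for a
    proof (cases "ip a u = 0")
      case True
      obtain t where t: "t \<in> G" "has_root t a" using a by (auto simp: roots_def)
      have "t *v u = u" using True by (simp add: has_root_apply[OF t(2)] ip_commute[of u a])
      then have "t \<in> P"
        using t reflection_if_root by (auto simp: P_def intro!: generate.incl)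
      then have "ip a (g *v z) * ip a z > 0" using p(2) t(2) by (simp add: g_def)
      then show ?thesis
        using True \<epsilon> unfolding gz' unfolding z'_def ip_add_right ip_scale_right
        by (simp add: zero_less_mult_iff mult_less_0_iff)
    next
      case False
      then have "a \<in> A" using a by (simp add: A_def)
      have "\<bar>\<epsilon> * ip a z\<bar> = \<epsilon> * \<bar>ip a z\<bar>" "\<bar>\<epsilon> * ip a (g *v z)\<bar> = \<epsilon> * \<bar>ip a (g *v z)\<bar>"
        using \<epsilon> by (simp_all add: abs_mult)
      then have "(ip a u > 0 \<longrightarrow> ip a u + \<epsilon> * ip a (g *v z) > 0 \<and> ip a u + \<epsilon> * ip a z > 0) \<and>
          (ip a u < 0 \<longrightarrow> ip a u + \<epsilon> * ip a (g *v z) < 0 \<and> ip a u + \<epsilon> * ip a z < 0)"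
        using \<epsilon>_small[OF \<open>a \<in> A\<close>] by linarith
      then show ?thesis
        using False unfolding gz' unfolding z'_def ip_add_right ip_scale_right zero_less_mult_iff
        by (meson linorder_neqE_linordered_idom)
    qed
    interpret chamber G z'
    proof
      show "ip a z' \<noteq> 0" if "a \<in> roots" for a using same_side[OF that] by auto
    qed
    have "g = mat 1"
    proof (rule preserves_positive_imp_one[OF gG])
      fix a assume a: "a \<in> positive"
      have ga: "g *v a \<in> roots" using a root_image[OF gG] by (simp add: positive_def)
      have "ip (g *v a) (g *v z') > 0" using a ip_invariant[OF gG] by (simp add: positive_def)
      then show "g *v a \<in> positive"
        using ga same_side[OF ga] by (simp add: positive_def zero_less_mult_iff)
    qed
    then have pw: "p ** w = mat 1" by (simp add: g_def)
    have pc: "p \<in> carrier GL" using subgroup.mem_carrier[OF subP p(1)] .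
    have wc: "w \<in> carrier GL" using inverse_in w by (auto simp: GL_def invertible_def)
    have "w = inv\<^bsub>GL\<^esub> p"
      using group.inv_equality[OF group_GL, of p w] group.inv_inv[OF group_GL wc] pw pc wc
      by (metis GL_def group.inv_equality group_GL monoid.simps(1) monoid.simps(2))
    then show "w \<in> generate GL ?H" using subgroup.m_inv_closed[OF subP p(1)] by (simp add: P_def)
  qed
qed

text \<open>
  The stabilizer of a complex vector is that of a generic vector in the span of its real and imaginary
  parts.
\<close>

theorem stabilizer_reflection_group:
  "reflection_group {g \<in> G. act g v = v}"
proof
  show "finite {g \<in> G. act g v = v}" using finite_group by simp
  obtain u where u: "u \<in> span {real_part v, imag_part v}"
    "\<And>g x. g \<in> G \<Longrightarrow> g *v u = u \<Longrightarrow> x \<in> span {real_part v, imag_part v} \<Longrightarrow> g *v x = x"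
    using ex_generic_real_vector[of "span {real_part v, imag_part v}"] by auto
  have fix_span: "g *v x = x" if "g *v real_part v = real_part v" "g *v imag_part v = imag_part v"
    "x \<in> span {real_part v, imag_part v}" for g x
  proof -
    have "subspace {x. g *v x = x}"
      by (auto simp: subspace_def matrix_vector_right_distrib matrix_vector_mult_scaleR)
    then have "span {real_part v, imag_part v} \<subseteq> {x. g *v x = x}"
      using that(1,2) by (intro span_minimal) auto
    then show ?thesis using that(3) by blast
  qed
  have iff: "act g v = v \<longleftrightarrow> g *v u = u" if "g \<in> G" for g
    unfolding act_fixes_iff
    using u(2)[OF that] fix_span[OF _ _ u(1)] span_base[of _ "{real_part v, imag_part v}"] by blast
  have "{g \<in> G. act g v = v} = {g \<in> G. g *v u = u}" using iff by blast
  moreover have "{s \<in> {g \<in> G. act g v = v}. reflection s} = {s \<in> G. s *v u = u \<and> reflection s}"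
    using iff by blast
  ultimately show "generate GL {s \<in> {g \<in> G. act g v = v}. reflection s} = {g \<in> G. act g v = v}"
    using real_stabilizer_generated[of u] by simp
qed

lemma regular_vector_stabilizer:
  assumes "regular_vector G v" "g \<in> G" "act g v = v"
  shows "g = mat 1"
proof -
  interpret S: reflection_group "{g \<in> G. act g v = v}" by (rule stabilizer_reflection_group)
  have "g \<in> {g \<in> G. act g v = v}" using assms by simp
  then show ?thesis
  proof (induction rule: S.group_induct)
    case (reflection s)
    then show ?case using assms(1) by (auto simp: regular_vector_def)
  qed simp_all
qed

end

section \<open>Elliptic numbers\<close>

context reflection_group
begin

lemma obtain_eigenspace_setup:
  assumes "0 < m" "z \<noteq> 1" "primitive_root_of_unity m z"
  obtains fs where "eigenspace_setup G fs (degrees G) m z"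
    "card (eigenspace_setup.divisible (degrees G) m) = num_degrees_divisible G m"
proof -
  have "\<exists>ds fs. basic_invariants G fs ds" using ex_basic_invariants by blast
  then have "\<exists>fs. basic_invariants G fs (degrees G)" unfolding degrees_def by (rule someI_ex)
  then obtain fs where "basic_invariants G fs (degrees G)" by blast
  then interpret E: eigenspace_setup G fs "degrees G" m z
    using assms by unfold_locales auto
  show thesis
    by (rule that[OF E.eigenspace_setup_axioms]) (simp add: E.divisible_def num_degrees_divisible_def)
qed

lemma
  assumes "0 < m" "z \<noteq> 1" "primitive_root_of_unity m z"
  shows dim_eigenspace_le_degrees: "g \<in> G \<Longrightarrow> dim (eigenspace g z) \<le> 2 * num_degrees_divisible G m"
    and ex_eigenspace_ge_degrees: "\<exists>g\<in>G. 2 * num_degrees_divisible G m \<le> dim (eigenspace g z)"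
    and eigenvector_conjugate_into:
      "g \<in> G \<Longrightarrow> dim (eigenspace g z) = 2 * num_degrees_divisible G m \<Longrightarrow>
        g' \<in> G \<Longrightarrow> v \<in> eigenspace g' z \<Longrightarrow> \<exists>w\<in>G. act w v \<in> eigenspace g z"
proof -
  obtain fs where E_setup: "eigenspace_setup G fs (degrees G) m z"
    and card: "card (eigenspace_setup.divisible (degrees G) m) = num_degrees_divisible G m"
    by (rule obtain_eigenspace_setup[OF assms])
  interpret E: eigenspace_setup G fs "degrees G" m z by (rule E_setup)
  show "g \<in> G \<Longrightarrow> dim (eigenspace g z) \<le> 2 * num_degrees_divisible G m"
    using E.dim_eigenspace_le card by simp
  show "\<exists>g\<in>G. 2 * num_degrees_divisible G m \<le> dim (eigenspace g z)"
    using E.ex_large_eigenspace card by simp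
  show "g \<in> G \<Longrightarrow> dim (eigenspace g z) = 2 * num_degrees_divisible G m \<Longrightarrow>
        g' \<in> G \<Longrightarrow> v \<in> eigenspace g' z \<Longrightarrow> \<exists>w\<in>G. act w v \<in> eigenspace g z"
    using E.eigenvector_in_large_eigenspace card by simp
qed

lemma parabolic_reflection_group: "parabolic G P \<Longrightarrow> reflection_group P"
  using stabilizer_reflection_group by (auto simp: parabolic_def)

lemma proper_parabolic_in_maximal:
  assumes "proper_parabolic G P"
  obtains Q where "maximal_parabolic G Q" "P \<subseteq> Q"
proof -
  have "{P. proper_parabolic G P} \<subseteq> Pow G"
    by (auto simp: proper_parabolic_def parabolic_def)
  then have "finite {P. proper_parabolic G P}" using finite_group finite_subset by blast
  from finite_has_maximal2[OF this, of P] assms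
  obtain Q where "proper_parabolic G Q" "P \<subseteq> Q" "\<And>Q'. proper_parabolic G Q' \<Longrightarrow> Q \<subseteq> Q' \<Longrightarrow> Q = Q'"
    by auto
  then show thesis using that[of Q] by (simp add: maximal_parabolic_def) metis
qed

end

lemma real_reflection_groupD:
  assumes "real_reflection_group W"
  shows "reflection_group W" "fixed_space W = {0}"
  using assms by (auto simp: real_reflection_group_def reflection_group_def)

lemma proper_parabolic_stabilizer:
  assumes "real_reflection_group W" "v \<noteq> 0"
  shows "proper_parabolic W {g \<in> W. act g v = v}"
proof -
  have "v \<notin> fixed_space W" using real_reflection_groupD(2)[OF assms(1)] assms(2) by simp
  then show ?thesis by (auto simp: proper_parabolic_def parabolic_def fixed_space_def)
qed

lemma ex_primitive_root_of_unity:
  assumes "0 < m"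
  shows "\<exists>z. primitive_root_of_unity m z"
proof -
  let ?z = "cis (2 * pi / m)"
  have pow: "?z ^ k = cis (2 * pi * (k / m))" for k
    by (simp only: Complex.DeMoivre) (simp add: field_simps)
  have "?z ^ k \<noteq> 1" if k: "0 < k" "k < m" for k
  proof
    assume "?z ^ k = 1"
    then have "cos (2 * pi * (k / m)) = 1" using pow by (metis cis.sel(1) one_complex.sel(1))
    then obtain n :: int where "2 * pi * (k / m) = real_of_int n * 2 * pi" using cos_one_2pi_int by blast
    then have "(2 * pi) * (k / m) = (2 * pi) * n" by (simp only: mult_ac)
    then have "real k / m = n" by (simp only: mult_cancel_left) simp
    moreover have "0 < real k / m" "real k / m < 1" using k by auto
    ultimately have "0 < real_of_int n" "real_of_int n < 1" by linarith+
    then have "0 < n" "n < 1" by simp_all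
    then show False by simp
  qed
  moreover have "?z ^ m = 1" using pow[of m] assms by simp
  ultimately show ?thesis by (auto simp: primitive_root_of_unity_def)
qed

lemma primitive_root_of_unity_ne_1:
  "primitive_root_of_unity m z \<Longrightarrow> 1 < m \<Longrightarrow> z \<noteq> 1"
  by (auto simp: primitive_root_of_unity_def)

text \<open>
  If the degree count of some maximal parabolic subgroup \<open>P\<close> were as large as that of \<open>W\<close>, some
  element of \<open>P\<close> would have an eigenspace of largest dimension.  A regular eigenvector can be moved
  into it, and then a conjugate of that element agrees with the given one.
\<close>

lemma elliptic_number_imp_degrees:
  fixes W :: "(real ^ 'n ^ 'n) set"
  assumes W: "real_reflection_group W" and "1 < m" and "elliptic_number W m" and P: "maximal_parabolic W P"
  shows "num_degrees_divisible P m < num_degrees_divisible W m"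
proof (rule ccontr)
  assume le: "\<not> ?thesis"
  interpret W: reflection_group W by (rule real_reflection_groupD(1)[OF W])
  have "parabolic W P" using P by (simp add: maximal_parabolic_def proper_parabolic_def)
  then obtain u where u: "P = {g \<in> W. act g u = u}" by (auto simp: parabolic_def)
  interpret P: reflection_group P by (rule W.parabolic_reflection_group[OF \<open>parabolic W P\<close>])
  obtain g v z where g: "g \<in> W" "elliptic_element W g" and v: "v \<noteq> 0" "regular_vector W v" "act g v = z *s v"
    and z: "primitive_root_of_unity m z"
    using assms(3) by (auto simp: elliptic_number_def has_regular_eigenvector_def)
  have "0 < m" using assms(2) by simp
  note root = \<open>0 < m\<close> primitive_root_of_unity_ne_1[OF z assms(2)] z
  obtain h where h: "h \<in> P" "2 * num_degrees_divisible P m \<le> dim (eigenspace h z)"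
    using P.ex_eigenspace_ge_degrees[OF root] by blast
  have hW: "h \<in> W" using h(1) u by simp
  have "dim (eigenspace h z) = 2 * num_degrees_divisible W m"
    using W.dim_eigenspace_le_degrees[OF root hW] h(2) le by simp
  moreover have "v \<in> eigenspace g z" using v(3) by (simp add: eigenspace_def)
  ultimately obtain w where w: "w \<in> W" "act w v \<in> eigenspace h z"
    using W.eigenvector_conjugate_into[OF root hW _ g(1)] by blast
  obtain w' where w': "w' \<in> W" "w' ** w = mat 1" "w ** w' = mat 1" using W.inverse_in[OF w(1)] by blast
  obtain g' where g': "g' \<in> W" "g' ** g = mat 1" "g ** g' = mat 1" using W.inverse_in[OF g(1)] by blast
  let ?k = "w' ** h ** w"
  have "act w' (act w v) = v" using act_mult[of w' w v] w'(2) by (simp add: act_one)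
  then have "act ?k v = z *s v" using w(2) by (simp add: act_mult eigenspace_def act_scale)
  then have "act (g' ** ?k) v = act (g' ** g) v" by (simp add: act_mult v(3))
  then have "g' ** ?k = mat 1"
    using W.regular_vector_stabilizer[OF v(2), of "g' ** ?k"] W.mult_in g'(1,2) w'(1) hW w(1)
    by (simp add: act_one)
  then have "g ** (g' ** ?k) = g" by simp
  then have k: "?k = g" using g'(3) by (simp add: matrix_mul_assoc)
  let ?u = "act w' u"
  have "act w ?u = u" using act_mult[of w w' u] w'(3) by (simp add: act_one)
  then have "act g ?u = ?u" using h(1) u by (simp add: k[symmetric] act_mult)
  moreover have "u \<noteq> 0"
  proof
    assume "u = 0"
    then have "P = W" using u by (simp add: act_zero)
    then show False using P by (simp add: maximal_parabolic_def proper_parabolic_def)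
  qed
  then have "?u \<noteq> 0" using \<open>act w ?u = u\<close> act_zero by metis
  ultimately show False
    using proper_parabolic_stabilizer[OF W] g by (fastforce simp: elliptic_element_def)
qed

text \<open>
  Under the assumption on degrees, every element with an eigenspace \<open>E\<close> of largest dimension is
  elliptic.  If \<open>E\<close> were contained in a reflecting hyperplane, such an element could be corrected,
  without changing its action on \<open>E\<close>, to one with a nonzero fixed vector, which is not elliptic.
\<close>

lemma degrees_imp_elliptic_number:
  fixes W :: "(real ^ 'n ^ 'n) set"
  assumes W: "real_reflection_group W" and "1 < m"
    and degrees: "\<And>P. maximal_parabolic W P \<Longrightarrow> num_degrees_divisible P m < num_degrees_divisible W m"
  shows "elliptic_number W m"
proof -
  interpret W: reflection_group W by (rule real_reflection_groupD(1)[OF W])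
  have "0 < m" using assms(2) by simp
  obtain z where z: "primitive_root_of_unity m z" using ex_primitive_root_of_unity[OF \<open>0 < m\<close>] by blast
  note root = \<open>0 < m\<close> primitive_root_of_unity_ne_1[OF z assms(2)] z
  have small: "dim (eigenspace h z) < 2 * num_degrees_divisible W m"
    if "proper_parabolic W Q" "h \<in> Q" for h Q
  proof -
    obtain P where P: "maximal_parabolic W P" "Q \<subseteq> P"
      using W.proper_parabolic_in_maximal[OF \<open>proper_parabolic W Q\<close>] by blast
    then have "parabolic W P" by (simp add: maximal_parabolic_def proper_parabolic_def)
    then interpret P: reflection_group P by (rule W.parabolic_reflection_group)
    have "dim (eigenspace h z) \<le> 2 * num_degrees_divisible P m"
      using P.dim_eigenspace_le_degrees[OF root] P(2) \<open>h \<in> Q\<close> by blast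
    then show ?thesis using degrees[OF P(1)] by simp
  qed
  obtain g where g: "g \<in> W" "2 * num_degrees_divisible W m \<le> dim (eigenspace g z)"
    using W.ex_eigenspace_ge_degrees[OF root] by blast
  let ?E = "eigenspace g z"
  have "0 < num_degrees_divisible W m"
  proof -
    have "proper_parabolic W {g \<in> W. act g (axis undefined 1) = axis undefined 1}"
      by (rule proper_parabolic_stabilizer[OF W]) simp
    then obtain P where "maximal_parabolic W P" using W.proper_parabolic_in_maximal by blast
    from degrees[OF this] show ?thesis by simp
  qed
  then have "dim ?E \<noteq> 0" using g(2) by linarith
  then have E: "\<not> ?E \<subseteq> {0}" by simp
  obtain e where e: "e \<in> ?E" "\<And>h x. h \<in> W \<Longrightarrow> act h e = e \<Longrightarrow> x \<in> ?E \<Longrightarrow> act h x = x"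
    using W.ex_generic_vector[OF subspace_eigenspace, of g z] by blast
  have "e \<noteq> 0"
  proof
    assume "e = 0"
    then have "?E \<subseteq> fixed_space W" using e(2) by (auto simp: fixed_space_def act_zero)
    then show False using E real_reflection_groupD(2)[OF W] by simp
  qed
  moreover have "regular_vector W e"
  proof (rule ccontr)
    assume "\<not> ?thesis"
    then obtain t where t: "t \<in> W" "reflection t" "act t e = e" by (auto simp: regular_vector_def)
    have "\<exists>h\<in>W. (\<forall>x\<in>?E. act h x = z *s x) \<and> (\<exists>y. y \<noteq> 0 \<and> h *v y = y)"
      by (rule W.ex_fixing_element[OF g(1) _ t(1,2) e(2)[OF t(1,3)]]) (simp_all add: eigenspace_def)
    then obtain h y where h: "h \<in> W" "\<And>x. x \<in> ?E \<Longrightarrow> act h x = z *s x" "y \<noteq> 0" "h *v y = y" by blast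
    have "?E \<subseteq> eigenspace h z" using h(2) by (auto simp: eigenspace_def)
    then have "2 * num_degrees_divisible W m \<le> dim (eigenspace h z)"
      using g(2) dim_subset order_trans by blast
    moreover have "complexify y \<noteq> 0"
      using h(3) complexify_eq_iff[of y 0] by (simp add: complexify_def vec_eq_iff)
    moreover have "act h (complexify y) = complexify y" using h(4) by (simp add: act_complexify)
    ultimately show False
      using small[OF proper_parabolic_stabilizer[OF W], of "complexify y" h] h(1) by simp
  qed
  ultimately have "has_regular_eigenvector W m g"
    using e(1) z by (auto simp: has_regular_eigenvector_def eigenspace_def)
  moreover have "elliptic_element W g"
    using small g by (fastforce simp: elliptic_element_def)
  ultimately show ?thesis
    using g(1) \<open>0 < m\<close> by (auto simp: elliptic_number_def regular_number_def)
qed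

theorem theorem6p1:
  fixes W :: "(real ^ 'n ^ 'n) set" and m :: nat
  assumes "real_reflection_group W"
    and "0 < m" and "m \<noteq> 1"
  shows "elliptic_number W m \<longleftrightarrow>
    (\<forall>W'. maximal_parabolic W W' \<longrightarrow> num_degrees_divisible W m > num_degrees_divisible W' m)"
proof -
  have "1 < m" using assms(2,3) by simp
  then show ?thesis
    using elliptic_number_imp_degrees[OF assms(1)] degrees_imp_elliptic_number[OF assms(1)] by blast
qed

end
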